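(* Let $R$ be a measurable function on the unit circle $\mathbb T$ with $|R(t)|\le 1$ a.e. and $\log(1-|R|)\in L^1(\mathbb T)$. With the vectors $\check K_{n,m},\widetilde{\check K}_{n,m}\in L^R$ and the functions $\check a_j,\check b_j,\check\omega_j$ on the unit disk defined in the context, for all $n,m\in\mathbb Z$ $$\begin{bmatrix}\check K_{n,m}&\widetilde{\check K}_{n+1,m}\end{bmatrix}=\begin{bmatrix}\widetilde{\check K}_{n,m}&\check K_{n,m+1}\end{bmatrix}\begin{bmatrix}\check\alpha_{n+m}&\check\rho_{n+m}\\ \check\rho_{n+m}&-\overline{\check\alpha}_{n+m}\end{bmatrix},$$ where, for $j\in\mathbb Z$, $$\check\rho_j=\frac{\check a_j(0)}{\check a_{j+1}(0)}>0,\qquad \check\alpha_j=-\check\omega_{j+1}(0)=\overline{\left(\frac{\check b_j(\zeta)}{\zeta}\right)\Big|_{\zeta=0}},$$ and moreover $|\check\alpha_j|<1$ and $\check\rho_j=\sqrt{1-|\check\alpha_j|^2}$.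
   Context: $L^R$ is the Hilbert space of (classes of) measurable functions $f=\begin{bmatrix}f_1\\ f_2\end{bmatrix}:\mathbb T\to\mathbb C^2$ with finite norm for the inner product $\langle f,g\rangle=\int_{\mathbb T} g(t)^*\begin{bmatrix}1&\overline{R(t)}\\R(t)&1\end{bmatrix}^{-1}f(t)\,dm(t)$, $m$ the normalized Lebesgue measure. $U_R$ is the unitary operator of multiplication by the independent variable $t$ on $L^R$. $L^2=L^2(\mathbb T)$, $H^2_+$ is the Hardy space of the disk, $H^2_-=L^2\ominus H^2_+$. For $n,m\in\mathbb Z$ let $\check{\mathcal H}_{n,m}$ be the closure in $L^R$ of $\left\{\begin{bmatrix}1&\overline R\\R&1\end{bmatrix}\begin{bmatrix}t^n h_+\\ \overline t^{\,m}h_-\end{bmatrix}: h_+\in H^2_+,\ h_-\in H^2_-\right\}$. The subspaces $\check{\mathcal H}_{n+1,m}$ and $\check{\mathcal H}_{n,m+1}$ have codimension one in $\check{\mathcal H}_{n,m}$, and $U_R$ maps $\check{\mathcal H}_{n,m+1}$ onto $\check{\mathcal H}_{n+1,m}$. Let $\check K_{n,m}$ be the unit vector in $\check{\mathcal H}_{n,m}\ominus\check{\mathcal H}_{n+1,m}$ normalized by $\left\langle\begin{bmatrix}1\\R\end{bmatrix}t^n,\check K_{n,m}\right\rangle>0$, and let $\widetilde{\check K}_{n,m}$ be the unit vector in $\check{\mathcal H}_{n,m}\ominus\check{\mathcal H}_{n,m+1}$ normalized by $\left\langle\widetilde{\check K}_{n,m},\begin{bmatrix}\overline R\\1\end{bmatrix}\overline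 t^{\,m+1}\right\rangle>0$. Let $A_0=A_{0,n,m}:\check{\mathcal H}_{n,m}\to\check{\mathcal H}_{n,m}$, $A_0h=U_RP_{\check{\mathcal H}_{n,m+1}}h$, where $P$ denotes orthogonal projection. For $|\zeta|<1$ put $$\check b_{n+m}(\zeta)=\zeta\left\langle(I-\zeta A_0^* )^{-1}\widetilde{\check K}_{n,m},\check K_{n,m}\right\rangle,\qquad \check a_{n+m}(\zeta)=\left\langle(I-\zeta A_0^* )^{-1}\begin{bmatrix}1\\R\end{bmatrix}t^n,\check K_{n,m}\right\rangle .$$ Let $P_\perp$ be the orthogonal projection of $L^R$ onto $\check{\mathcal H}_{n,m}^\perp$ and $A_\perp=P_\perp U_R^*|_{\check{\mathcal H}_{n,m}^\perp}$; put $$\check\omega_{n+m}(\zeta)=\left\langle U_R^*\check K_{n,m},\widetilde{\check K}_{n,m}\right\rangle+\zeta\left\langle U_R^*(I-\zeta A_\perp)^{-1}P_\perp U_R^*\check K_{n,m},\widetilde{\check K}_{n,m}\right\rangle .$$ (So $\check b_{n+m}$ and $\check\omega_{n+m}$ are the characteristic functions of the adjoints of the unitary colligations whose feedback coupling is $U_R$.) These functions depend only on the sum $n+m$; they are analytic and bounded by $1$ in the disk, $\check b_{n+m}(0)=0$, and $\check a_{n+m}$ is outer with $\check a_{n+m}(0)>0$. An equality of row matrices of vectors multiplied by scalar matrices is understood by the usual matrix multiplication rule. *)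

theory Defs
  imports "HOL-Analysis.Analysis" "HOL-Library.Complex_Order"
begin

section \<open>The circle and classes of measurable \<open>\<complex>\<^sup>2\<close>-valued functions on it\<close>

text \<open>Normalized Lebesgue measure on the unit circle. Since it is completed,
  \<open>borel_measurable circle_measure\<close> means Lebesgue measurable on the circle; functions on the
  circle are total functions on \<open>complex\<close> whose values off the circle are irrelevant.\<close>

definition circle_measure :: "complex measure" where
  "circle_measure =
     completion (distr (uniform_measure lborel {0..<2*pi}) (restrict_space borel (sphere 0 1)) cis)"

definition L0_eq :: "(complex \<Rightarrow> complex ^ 2) \<Rightarrow> (complex \<Rightarrow> complex ^ 2) \<Rightarrow> bool" where
  "L0_eq f g \<longleftrightarrow> f \<in> borel_measurable circle_measure \<and> g \<in> borel_measurable circle_measure \<and>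
     (AE t in circle_measure. f t = g t)"

quotient_type L0 = "complex \<Rightarrow> complex ^ 2" / partial: L0_eq
proof (rule part_equivpI)
  show "\<exists>f. L0_eq f f"
    by (rule exI[of _ "\<lambda>_. 0"]) (simp add: L0_eq_def)
  show "symp L0_eq"
    by (auto simp: symp_def L0_eq_def)
  show "transp L0_eq"
    by (auto simp: transp_def L0_eq_def)
qed

lemma borel_measurable_vector_scalar_mult:
  fixes f :: "'a \<Rightarrow> complex ^ 2"
  assumes "c \<in> borel_measurable M" "f \<in> borel_measurable M"
  shows "(\<lambda>t. c t *s f t) \<in> borel_measurable M"
proof -
  have "continuous_on UNIV (\<lambda>p :: complex \<times> (complex ^ 2). fst p *s snd p)"
    unfolding vector_scalar_mult_def by (intro continuous_intros)
  then have "(\<lambda>p :: complex \<times> (complex ^ 2). fst p *s snd p) \<in> borel_measurable borel"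
    by (rule borel_measurable_continuous_onI)
  from measurable_compose[OF borel_measurable_Pair[OF assms] this] show ?thesis
    by simp
qed

lemma borel_measurable_circle_ident:
  "(\<lambda>t. t) \<in> borel_measurable circle_measure"
  unfolding circle_measure_def
  by (intro measurable_completion) (simp add: measurable_distr_eq1 measurable_restrict_space1)

instantiation L0 :: ab_group_add
begin

lift_definition zero_L0 :: L0 is "\<lambda>_. 0"
  by (simp add: L0_eq_def)

lift_definition plus_L0 :: "L0 \<Rightarrow> L0 \<Rightarrow> L0" is "\<lambda>f g t. f t + g t"
  by (auto simp: L0_eq_def)

lift_definition minus_L0 :: "L0 \<Rightarrow> L0 \<Rightarrow> L0" is "\<lambda>f g t. f t - g t"
  by (auto simp: L0_eq_def)

lift_definition uminus_L0 :: "L0 \<Rightarrow> L0" is "\<lambda>f t. - f t"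
  by (auto simp: L0_eq_def)

instance
  by standard (transfer; auto simp: L0_eq_def algebra_simps)+

end

lift_definition scale_L0 :: "complex \<Rightarrow> L0 \<Rightarrow> L0"  (infixr "*\<^sub>C" 75) is "\<lambda>c f t. c *s f t"
  by (auto simp: L0_eq_def intro: borel_measurable_vector_scalar_mult)

lift_definition mult_t :: "L0 \<Rightarrow> L0" is "\<lambda>f t. t *s f t"
  by (auto simp: L0_eq_def
      intro: borel_measurable_vector_scalar_mult borel_measurable_circle_ident)


section \<open>Hardy spaces\<close>

text \<open>Square integrable functions on the circle, as representatives of their classes.\<close>

definition L2 :: "(complex \<Rightarrow> complex) set" where
  "L2 = {f \<in> borel_measurable circle_measure. integrable circle_measure (\<lambda>t. (norm (f t))\<^sup>2)}"

definition H2_plus :: "(complex \<Rightarrow> complex) set" where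
  "H2_plus = {f \<in> L2. \<forall>k<0. (\<integral>t. f t * cnj (t powi k) \<partial>circle_measure) = 0}"

definition H2_minus :: "(complex \<Rightarrow> complex) set" where
  "H2_minus = {f \<in> L2. \<forall>g\<in>H2_plus. (\<integral>t. f t * cnj (g t) \<partial>circle_measure) = 0}"


section \<open>The space \<open>L\<^sup>R\<close>\<close>

definition W :: "(complex \<Rightarrow> complex) \<Rightarrow> complex \<Rightarrow> complex ^ 2 ^ 2" where
  "W R t = vector [vector [1, cnj (R t)], vector [R t, 1]]"

text \<open>The integrand \<open>g(t)\<^sup>* W(t)\<^sup>-\<^sup>1 f(t)\<close> for the chosen representatives of \<open>f\<close>, \<open>g\<close>.\<close>

definition ip_density :: "(complex \<Rightarrow> complex) \<Rightarrow> L0 \<Rightarrow> L0 \<Rightarrow> complex \<Rightarrow> complex" where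
  "ip_density R f g t =
     (\<Sum>i\<in>UNIV. cnj (rep_L0 g t $ i) * (matrix_inv (W R t) *v rep_L0 f t) $ i)"

definition ip :: "(complex \<Rightarrow> complex) \<Rightarrow> L0 \<Rightarrow> L0 \<Rightarrow> complex" where
  "ip R f g = (\<integral>t. ip_density R f g t \<partial>circle_measure)"

definition LR :: "(complex \<Rightarrow> complex) \<Rightarrow> L0 set" where
  "LR R = {f. integrable circle_measure (ip_density R f f)}"

definition nrm :: "(complex \<Rightarrow> complex) \<Rightarrow> L0 \<Rightarrow> real" where
  "nrm R f = sqrt (Re (ip R f f))"

definition LR_closure :: "(complex \<Rightarrow> complex) \<Rightarrow> L0 set \<Rightarrow> L0 set" where
  "LR_closure R S = {f \<in> LR R. \<forall>e>0. \<exists>g\<in>S. nrm R (f - g) < e}"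

definition ominus :: "(complex \<Rightarrow> complex) \<Rightarrow> L0 set \<Rightarrow> L0 set \<Rightarrow> L0 set" where
  "ominus R M N = {f \<in> M. \<forall>g\<in>N. ip R f g = 0}"

definition proj :: "(complex \<Rightarrow> complex) \<Rightarrow> L0 set \<Rightarrow> L0 \<Rightarrow> L0" where
  "proj R M f = (THE g. g \<in> M \<and> f - g \<in> ominus R (LR R) M)"

text \<open>Adjoint of an operator \<open>A\<close> on the closed subspace \<open>M\<close>, and \<open>(I - \<zeta> A)\<^sup>-\<^sup>1\<close> on \<open>M\<close>.\<close>

definition adj :: "(complex \<Rightarrow> complex) \<Rightarrow> L0 set \<Rightarrow> (L0 \<Rightarrow> L0) \<Rightarrow> L0 \<Rightarrow> L0" where
  "adj R M A g = (THE h. h \<in> M \<and> (\<forall>f\<in>M. ip R (A f) g = ip R f h))"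

definition resolv :: "L0 set \<Rightarrow> (L0 \<Rightarrow> L0) \<Rightarrow> complex \<Rightarrow> L0 \<Rightarrow> L0" where
  "resolv M A \<zeta> g = (THE f. f \<in> M \<and> f - \<zeta> *\<^sub>C A f = g)"

definition U_adj :: "(complex \<Rightarrow> complex) \<Rightarrow> L0 \<Rightarrow> L0" where
  "U_adj R = adj R (LR R) mult_t"


section \<open>The subspaces and vectors\<close>

definition H_check :: "(complex \<Rightarrow> complex) \<Rightarrow> int \<Rightarrow> int \<Rightarrow> L0 set" where
  "H_check R n m = LR_closure R
     {abs_L0 (\<lambda>t. W R t *v vector [t powi n * hp t, cnj t powi m * hm t]) |hp hm.
        hp \<in> H2_plus \<and> hm \<in> H2_minus}"

definition e_plus :: "(complex \<Rightarrow> complex) \<Rightarrow> int \<Rightarrow> L0" where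
  "e_plus R n = abs_L0 (\<lambda>t. (t powi n) *s vector [1, R t])"

definition e_minus :: "(complex \<Rightarrow> complex) \<Rightarrow> int \<Rightarrow> L0" where
  "e_minus R k = abs_L0 (\<lambda>t. (cnj t powi k) *s vector [cnj (R t), 1])"

text \<open>The order on \<open>complex\<close> is the one of \<open>Complex_Order\<close>: \<open>0 < z\<close> means that \<open>z\<close> is real and positive.\<close>

definition K_check :: "(complex \<Rightarrow> complex) \<Rightarrow> int \<Rightarrow> int \<Rightarrow> L0" where
  "K_check R n m = (THE x. x \<in> ominus R (H_check R n m) (H_check R (n + 1) m) \<and>
     nrm R x = 1 \<and> 0 < ip R (e_plus R n) x)"

definition Kt_check :: "(complex \<Rightarrow> complex) \<Rightarrow> int \<Rightarrow> int \<Rightarrow> L0" where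
  "Kt_check R n m = (THE x. x \<in> ominus R (H_check R n m) (H_check R n (m + 1)) \<and>
     nrm R x = 1 \<and> 0 < ip R x (e_minus R (m + 1)))"


section \<open>The functions on the disk\<close>

definition A0 :: "(complex \<Rightarrow> complex) \<Rightarrow> int \<Rightarrow> int \<Rightarrow> L0 \<Rightarrow> L0" where
  "A0 R n m h = mult_t (proj R (H_check R n (m + 1)) h)"

definition A0_adj :: "(complex \<Rightarrow> complex) \<Rightarrow> int \<Rightarrow> int \<Rightarrow> L0 \<Rightarrow> L0" where
  "A0_adj R n m = adj R (H_check R n m) (A0 R n m)"

definition b_nm :: "(complex \<Rightarrow> complex) \<Rightarrow> int \<Rightarrow> int \<Rightarrow> complex \<Rightarrow> complex" where
  "b_nm R n m \<zeta> =
     \<zeta> * ip R (resolv (H_check R n m) (A0_adj R n m) \<zeta> (Kt_check R n m)) (K_check R n m)"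

definition a_nm :: "(complex \<Rightarrow> complex) \<Rightarrow> int \<Rightarrow> int \<Rightarrow> complex \<Rightarrow> complex" where
  "a_nm R n m \<zeta> =
     ip R (resolv (H_check R n m) (A0_adj R n m) \<zeta> (e_plus R n)) (K_check R n m)"

definition H_perp :: "(complex \<Rightarrow> complex) \<Rightarrow> int \<Rightarrow> int \<Rightarrow> L0 set" where
  "H_perp R n m = ominus R (LR R) (H_check R n m)"

definition A_perp :: "(complex \<Rightarrow> complex) \<Rightarrow> int \<Rightarrow> int \<Rightarrow> L0 \<Rightarrow> L0" where
  "A_perp R n m h = proj R (H_perp R n m) (U_adj R h)"

definition omega_nm :: "(complex \<Rightarrow> complex) \<Rightarrow> int \<Rightarrow> int \<Rightarrow> complex \<Rightarrow> complex" where
  "omega_nm R n m \<zeta> =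
     ip R (U_adj R (K_check R n m)) (Kt_check R n m) +
     \<zeta> * ip R (U_adj R (resolv (H_perp R n m) (A_perp R n m) \<zeta>
              (proj R (H_perp R n m) (U_adj R (K_check R n m))))) (Kt_check R n m)"

text \<open>The functions above depend only on \<open>n + m\<close>, because multiplication by \<open>t\<close> is a unitary map
  that carries all data at \<open>(n, m)\<close> to the data at \<open>(n + 1, m - 1)\<close>.\<close>

definition a_check :: "(complex \<Rightarrow> complex) \<Rightarrow> int \<Rightarrow> complex \<Rightarrow> complex" where
  "a_check R j = a_nm R j 0"

definition b_check :: "(complex \<Rightarrow> complex) \<Rightarrow> int \<Rightarrow> complex \<Rightarrow> complex" where
  "b_check R j = b_nm R j 0"

definition omega_check :: "(complex \<Rightarrow> complex) \<Rightarrow> int \<Rightarrow> complex \<Rightarrow> complex" where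
  "omega_check R j = omega_nm R j 0"

definition rho_check :: "(complex \<Rightarrow> complex) \<Rightarrow> int \<Rightarrow> complex" where
  "rho_check R j = a_check R j 0 / a_check R (j + 1) 0"

definition alpha_check :: "(complex \<Rightarrow> complex) \<Rightarrow> int \<Rightarrow> complex" where
  "alpha_check R j = - omega_check R (j + 1) 0"

text \<open>\<open>log w \<in> L\<^sup>1\<close> for a function \<open>w \<ge> 0\<close>. As \<open>log 0 = -\<infinity>\<close>, this includes \<open>w > 0\<close> almost
  everywhere, which has to be said separately because \<open>ln 0 = 0\<close> in HOL.\<close>

definition log_integrable :: "(complex \<Rightarrow> real) \<Rightarrow> bool" where
  "log_integrable w \<longleftrightarrow> (AE t in circle_measure. 0 < w t) \<and>
     integrable circle_measure (\<lambda>t. ln (w t))"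

end

(* Idea. Inside the two-dimensional space H(n,m) minus H(n+1,m+1), the pairs (K(n,m), Kt(n+1,m)) and
   (Kt(n,m), K(n,m+1)) are orthonormal bases, and the normalizations of the four vectors force the
   unitary matrix between them into the stated form, with alpha = <K(n,m), Kt(n,m)>.  The adjoint of
   A0 is g |-> U^* (g - <g,K> K), so alpha is also read off from b at 0; evaluating omega at 0 and
   shifting by U gives the other formula.
   The analytic input is that the vectors exist, i.e. that the inclusions of the H(n,m) are strict.
   Since x^* W x >= (1 - |R|) |x_i|^2, this reduces to the lower bound
   integral of |1 - t h|^2 (1 - |R|) >= exp (integral of ln (1 - |R|)) / 2 for h in H^2_+, which
   follows from Jensen's inequality for polynomials and density of polynomials in H^2_+. *)

theory Submission
  imports Defs "HOL-Computational_Algebra.Fundamental_Theorem_Algebra"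
begin

section \<open>Normalized Lebesgue measure on the circle\<close>

text \<open>The subspaces H(n,m) are closures, so strictness of an inclusion is a statement about
  distances: the vector spanning the gap must keep a distance from all generators that does not
  depend on the generator. This calls for a quantitative bound of Szego's type, where any positive
  constant will do; the factor 1/2 is the price of |x + y|^2 \<le> 2 |x|^2 + 2 |y|^2 when h is
  replaced by a nearby polynomial. The vectors, projections, adjoints and resolvents are definite
  descriptions, so each requires existence and uniqueness before its formula can be used. Existence
  of the vectors comes from projecting onto closed subspaces, hence from completeness of L^R; a
  triangular factorization of W^-1 turns L^R into two copies of L^2 and reduces this to completeness
  of L^2. The value of b/\<zeta> at 0 is a limit, so the resolvent of A_0^* has to be controlled for
  all small \<zeta>. The functions a and omega are evaluated at 0 itself, where the resolvent in a
  is the identity and the one in omega is multiplied by 0.\<close>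

abbreviation (input) \<mu> :: "complex measure" where
  "\<mu> \<equiv> circle_measure"

lemma measurable_cis_circle:
  "cis \<in> measurable (uniform_measure lborel {0..<2*pi}) (restrict_space borel (sphere 0 1))"
proof (rule measurable_restrict_space2)
  have "cis \<in> borel_measurable borel"
    by (intro borel_measurable_continuous_onI continuous_intros)
  then show "cis \<in> borel_measurable (uniform_measure lborel {0..<2*pi})"
    unfolding uniform_measure_def by (subst measurable_density_eq1) simp
qed (simp add: image_subset_iff)

lemma space_circle_measure [simp]: "space \<mu> = sphere 0 1"
  by (simp add: circle_measure_def space_restrict_space)

lemma emeasure_circle_measure: "emeasure \<mu> (sphere 0 1) = 1"
proof -
  have *: "sphere (0::complex) 1 \<in> sets (restrict_space borel (sphere 0 1))"
    using sets.top[of "restrict_space borel (sphere (0::complex) 1)"]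
    by (simp add: space_restrict_space)
  then have "sphere (0::complex) 1 \<in> sets (distr (uniform_measure lborel {0..<2*pi}) (restrict_space borel (sphere 0 1)) cis)"
    by simp
  then have "emeasure \<mu> (sphere 0 1) =
      emeasure (distr (uniform_measure lborel {0..<2*pi}) (restrict_space borel (sphere 0 1)) cis) (sphere 0 1)"
    unfolding circle_measure_def by (subst emeasure_completion) (auto simp only: sets_completionI_sets main_part)
  also have "\<dots> = emeasure (uniform_measure lborel {0..<2*pi}) UNIV"
    using * by (subst emeasure_distr[OF measurable_cis_circle]) (auto simp: vimage_def)
  also have "\<dots> = 1"
    by (subst emeasure_uniform_measure) (auto simp: divide_ennreal)
  finally show ?thesis .
qed

interpretation circle: finite_measure \<mu>
  by standard (simp add: emeasure_circle_measure)

lemma measure_circle_measure [simp]: "measure \<mu> (sphere 0 1) = 1"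
  by (simp add: measure_def emeasure_circle_measure)

lemma borel_measurable_circle:
  "g \<in> borel_measurable borel \<Longrightarrow> g \<in> borel_measurable \<mu>"
  by (rule measurable_compose[OF borel_measurable_circle_ident])

lemma integral_circle_cong:
  "(\<And>t. norm t = 1 \<Longrightarrow> f t = g t) \<Longrightarrow> integral\<^sup>L \<mu> f = integral\<^sup>L \<mu> g"
  by (rule Bochner_Integration.integral_cong) auto

text \<open>The half-open interval of the definition is traded for the closed one, which differs by
  a null set, so that integrals can be evaluated by the fundamental theorem of calculus on
  \<open>{0..2*pi}\<close>.\<close>

lemma integral_circle_measure:
  fixes g :: "complex \<Rightarrow> complex"
  assumes "g \<in> borel_measurable borel"
  shows "(\<integral>t. g t \<partial>\<mu>) = (\<integral>x. indicator {0..2*pi} x *\<^sub>R g (cis x) \<partial>lborel) / (2*pi)"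
proof -
  let ?S = "restrict_space borel (sphere (0::complex) 1)"
  have g: "g \<in> borel_measurable ?S"
    using assms by (rule measurable_restrict_space1)
  have gc: "(\<lambda>x. g (cis x)) \<in> borel_measurable lborel"
    using measurable_compose[OF borel_measurable_continuous_onI[OF continuous_on_cis[OF continuous_on_id]] assms]
    by simp
  have "(\<integral>t. g t \<partial>\<mu>) = (\<integral>t. g t \<partial>distr (uniform_measure lborel {0..<2*pi}) ?S cis)"
    unfolding circle_measure_def by (rule integral_completion) (use g in simp)
  also have "\<dots> = (\<integral>x. g (cis x) \<partial>uniform_measure lborel {0..<2*pi})"
    by (rule integral_distr[OF measurable_cis_circle g])
  also have "uniform_measure lborel {0..<2*pi} =
      density lborel (\<lambda>x. ennreal (indicator {0..<2*pi} x / (2*pi)))"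
    unfolding uniform_measure_def
    by (rule arg_cong[where f = "density lborel"]) (auto simp: indicator_def divide_ennreal fun_eq_iff
        simp flip: ennreal_1)
  also have "(\<integral>x. g (cis x) \<partial>\<dots>) = (\<integral>x. (indicator {0..<2*pi} x / (2*pi)) *\<^sub>R g (cis x) \<partial>lborel)"
    by (rule integral_density) (use gc in auto)
  also have "\<dots> = (\<integral>x. (indicator {0..2*pi} x *\<^sub>R g (cis x)) / (2*pi) \<partial>lborel)"
  proof (rule integral_cong_AE)
    show "AE x in lborel. (indicator {0..<2 * pi} x / (2 * pi)) *\<^sub>R g (cis x) =
         indicator {0..2 * pi} x *\<^sub>R g (cis x) / complex_of_real (2 * pi)"
      using AE_lborel_singleton[of "2*pi"] by eventually_elim (auto simp: indicator_def scaleR_conv_of_real)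
  qed (use gc in measurable)
  also have "\<dots> = (\<integral>x. indicator {0..2*pi} x *\<^sub>R g (cis x) \<partial>lborel) / (2*pi)"
    by (rule integral_divide_zero)
  finally show ?thesis by simp
qed

lemma borel_measurable_powi [measurable]: "(\<lambda>t::complex. t powi k) \<in> borel_measurable borel"
  unfolding power_int_def by simp

lemma cnj_circle: "norm t = 1 \<Longrightarrow> cnj t = inverse t" for t :: complex
  using complex_norm_square[of t] by (simp add: inverse_unique)

lemma cnj_powi_circle: "norm t = 1 \<Longrightarrow> cnj (t powi k) = t powi (- k)" for t :: complex
  by (metis cnj_circle complex_cnj_power_int power_int_inverse power_int_minus)

lemma integral_powi_circle:
  "(\<integral>t. t powi k \<partial>\<mu>) = (if k = 0 then 1 else 0)"
proof (cases "k = 0")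
  case False
  \<comment> \<open>An antiderivative of e^(ikx); by periodicity it takes the same value at both
    ends of the interval.\<close>
  define F where "F x = cis (x * of_int k) / (\<i> * of_int k)" for x :: real
  have "(\<integral>x. indicator {0..2*pi} x *\<^sub>R cis x powi k \<partial>lborel) = F (2*pi) - F 0"
  proof (rule integral_FTC_Icc)
    fix x :: real
    have "((\<lambda>x. exp (\<i> * of_int k * of_real x) / (\<i> * of_int k)) has_vector_derivative
        exp (\<i> * of_int k * of_real x)) (at x within {0..2 * pi})"
      using False by (auto intro!: derivative_eq_intros has_vector_derivative_real_field)
    then show "(F has_vector_derivative cis x powi k) (at x within {0..2 * pi})"
      unfolding F_def cis_power_int by (simp add: cis_conv_exp mult_ac)
    show "continuous_on {0..2*pi} (\<lambda>x. cis x powi k)"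
      unfolding cis_power_int by (intro continuous_intros)
  qed simp
  also have "\<dots> = 0"
    using cis_multiple_2pi[of "of_int k"] by (simp add: F_def)
  finally show ?thesis
    using False by (simp only: integral_circle_measure[OF borel_measurable_powi] div_0 if_False)
next
  case True
  then show ?thesis
    by (simp only: power_int_0_right if_True simp_thms lebesgue_integral_const space_circle_measure
        measure_circle_measure scaleR_one)
qed

section \<open>Square integrable functions\<close>

lemma borel_measurable_cnj [measurable (raw)]:
  "f \<in> borel_measurable M \<Longrightarrow> (\<lambda>x. cnj (f x)) \<in> borel_measurable M"
  by (erule measurable_compose) (intro borel_measurable_continuous_onI continuous_intros)

lemma L2I:
  assumes "f \<in> borel_measurable \<mu>" "integrable \<mu> g"
    and "AE t in \<mu>. (norm (f t))\<^sup>2 \<le> g t"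
  shows "f \<in> L2"
  unfolding L2_def
proof safe
  show "integrable \<mu> (\<lambda>t. (norm (f t))\<^sup>2)"
    by (rule Bochner_Integration.integrable_bound[OF assms(2)]) (use assms in auto)
qed (use assms in auto)

lemma L2_measurable: "f \<in> L2 \<Longrightarrow> f \<in> borel_measurable \<mu>"
  and L2_integrable: "f \<in> L2 \<Longrightarrow> integrable \<mu> (\<lambda>t. (norm (f t))\<^sup>2)"
  by (auto simp: L2_def)

lemma norm_add_power2_le: "(norm (x + y))\<^sup>2 \<le> 2 * (norm x)\<^sup>2 + 2 * (norm y)\<^sup>2"
  for x y :: "'a::real_normed_vector"
proof -
  have "(norm (x + y))\<^sup>2 \<le> (norm x + norm y)\<^sup>2"
    by (intro power_mono norm_triangle_ineq) auto
  also have "\<dots> \<le> 2 * (norm x)\<^sup>2 + 2 * (norm y)\<^sup>2"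
    using sum_squares_bound[of "norm x" "norm y"] by (simp add: power2_sum)
  finally show ?thesis .
qed

lemma L2_add [intro]: "f \<in> L2 \<Longrightarrow> g \<in> L2 \<Longrightarrow> (\<lambda>t. f t + g t) \<in> L2"
  by (rule L2I[where g = "\<lambda>t. 2 * (norm (f t))\<^sup>2 + 2 * (norm (g t))\<^sup>2"])
     (auto simp: norm_add_power2_le L2_measurable L2_integrable intro!: borel_measurable_add)

lemma L2_mult_bounded:
  assumes "f \<in> L2" "b \<in> borel_measurable \<mu>" "AE t in \<mu>. norm (b t) \<le> C"
  shows "(\<lambda>t. b t * f t) \<in> L2"
proof (rule L2I[where g = "\<lambda>t. C\<^sup>2 * (norm (f t))\<^sup>2"])
  show "AE t in \<mu>. (norm (b t * f t))\<^sup>2 \<le> C\<^sup>2 * (norm (f t))\<^sup>2"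
    using assms(3) by eventually_elim (auto simp: norm_mult power_mult_distrib intro!: mult_right_mono power_mono)
qed (use assms in \<open>auto simp: L2_measurable L2_integrable intro!: borel_measurable_times\<close>)

lemma L2_cmult [intro]: "f \<in> L2 \<Longrightarrow> (\<lambda>t. c * f t) \<in> L2"
  by (rule L2_mult_bounded[where C = "norm c"]) auto

lemma L2_diff [intro]: "f \<in> L2 \<Longrightarrow> g \<in> L2 \<Longrightarrow> (\<lambda>t. f t - g t) \<in> L2"
  using L2_add[of f "\<lambda>t. (-1) * g t"] L2_cmult[of g "-1"] by simp

lemma L2_cnj [intro]: "f \<in> L2 \<Longrightarrow> (\<lambda>t. cnj (f t)) \<in> L2"
  by (auto simp: L2_def intro: borel_measurable_cnj)

lemma L2_bounded:
  assumes "f \<in> borel_measurable \<mu>" "AE t in \<mu>. norm (f t) \<le> C"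
  shows "f \<in> L2"
  by (rule L2I[where g = "\<lambda>t. C\<^sup>2"]) (use assms in \<open>auto elim!: eventually_mono intro!: power_mono\<close>)

lemma L2_mult_integrable:
  assumes "f \<in> L2" "g \<in> L2"
  shows "integrable \<mu> (\<lambda>t. f t * g t)"
proof (rule Bochner_Integration.integrable_bound)
  show "integrable \<mu> (\<lambda>t. (norm (f t))\<^sup>2 + (norm (g t))\<^sup>2)"
    using assms by (intro Bochner_Integration.integrable_add L2_integrable)
  have "norm (f t * g t) \<le> (norm (f t))\<^sup>2 + (norm (g t))\<^sup>2" for t
  proof -
    have "0 \<le> norm (f t) * norm (g t)"
      by simp
    with sum_squares_bound[of "norm (f t)" "norm (g t)"] show ?thesis
      by (simp only: norm_mult)
  qed
  then show "AE t in \<mu>. norm (f t * g t) \<le> norm ((norm (f t))\<^sup>2 + (norm (g t))\<^sup>2)"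
    by (auto simp: abs_of_nonneg)
qed (use assms in \<open>auto simp: L2_measurable intro!: borel_measurable_times\<close>)

lemma L2_imp_integrable: "f \<in> L2 \<Longrightarrow> integrable \<mu> f"
  using L2_mult_integrable[of f "\<lambda>_. 1"] L2_bounded[of "\<lambda>_. 1" 1] by auto

section \<open>Completeness of L^2 on the circle\<close>

definition L2_dist2 :: "(complex \<Rightarrow> complex) \<Rightarrow> (complex \<Rightarrow> complex) \<Rightarrow> real" where
  "L2_dist2 f g = (\<integral>t. (norm (f t - g t))\<^sup>2 \<partial>\<mu>)"

lemma L2_dist2_nonneg [simp]: "0 \<le> L2_dist2 f g"
  by (simp add: L2_dist2_def)

text \<open>Riesz-Fischer: a rapidly Cauchy subsequence converges almost everywhere, and Fatou's
  lemma turns its pointwise limit into a limit in the mean of the whole sequence.\<close>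

lemma L2_complete:
  assumes f: "\<And>n. f n \<in> L2"
    and Cauchy: "\<And>e. e > 0 \<Longrightarrow>
      \<exists>N. \<forall>m\<ge>N. \<forall>n\<ge>N. L2_dist2 (f m) (f n) < e"
  obtains g where "g \<in> L2" "(\<lambda>n. L2_dist2 (f n) g) \<longlonglongrightarrow> 0"
proof -
  note [measurable] = L2_measurable[OF f]
  have int: "integrable \<mu> (\<lambda>t. (norm (f m t - f n t))\<^sup>2)" for m n
    by (intro L2_integrable L2_diff f)
  have "\<forall>k. \<exists>N. \<forall>m\<ge>N. \<forall>n\<ge>N. L2_dist2 (f m) (f n) < (1/4::real)^k"
    using Cauchy by simp
  then obtain N where N: "\<And>k m n. m \<ge> N k \<Longrightarrow> n \<ge> N k \<Longrightarrow>
      L2_dist2 (f m) (f n) < (1/4::real)^k"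
    by metis
  \<comment> \<open>The sum of the \<open>N i\<close> makes both \<open>r k\<close> and
    \<open>r (Suc k)\<close> at least \<open>N k\<close>; the summand \<open>k\<close> makes the
    indices unbounded, which the Fatou step below uses.\<close>
  define r where "r k = k + (\<Sum>i\<le>k. N i)" for k
  have r: "r k \<ge> N k" "r (Suc k) \<ge> N k" "r k \<ge> k" for k
    using member_le_sum[of k "{..k}" N] by (auto simp: r_def)
  \<comment> \<open>The squared steps have integral below 4^-k. Even with the weight 2^k their sum
    is integrable, so almost everywhere d k t \<le> C 2^-k, and the square roots still form a
    geometric series. The weight takes the place of Minkowski's inequality for the sum of the
    steps.\<close>
  define d where "d k t = (norm (f (r (Suc k)) t - f (r k) t))\<^sup>2" for k t
  have [measurable]: "d k \<in> borel_measurable \<mu>" for k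
    unfolding d_def by measurable
  have "(\<integral>\<^sup>+t. (\<Sum>k. ennreal (2^k * d k t)) \<partial>\<mu>) = (\<Sum>k. \<integral>\<^sup>+t. ennreal (2^k * d k t) \<partial>\<mu>)"
    by (rule nn_integral_suminf) measurable
  also have "\<dots> \<le> (\<Sum>k. ennreal ((1/2)^k))"
  proof (intro suminf_le allI)
    fix k
    have "(\<integral>\<^sup>+t. ennreal (2^k * d k t) \<partial>\<mu>) = ennreal (\<integral>t. 2^k * d k t \<partial>\<mu>)"
      using int by (intro nn_integral_eq_integral) (auto simp: d_def)
    also have "(\<integral>t. 2^k * d k t \<partial>\<mu>) \<le> 2^k * (1/4)^k"
      using N[OF r(2) r(1), of k] by (simp add: d_def L2_dist2_def)
    also have "\<dots> = (1/2::real)^k"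
      by (simp flip: power_mult_distrib)
    finally show "(\<integral>\<^sup>+t. ennreal (2^k * d k t) \<partial>\<mu>) \<le> ennreal ((1/2)^k)"
      by (simp add: ennreal_leI)
  qed auto
  also have "\<dots> = ennreal (\<Sum>k. (1/2)^k)"
    by (rule suminf_ennreal2) (auto intro: summable_geometric)
  also have "\<dots> < \<infinity>"
    by simp
  finally have "(\<integral>\<^sup>+t. (\<Sum>k. ennreal (2^k * d k t)) \<partial>\<mu>) \<noteq> \<infinity>"
    by simp
  then have "AE t in \<mu>. (\<Sum>k. ennreal (2^k * d k t)) \<noteq> \<infinity>"
    by (intro nn_integral_PInf_AE) auto
  then have conv: "AE t in \<mu>. convergent (\<lambda>k. f (r k) t)"
  proof eventually_elim
    case (elim t)
    define C where "C = enn2real (\<Sum>k. ennreal (2^k * d k t))"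
    have "2^k * d k t \<le> C" for k
    proof -
      have "ennreal (2^k * d k t) \<le> (\<Sum>k. ennreal (2^k * d k t))"
        using sum_le_suminf[of "\<lambda>k. ennreal (2^k * d k t)" "{k}"] by simp
      also have "\<dots> = ennreal C"
        using elim by (simp add: C_def less_top)
      finally show ?thesis
        by (simp add: C_def ennreal_le_iff)
    qed
    then have "d k t \<le> C * (1/2)^k" for k
      by (simp add: power_divide field_simps)
    then have "sqrt (d k t) \<le> sqrt (C * (1/2)^k)" for k
      by (rule real_sqrt_le_mono)
    then have le: "norm (f (r (Suc k)) t - f (r k) t) \<le> sqrt C * sqrt (1/2) ^ k" for k
      by (simp only: d_def real_sqrt_mult real_sqrt_power) simp
    have "summable (\<lambda>k. sqrt C * sqrt (1/2) ^ k)"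
      by (intro summable_mult summable_geometric) (simp add: real_sqrt_divide)
    then have "summable (\<lambda>k. f (r (Suc k)) t - f (r k) t)"
      by (rule summable_comparison_test') (rule le)
    then have "convergent (\<lambda>n. \<Sum>k<n. f (r (Suc k)) t - f (r k) t)"
      by (simp add: summable_iff_convergent)
    then show ?case
      unfolding sum_lessThan_telescope[of "\<lambda>k. f (r k) t"] convergent_diff_const_right_iff .
  qed
  define g where "g t = lim (\<lambda>k. f (r k) t)" for t
  have [measurable]: "g \<in> borel_measurable \<mu>"
    unfolding g_def by measurable
  have lim: "AE t in \<mu>. (\<lambda>k. f (r k) t) \<longlonglongrightarrow> g t"
    using conv by eventually_elim (simp add: g_def convergent_LIMSEQ_iff)
  \<comment> \<open>Fatou along the subsequence: the distance from \<open>f n\<close> to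
    \<open>g\<close> is at most the lower limit of the distances from \<open>f n\<close> to
    \<open>f (r k)\<close>. The integral is the extended nonnegative one, since \<open>g\<close> is
    not yet known to be in \<open>L2\<close>.\<close>
  have bound: "\<exists>n0. \<forall>n\<ge>n0. (\<integral>\<^sup>+t. ennreal ((norm (f n t - g t))\<^sup>2) \<partial>\<mu>) \<le> ennreal e" if "e > 0" for e
  proof -
    obtain n0 where n0: "\<And>m n. m \<ge> n0 \<Longrightarrow> n \<ge> n0 \<Longrightarrow> L2_dist2 (f m) (f n) < e"
      using Cauchy[OF \<open>e > 0\<close>] by auto
    show ?thesis
    proof (intro exI[of _ n0] allI impI)
      fix n assume "n \<ge> n0"
      have "(\<integral>\<^sup>+t. ennreal ((norm (f n t - g t))\<^sup>2) \<partial>\<mu>) =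
          (\<integral>\<^sup>+t. liminf (\<lambda>k. ennreal ((norm (f n t - f (r k) t))\<^sup>2)) \<partial>\<mu>)"
      proof (rule nn_integral_cong_AE)
        show "AE t in \<mu>. ennreal ((norm (f n t - g t))\<^sup>2) =
            liminf (\<lambda>k. ennreal ((norm (f n t - f (r k) t))\<^sup>2))"
          using lim
        proof eventually_elim
          case (elim t)
          have "(\<lambda>k. ennreal ((norm (f n t - f (r k) t))\<^sup>2)) \<longlonglongrightarrow> ennreal ((norm (f n t - g t))\<^sup>2)"
            by (intro tendsto_intros tendsto_ennrealI elim)
          then show ?case
            by (metis lim_imp_Liminf sequentially_bot)
        qed
      qed
      also have "\<dots> \<le> liminf (\<lambda>k. \<integral>\<^sup>+t. ennreal ((norm (f n t - f (r k) t))\<^sup>2) \<partial>\<mu>)"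
        by (rule nn_integral_liminf) measurable
      also have "\<dots> \<le> liminf (\<lambda>k. ennreal e)"
      proof (rule Liminf_mono, rule eventually_sequentiallyI[of n0])
        fix k assume "k \<ge> n0"
        have "(\<integral>\<^sup>+t. ennreal ((norm (f n t - f (r k) t))\<^sup>2) \<partial>\<mu>) =
            ennreal (L2_dist2 (f n) (f (r k)))"
          unfolding L2_dist2_def by (rule nn_integral_eq_integral[OF int]) auto
        also have "\<dots> \<le> ennreal e"
          using n0[OF \<open>n \<ge> n0\<close>, of "r k"] r(3)[of k] \<open>k \<ge> n0\<close> by (intro ennreal_leI) auto
        finally show "(\<integral>\<^sup>+t. ennreal ((norm (f n t - f (r k) t))\<^sup>2) \<partial>\<mu>) \<le> ennreal e" .
      qed
      also have "\<dots> = ennreal e"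
        by (simp add: Liminf_const)
      finally show "(\<integral>\<^sup>+t. ennreal ((norm (f n t - g t))\<^sup>2) \<partial>\<mu>) \<le> ennreal e" .
    qed
  qed
  obtain n1 where n1: "(\<integral>\<^sup>+t. ennreal ((norm (f n1 t - g t))\<^sup>2) \<partial>\<mu>) \<le> ennreal 1"
    using bound[of 1] by auto
  have "integrable \<mu> (\<lambda>t. (norm (f n1 t - g t))\<^sup>2)"
  proof (rule integrableI_bounded)
    have "(\<integral>\<^sup>+t. ennreal (norm ((norm (f n1 t - g t))\<^sup>2)) \<partial>\<mu>) \<le> ennreal 1"
      using n1 by simp
    also have "\<dots> < \<infinity>"
      by simp
    finally show "(\<integral>\<^sup>+t. ennreal (norm ((norm (f n1 t - g t))\<^sup>2)) \<partial>\<mu>) < \<infinity>" .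
  qed measurable
  then have "(\<lambda>t. f n1 t - g t) \<in> L2"
    by (auto simp: L2_def)
  from L2_diff[OF f[of n1] this] have g: "g \<in> L2"
    by simp
  have "(\<lambda>n. L2_dist2 (f n) g) \<longlonglongrightarrow> 0"
  proof (rule LIMSEQ_I)
    fix e :: real assume "e > 0"
    then obtain n0 where n0: "\<And>n. n \<ge> n0 \<Longrightarrow> (\<integral>\<^sup>+t. ennreal ((norm (f n t - g t))\<^sup>2) \<partial>\<mu>) \<le> ennreal (e/2)"
      using bound[of "e/2"] by auto
    have "norm (L2_dist2 (f n) g) < e" if "n \<ge> n0" for n
    proof -
      have "ennreal (L2_dist2 (f n) g) = (\<integral>\<^sup>+t. ennreal ((norm (f n t - g t))\<^sup>2) \<partial>\<mu>)"
        unfolding L2_dist2_def by (rule nn_integral_eq_integral[symmetric]) (auto intro!: L2_integrable f g)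
      also note n0[OF that]
      finally have "L2_dist2 (f n) g \<le> e / 2"
        using \<open>e > 0\<close> by (subst (asm) ennreal_le_iff) auto
      then show ?thesis
        using \<open>e > 0\<close> by simp
    qed
    then show "\<exists>n0. \<forall>n\<ge>n0. norm (L2_dist2 (f n) g - 0) < e"
      by auto
  qed
  with g show ?thesis by (rule that)
qed

section \<open>A lower bound of Szego's type for polynomials\<close>

lemma borel_measurable_poly [measurable (raw)]:
  fixes p :: "complex poly"
  shows "f \<in> borel_measurable M \<Longrightarrow> (\<lambda>x. poly p (f x)) \<in> borel_measurable M"
  by (erule measurable_compose) (intro borel_measurable_continuous_onI continuous_intros)

text \<open>Mean value property of Re Ln (1 - a t), read off from its power series: for |a| < 1 the
  series is dominated on the circle by a geometric one, and its terms are multiples of positive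
  powers of t, which integrate to 0.\<close>

lemma integral_ln_norm_one_minus:
  fixes a :: complex
  assumes "norm a < 1"
  shows "integrable \<mu> (\<lambda>t. ln (norm (1 - a * t)))"
    and "(\<integral>t. ln (norm (1 - a * t)) \<partial>\<mu>) = 0"
proof -
  \<comment> \<open>The term with n = 0 is 0 because division by 0 gives 0, so the series may start
    at index 0.\<close>
  define f where "f n t = - ((a * t) ^ n) / of_nat n" for n :: nat and t :: complex
  have f_eq: "f n = (\<lambda>t. (- (a ^ n) / of_nat n) * t powi int n)" for n
    by (simp add: f_def power_mult_distrib fun_eq_iff)
  have norm_f: "norm (f n t) \<le> norm a ^ n" if "norm t = 1" for n t
  proof (cases "n = 0")
    case False
    then have "norm (f n t) = norm a ^ n / real n"
      using that by (simp add: f_def norm_divide norm_power norm_mult)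
    also have "\<dots> \<le> norm a ^ n / 1"
      using False by (intro divide_left_mono) auto
    finally show ?thesis by simp
  qed (simp add: f_def)
  have "f n \<in> borel_measurable \<mu>" for n
    unfolding f_eq by (intro borel_measurable_circle) measurable
  then have int: "integrable \<mu> (f n)" for n
    by (intro L2_imp_integrable L2_bounded[where C = "norm a ^ n"] AE_I2 norm_f) auto
  have int0: "(\<integral>t. f n t \<partial>\<mu>) = 0" for n
    by (simp only: f_eq integral_mult_right_zero integral_powi_circle) auto
  have summable_norm: "summable (\<lambda>n. norm a ^ n)"
    using assms by (simp add: summable_geometric)
  have AE_summable: "AE t in \<mu>. summable (\<lambda>n. norm (f n t))"
  proof (rule AE_I2)
    fix t assume "t \<in> space \<mu>"
    then show "summable (\<lambda>n. norm (f n t))"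
      by (intro summable_comparison_test'[OF summable_norm]) (use norm_f in auto)
  qed
  have summable_int: "summable (\<lambda>n. \<integral>t. norm (f n t) \<partial>\<mu>)"
  proof (rule summable_comparison_test'[OF summable_norm])
    fix n :: nat
    have "(\<integral>t. norm (f n t) \<partial>\<mu>) \<le> (\<integral>t. norm a ^ n \<partial>\<mu>)"
      by (rule integral_mono) (use norm_f int in auto)
    then show "norm (\<integral>t. norm (f n t) \<partial>\<mu>) \<le> norm a ^ n"
      by simp
  qed
  have Ln: "(\<Sum>n. f n t) = Ln (1 - a * t)" "1 - a * t \<noteq> 0" if "t \<in> space \<mu>" for t
  proof -
    have *: "norm (a * t) < 1"
      using that assms by (simp add: norm_mult)
    then show "1 - a * t \<noteq> 0"
      by auto
    show "(\<Sum>n. f n t) = Ln (1 - a * t)"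
      using Ln_series'[of "- (a * t)"] * unfolding f_def by (simp add: sums_iff)
  qed
  have eq: "ln (norm (1 - a * t)) = Re (\<Sum>n. f n t)" if "t \<in> space \<mu>" for t
    using Ln[OF that] by (simp add: Re_Ln)
  have S: "integrable \<mu> (\<lambda>t. \<Sum>n. f n t)"
    by (rule integrable_suminf[OF int AE_summable summable_int])
  have "(\<integral>t. (\<Sum>n. f n t) \<partial>\<mu>) = (\<Sum>n. \<integral>t. f n t \<partial>\<mu>)"
    by (rule integral_suminf[OF int AE_summable summable_int])
  then have "(\<integral>t. (\<Sum>n. f n t) \<partial>\<mu>) = 0"
    by (simp add: int0)
  then have "(\<integral>t. Re (\<Sum>n. f n t) \<partial>\<mu>) = 0"
    using S by (simp add: integral_Re)
  then show "(\<integral>t. ln (norm (1 - a * t)) \<partial>\<mu>) = 0"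
    by (subst Bochner_Integration.integral_cong[OF refl eq]) auto
  show "integrable \<mu> (\<lambda>t. ln (norm (1 - a * t)))"
    by (subst Bochner_Integration.integrable_cong[OF refl eq]) (auto intro: integrable_Re S)
qed

text \<open>Jensen's formula for one root off the circle, where the mean is max(0, ln |z|). A root
  inside is reflected, since |z - t| = |1 - cnj z t| for |t| = 1; from a root outside the factor |z|
  is pulled out. In both cases what remains has mean 0.\<close>

lemma integral_ln_norm_minus_ge:
  fixes z :: complex
  assumes "norm z \<noteq> 1" "z \<noteq> 0"
  shows "integrable \<mu> (\<lambda>t. ln (norm (z - t)))"
    and "ln (norm z) \<le> (\<integral>t. ln (norm (z - t)) \<partial>\<mu>)"
proof -
  have "integrable \<mu> (\<lambda>t. ln (norm (z - t))) \<and> ln (norm z) \<le> (\<integral>t. ln (norm (z - t)) \<partial>\<mu>)"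
  proof (cases "norm z < 1")
    case True
    have eq: "ln (norm (z - t)) = ln (norm (1 - cnj z * t))" if "t \<in> space \<mu>" for t
    proof -
      have "norm t = 1"
        using that by simp
      then have "t * cnj t = 1"
        using complex_norm_square[of t] by simp
      then have "z - t = - t * cnj (1 - cnj z * t)"
        by (simp add: algebra_simps)
      then have "norm (z - t) = norm (1 - cnj z * t)"
        using \<open>norm t = 1\<close> by (metis complex_mod_cnj mult_1 norm_minus_cancel norm_mult)
      then show ?thesis by simp
    qed
    have 1: "norm (cnj z) < 1"
      using True by simp
    have "integrable \<mu> (\<lambda>t. ln (norm (z - t)))"
      by (subst Bochner_Integration.integrable_cong[OF refl eq]) (use integral_ln_norm_one_minus[OF 1] in auto)
    moreover have "(\<integral>t. ln (norm (z - t)) \<partial>\<mu>) = 0"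
      by (subst Bochner_Integration.integral_cong[OF refl eq]) (use integral_ln_norm_one_minus[OF 1] in auto)
    ultimately show ?thesis
      using True assms by simp
  next
    case False
    then have "norm (1 / z) < 1"
      using assms by (simp add: norm_divide)
    note 1 = integral_ln_norm_one_minus[OF this]
    have nz: "norm (1 - 1 / z * t) \<noteq> 0" if "t \<in> space \<mu>" for t
    proof
      assume "norm (1 - 1 / z * t) = 0"
      then have "z = t"
        using assms by (simp add: field_simps)
      then show False
        using that assms by simp
    qed
    have eq: "ln (norm (z - t)) = ln (norm z) + ln (norm (1 - 1 / z * t))" if "t \<in> space \<mu>" for t
    proof -
      have "z - t = z * (1 - 1 / z * t)"
        using assms by (simp add: field_simps)
      then have "norm (z - t) = norm z * norm (1 - 1 / z * t)"
        by (simp only: norm_mult)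
      then show ?thesis
        using assms nz[OF that] by (simp add: ln_mult_pos)
    qed
    have "integrable \<mu> (\<lambda>t. ln (norm (z - t)))"
      by (subst Bochner_Integration.integrable_cong[OF refl eq]) (use 1 in auto)
    moreover have "(\<integral>t. ln (norm (z - t)) \<partial>\<mu>) = ln (norm z)"
      by (subst Bochner_Integration.integral_cong[OF refl eq]) (use 1 in auto)
    ultimately show ?thesis
      by simp
  qed
  then show "integrable \<mu> (\<lambda>t. ln (norm (z - t)))"
    and "ln (norm z) \<le> (\<integral>t. ln (norm (z - t)) \<partial>\<mu>)"
    by auto
qed

text \<open>Roots are split off one at a time; what is left without roots is constant by the
  fundamental theorem of algebra. Roots on the circle are excluded here and dealt with by dilation
  in \<open>Szego_poly\<close>.\<close>

lemma Jensen_poly: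
  fixes p :: "complex poly"
  assumes "poly p 0 \<noteq> 0" "\<And>t. norm t = 1 \<Longrightarrow> poly p t \<noteq> 0"
  shows "integrable \<mu> (\<lambda>t. ln (norm (poly p t))) \<and>
    ln (norm (poly p 0)) \<le> (\<integral>t. ln (norm (poly p t)) \<partial>\<mu>)"
  using assms
proof (induction p rule: poly_root_induct[where P = "\<lambda>_. True"])
  case (no_roots p)
  then have "constant (poly p)"
    using fundamental_theorem_of_algebra by blast
  then obtain c where "poly p = (\<lambda>_. c)"
    unfolding constant_def by blast
  then show ?case
    by simp
next
  case (root a p)
  have a: "a \<noteq> 0" "norm a \<noteq> 1" and p0: "poly p 0 \<noteq> 0"
    and p: "\<And>t. norm t = 1 \<Longrightarrow> poly p t \<noteq> 0"
    using root.prems(1) root.prems(2)[of a] root.prems(2) by auto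
  note IH = root.IH[OF p0 p] and I = integral_ln_norm_minus_ge[OF a(2,1)]
  have eq: "ln (norm (poly ([:a, - 1:] * p) t)) = ln (norm (a - t)) + ln (norm (poly p t))"
    if "t \<in> space \<mu>" for t
  proof -
    have "poly ([:a, - 1:] * p) t = (a - t) * poly p t"
      by (simp add: algebra_simps)
    then have "norm (poly ([:a, - 1:] * p) t) = norm (a - t) * norm (poly p t)"
      by (simp only: norm_mult)
    moreover have "a \<noteq> t"
      using a(2) that by auto
    ultimately show ?thesis
      using p[of t] that by (simp add: ln_mult_pos)
  qed
  have "integrable \<mu> (\<lambda>t. ln (norm (poly ([:a, - 1:] * p) t)))"
    by (subst Bochner_Integration.integrable_cong[OF refl eq]) (use IH I in auto)
  moreover have "(\<integral>t. ln (norm (poly ([:a, - 1:] * p) t)) \<partial>\<mu>) =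
      (\<integral>t. ln (norm (a - t)) \<partial>\<mu>) + (\<integral>t. ln (norm (poly p t)) \<partial>\<mu>)"
    by (subst Bochner_Integration.integral_cong[OF refl eq]) (use IH I in auto)
  moreover have "ln (norm (poly ([:a, - 1:] * p) 0)) = ln (norm a) + ln (norm (poly p 0))"
    using a p0 by (simp add: norm_mult ln_mult_pos)
  ultimately show ?case
    using IH I by simp
qed simp

text \<open>Concavity of the logarithm enters through its tangent at
  \<open>s = exp (\<integral> ln w)\<close>.\<close>

lemma Szego_poly_no_zeros:
  fixes p :: "complex poly" and w :: "complex \<Rightarrow> real"
  assumes w: "AE t in \<mu>. 0 < w t" "integrable \<mu> w"
      "integrable \<mu> (\<lambda>t. ln (w t))"
    and p: "poly p 0 = 1" "\<And>t. norm t = 1 \<Longrightarrow> poly p t \<noteq> 0"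
    and int: "integrable \<mu> (\<lambda>t. (norm (poly p t))\<^sup>2 * w t)"
  shows "exp (\<integral>t. ln (w t) \<partial>\<mu>) \<le> (\<integral>t. (norm (poly p t))\<^sup>2 * w t \<partial>\<mu>)"
proof -
  define s where "s = exp (\<integral>t. ln (w t) \<partial>\<mu>)"
  define c where "c = (\<integral>t. (norm (poly p t))\<^sup>2 * w t \<partial>\<mu>)"
  have "s > 0"
    by (simp add: s_def)
  have J: "integrable \<mu> (\<lambda>t. ln (norm (poly p t)))" "0 \<le> (\<integral>t. ln (norm (poly p t)) \<partial>\<mu>)"
    using Jensen_poly[of p] p by auto
  have "(\<integral>t. 2 * ln (norm (poly p t)) + ln (w t) \<partial>\<mu>) \<le>
      (\<integral>t. (norm (poly p t))\<^sup>2 * w t / s - 1 + ln s \<partial>\<mu>)"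
  proof (rule integral_mono_AE)
    have "AE t in \<mu>. t \<in> space \<mu>"
      by (rule AE_space)
    with w(1) show "AE t in \<mu>. 2 * ln (norm (poly p t)) + ln (w t) \<le>
        (norm (poly p t))\<^sup>2 * w t / s - 1 + ln s"
    proof eventually_elim
      case (elim t)
      then have pos: "0 < norm (poly p t)"
        using p(2) by simp
      have "ln ((norm (poly p t))\<^sup>2 * w t / s) \<le> (norm (poly p t))\<^sup>2 * w t / s - 1"
        using elim pos \<open>s > 0\<close> by (intro ln_le_minus_one) auto
      moreover have "ln ((norm (poly p t))\<^sup>2 * w t / s) = 2 * ln (norm (poly p t)) + ln (w t) - ln s"
        using elim pos \<open>s > 0\<close> by (simp add: ln_div ln_mult_pos ln_realpow)
      ultimately show ?case by simp
    qed
  qed (use J w int in auto)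
  then have "2 * (\<integral>t. ln (norm (poly p t)) \<partial>\<mu>) + ln s \<le> c / s - 1 + ln s"
    using J w int by (simp add: c_def s_def)
  then have "0 \<le> c / s - 1"
    using J(2) by linarith
  then have "s \<le> c"
    using \<open>s > 0\<close> by (simp add: field_simps)
  then show ?thesis
    by (simp only: s_def c_def)
qed

text \<open>Zeros on the circle are moved away by passing to p(r t) with r < 1. This keeps the value
  1 at 0 and has a zero on the circle only if r is the modulus of a root of p, hence for finitely
  many members of a sequence of distinct radii. Dominated convergence then lets r tend to 1.\<close>

lemma Szego_poly:
  fixes p :: "complex poly" and w :: "complex \<Rightarrow> real"
  assumes w: "AE t in \<mu>. 0 < w t" "integrable \<mu> w"
      "integrable \<mu> (\<lambda>t. ln (w t))"
    and p: "poly p 0 = 1"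
  shows "exp (\<integral>t. ln (w t) \<partial>\<mu>) \<le> (\<integral>t. (norm (poly p t))\<^sup>2 * w t \<partial>\<mu>)"
proof -
  \<comment> \<open>The shift by 2 keeps every radius strictly between 0 and 1, and the radii are
    distinct, so the finite set of moduli of roots is met by finitely many indices.\<close>
  define r :: "nat \<Rightarrow> real" where "r n = 1 - 1 / real (n + 2)" for n
  define q where "q n = pcompose p [:0, of_real (r n):]" for n
  have r: "0 < r n" "r n < 1" for n
    by (auto simp: r_def)
  have r_lim: "r \<longlonglongrightarrow> 1"
  proof -
    have "(\<lambda>n. 1 - 1 / real (n + 2)) \<longlonglongrightarrow> 1 - 0"
      by (intro tendsto_diff tendsto_const LIMSEQ_ignore_initial_segment[OF lim_1_over_n])
    then show ?thesis by (simp add: r_def[abs_def])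
  qed
  have poly_q: "poly (q n) t = poly p (of_real (r n) * t)" for n t
    by (simp add: q_def poly_pcompose mult.commute)
  obtain B where B: "\<And>z. norm z \<le> 1 \<Longrightarrow> norm (poly p z) \<le> B"
  proof -
    have "bounded (poly p ` cball 0 1)"
      by (intro compact_imp_bounded compact_continuous_image continuous_intros compact_cball)
    then show ?thesis
      using that by (force simp: bounded_iff)
  qed
  have [measurable]: "w \<in> borel_measurable \<mu>"
    using w(2) by auto
  have [measurable]: "poly p' \<in> borel_measurable \<mu>" for p' :: "complex poly"
    by (intro borel_measurable_circle borel_measurable_poly) simp
  have bound: "AE t in \<mu>. norm ((norm (poly (q n) t))\<^sup>2 * w t) \<le> B\<^sup>2 * norm (w t)" for n
  proof (rule AE_I2)
    fix t assume "t \<in> space \<mu>"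
    then have "norm (of_real (r n) * t) \<le> 1"
      using r[of n] by (simp add: norm_mult)
    from B[OF this] have "(norm (poly (q n) t))\<^sup>2 \<le> B\<^sup>2"
      unfolding poly_q by (intro power_mono) auto
    then show "norm ((norm (poly (q n) t))\<^sup>2 * w t) \<le> B\<^sup>2 * norm (w t)"
      by (simp add: abs_mult mult_right_mono)
  qed
  have Bw: "integrable \<mu> (\<lambda>t. B\<^sup>2 * norm (w t))"
    using w(2) by auto
  have int: "integrable \<mu> (\<lambda>t. (norm (poly (q n) t))\<^sup>2 * w t)" for n
    by (rule Bochner_Integration.integrable_bound[OF Bw]) (use bound[of n] in auto)
  have "(\<lambda>n. \<integral>t. (norm (poly (q n) t))\<^sup>2 * w t \<partial>\<mu>) \<longlonglongrightarrow> (\<integral>t. (norm (poly p t))\<^sup>2 * w t \<partial>\<mu>)"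
  proof (rule integral_dominated_convergence[OF _ _ Bw _ bound])
    show "AE t in \<mu>. (\<lambda>n. (norm (poly (q n) t))\<^sup>2 * w t) \<longlonglongrightarrow> (norm (poly p t))\<^sup>2 * w t"
    proof (rule AE_I2)
      fix t
      have "(\<lambda>n. complex_of_real (r n) * t) \<longlonglongrightarrow> complex_of_real 1 * t"
        by (intro tendsto_mult tendsto_of_real r_lim tendsto_const)
      then have "(\<lambda>n. poly (q n) t) \<longlonglongrightarrow> poly p t"
        unfolding poly_q by (intro tendsto_poly) simp
      then show "(\<lambda>n. (norm (poly (q n) t))\<^sup>2 * w t) \<longlonglongrightarrow> (norm (poly p t))\<^sup>2 * w t"
        by (intro tendsto_intros)
    qed
  qed measurable
  moreover have "\<forall>\<^sub>F n in sequentially. exp (\<integral>t. ln (w t) \<partial>\<mu>) \<le> (\<integral>t. (norm (poly (q n) t))\<^sup>2 * w t \<partial>\<mu>)"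
  proof -
    have "p \<noteq> 0"
      using p by auto
    then have "finite (norm ` {z. poly p z = 0})"
      by (intro finite_imageI poly_roots_finite)
    moreover have "inj r"
      by (auto simp: inj_def r_def)
    ultimately have "finite (r -` norm ` {z. poly p z = 0})"
      by (intro finite_vimageI) auto
    then have "\<forall>\<^sub>F n in sequentially. n \<notin> r -` norm ` {z. poly p z = 0}"
      unfolding cofinite_eq_sequentially[symmetric] eventually_cofinite
      by (simp add: vimage_def)
    then show ?thesis
    proof eventually_elim
      case (elim n)
      show ?case
      proof (rule Szego_poly_no_zeros[OF w _ _ int])
        fix t :: complex assume "norm t = 1"
        then have "norm (of_real (r n) * t) = r n"
          using r[of n] by (simp add: norm_mult)
        then have "r n \<in> norm ` {z. poly p z = 0}" if "poly (q n) t = 0"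
          using that unfolding poly_q by (metis (mono_tags, lifting) image_eqI mem_Collect_eq)
        then show "poly (q n) t \<noteq> 0"
          using elim by auto
      qed (simp add: poly_q p)
    qed
  qed
  ultimately show ?thesis
    by (rule tendsto_lowerbound) simp
qed

section \<open>Density of trigonometric polynomials\<close>

text \<open>Distances are kept squared so that they stay plain integrals; the triangle inequality
  then carries a factor 2, and the approximations below start from e / 4.\<close>

lemma L2_dist2_triangle:
  assumes "f \<in> L2" "g \<in> L2" "h \<in> L2"
  shows "L2_dist2 f h \<le> 2 * L2_dist2 f g + 2 * L2_dist2 g h"
proof -
  have "L2_dist2 f h \<le> (\<integral>t. 2 * (norm (f t - g t))\<^sup>2 + 2 * (norm (g t - h t))\<^sup>2 \<partial>\<mu>)"
    unfolding L2_dist2_def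
  proof (rule integral_mono)
    fix t
    show "(norm (f t - h t))\<^sup>2 \<le> 2 * (norm (f t - g t))\<^sup>2 + 2 * (norm (g t - h t))\<^sup>2"
      using norm_add_power2_le[of "f t - g t" "g t - h t"] by simp
  qed (intro Bochner_Integration.integrable_add integrable_mult_right L2_integrable L2_diff assms)+
  also have "\<dots> = 2 * L2_dist2 f g + 2 * L2_dist2 g h"
    unfolding L2_dist2_def
    by (subst Bochner_Integration.integral_add)
       (auto intro!: Bochner_Integration.integrable_add integrable_mult_right L2_integrable L2_diff assms)
  finally show ?thesis .
qed

text \<open>On the circle \<open>cnj t ^ N\<close> is t^-N, so this is an arbitrary Laurent
  polynomial, stored as an ordinary polynomial with a shift. The pair (N, p) is not unique, which
  allows sums to be brought to a common shift.\<close>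

definition trig :: "nat \<Rightarrow> complex poly \<Rightarrow> complex \<Rightarrow> complex" where
  "trig N p t = cnj t ^ N * poly p t"

lemma circle_mult_cnj: "norm t = 1 \<Longrightarrow> t * cnj t = 1"
  using complex_norm_square[of t] by simp

lemma trig_add:
  assumes "norm t = 1"
  shows "trig N p t + trig M q t = trig (N + M) (monom 1 M * p + monom 1 N * q) t"
proof -
  have "trig (N + M) (monom 1 M * p + monom 1 N * q) t =
      (t * cnj t) ^ M * trig N p t + (t * cnj t) ^ N * trig M q t"
    by (simp add: trig_def poly_monom power_add algebra_simps)
  then show ?thesis
    using circle_mult_cnj[OF assms] by simp
qed

lemma trig_mult: "trig N p t * trig M q t = trig (N + M) (p * q) t"
  by (simp add: trig_def power_add)

lemma bounded_on_circle:
  fixes f :: "complex \<Rightarrow> complex"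
  assumes "continuous_on (sphere 0 1) f"
  obtains B where "\<And>t. norm t = 1 \<Longrightarrow> norm (f t) \<le> B"
proof -
  have "bounded (f ` sphere (0::complex) 1)"
    by (intro compact_imp_bounded compact_continuous_image assms compact_sphere)
  then show ?thesis
    using that by (force simp: bounded_iff)
qed

lemma L2_continuous:
  assumes "continuous_on UNIV f"
  shows "f \<in> L2"
proof -
  obtain B where "\<And>t. norm t = 1 \<Longrightarrow> norm (f t) \<le> B"
    using bounded_on_circle[OF continuous_on_subset[OF assms]] by auto
  then show ?thesis
    by (intro L2_bounded[where C = B] AE_I2 borel_measurable_circle borel_measurable_continuous_onI assms) auto
qed

lemma L2_const: "(\<lambda>_. c) \<in> L2"
  by (intro L2_continuous continuous_intros)

lemma L2_trig [simp]: "trig N p \<in> L2"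
  unfolding trig_def[abs_def] by (intro L2_continuous continuous_intros)

lemma real_polynomial_function_trig:
  assumes "real_polynomial_function g"
  shows "\<exists>N p. \<forall>t. norm t = 1 \<longrightarrow> complex_of_real (g t) = trig N p t"
  using assms
proof (induction rule: real_polynomial_function.induct)
  case (linear f)
  interpret bounded_linear f by fact
  \<comment> \<open>From Re t = (t + cnj t)/2 and Im t = (t - cnj t)/(2i): the coefficients of cnj t
    and t in Re t f(1) + Im t f(i) sit at degrees 0 and 2 because the shift is 1.\<close>
  define p where "p = [:(of_real (f 1) + \<i> * of_real (f \<i>)) / 2, 0, (of_real (f 1) - \<i> * of_real (f \<i>)) / 2:]"
  have "complex_of_real (f t) = trig 1 p t" if "norm t = 1" for t
  proof -
    have "t = Re t *\<^sub>R 1 + Im t *\<^sub>R \<i>"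
      by (simp add: complex_eq_iff)
    then have "f t = Re t * f 1 + Im t * f \<i>"
      by (metis add scaleR real_scaleR_def)
    moreover have "trig 1 p t = cnj t * ((of_real (f 1) + \<i> * of_real (f \<i>)) / 2) +
        t * (t * cnj t) * ((of_real (f 1) - \<i> * of_real (f \<i>)) / 2)"
      by (simp add: trig_def p_def algebra_simps)
    ultimately show ?thesis
      unfolding circle_mult_cnj[OF that] by (auto simp: complex_eq_iff field_simps)
  qed
  then show ?case by blast
next
  case (const c)
  have "complex_of_real c = trig 0 [:of_real c:] t" for t
    by (simp add: trig_def)
  then show ?case by blast
next
  case (add f g)
  then show ?case
    by (metis of_real_add trig_add)
next
  case (mult f g)
  then show ?case
    by (metis of_real_mult trig_mult)
qed

section \<open>Closure of the trigonometric polynomials in L^2\<close>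

definition trig_closure :: "(complex \<Rightarrow> complex) set" where
  "trig_closure = {f \<in> L2. \<forall>e>0. \<exists>N p. L2_dist2 f (trig N p) < e}"

lemma trig_closure_closed:
  assumes "f \<in> L2" "\<And>e. e > 0 \<Longrightarrow> \<exists>g\<in>trig_closure. L2_dist2 f g < e"
  shows "f \<in> trig_closure"
  unfolding trig_closure_def
proof safe
  fix e :: real assume "e > 0"
  then obtain g where g: "g \<in> trig_closure" "L2_dist2 f g < e / 4"
    using assms(2)[of "e/4"] by auto
  moreover have "e / 4 > 0"
    using \<open>e > 0\<close> by simp
  ultimately obtain N p where "L2_dist2 g (trig N p) < e / 4"
    unfolding trig_closure_def by blast
  then have "L2_dist2 f (trig N p) < e"
    using L2_dist2_triangle[of f g "trig N p"] assms(1) g by (simp add: trig_closure_def)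
  then show "\<exists>N p. L2_dist2 f (trig N p) < e"
    by blast
qed fact

lemma L2_dist2_add:
  assumes "f \<in> L2" "f' \<in> L2" "g \<in> L2" "g' \<in> L2"
  shows "L2_dist2 (\<lambda>t. f t + g t) (\<lambda>t. f' t + g' t) \<le> 2 * L2_dist2 f f' + 2 * L2_dist2 g g'"
proof -
  have "L2_dist2 (\<lambda>t. f t + g t) (\<lambda>t. f' t + g' t) = L2_dist2 (\<lambda>t. f t + g t - f' t - g' t) (\<lambda>t. 0)"
    by (simp add: L2_dist2_def algebra_simps)
  also have "\<dots> \<le> 2 * L2_dist2 (\<lambda>t. f t + g t - f' t - g' t) (\<lambda>t. g t - g' t) + 2 * L2_dist2 (\<lambda>t. g t - g' t) (\<lambda>t. 0)"
    by (rule L2_dist2_triangle) (intro L2_diff L2_add L2_const assms)+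
  also have "\<dots> = 2 * L2_dist2 f f' + 2 * L2_dist2 g g'"
    by (simp add: L2_dist2_def algebra_simps)
  finally show ?thesis .
qed

lemma L2_dist2_cong:
  assumes "\<And>t. norm t = 1 \<Longrightarrow> f t = f' t" "\<And>t. norm t = 1 \<Longrightarrow> g t = g' t"
  shows "L2_dist2 f g = L2_dist2 f' g'"
  unfolding L2_dist2_def by (rule Bochner_Integration.integral_cong) (use assms in auto)

lemma trig_closure_add:
  assumes "f \<in> trig_closure" "g \<in> trig_closure"
  shows "(\<lambda>t. f t + g t) \<in> trig_closure"
  unfolding trig_closure_def
proof safe
  have L2: "f \<in> L2" "g \<in> L2"
    using assms by (auto simp: trig_closure_def)
  then show "(\<lambda>t. f t + g t) \<in> L2"
    by (rule L2_add)
  fix e :: real assume "e > 0"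
  then have "e / 4 > 0" by simp
  then obtain N p M q where "L2_dist2 f (trig N p) < e / 4" "L2_dist2 g (trig M q) < e / 4"
    using assms unfolding trig_closure_def by blast
  then have "L2_dist2 (\<lambda>t. f t + g t) (\<lambda>t. trig N p t + trig M q t) < e"
    using L2_dist2_add[of f "trig N p" g "trig M q"] L2 by simp
  moreover have "L2_dist2 (\<lambda>t. f t + g t) (\<lambda>t. trig N p t + trig M q t) =
      L2_dist2 (\<lambda>t. f t + g t) (trig (N + M) (monom 1 M * p + monom 1 N * q))"
    by (rule L2_dist2_cong) (simp_all add: trig_add)
  ultimately show "\<exists>N p. L2_dist2 (\<lambda>t. f t + g t) (trig N p) < e"
    by auto
qed

lemma trig_closure_cmult:
  assumes "f \<in> trig_closure"
  shows "(\<lambda>t. c * f t) \<in> trig_closure"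
  unfolding trig_closure_def
proof safe
  show "(\<lambda>t. c * f t) \<in> L2"
    using assms by (auto simp: trig_closure_def)
  fix e :: real assume "e > 0"
  define d where "d = e / ((norm c)\<^sup>2 + 1)"
  have "(norm c)\<^sup>2 + 1 > 0"
    by (intro add_nonneg_pos) auto
  then have "d > 0"
    using \<open>e > 0\<close> by (simp add: d_def)
  then obtain N p where "L2_dist2 f (trig N p) < d"
    using assms unfolding trig_closure_def by blast
  then have "(norm c)\<^sup>2 * L2_dist2 f (trig N p) \<le> (norm c)\<^sup>2 * d"
    by (intro mult_left_mono) auto
  also have "\<dots> < ((norm c)\<^sup>2 + 1) * d"
    using \<open>d > 0\<close> by simp
  also have "\<dots> = e"
    using \<open>(norm c)\<^sup>2 + 1 > 0\<close> by (simp add: d_def)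
  also have "(norm c)\<^sup>2 * L2_dist2 f (trig N p) = L2_dist2 (\<lambda>t. c * f t) (trig N (smult c p))"
  proof -
    have "c * f t - trig N (smult c p) t = c * (f t - trig N p t)" for t
      by (simp add: trig_def algebra_simps)
    then show ?thesis
      by (simp add: L2_dist2_def norm_mult power_mult_distrib)
  qed
  finally show "\<exists>N p. L2_dist2 (\<lambda>t. c * f t) (trig N p) < e"
    by blast
qed

text \<open>Stone-Weierstrass on the circle. Uniform approximation within sqrt (e/2) bounds the
  squared distance by e/2, as the measure has total mass 1.\<close>

lemma trig_closure_continuous:
  fixes g :: "complex \<Rightarrow> real"
  assumes g: "continuous_on UNIV g"
  shows "(\<lambda>t. complex_of_real (g t)) \<in> trig_closure"
  unfolding trig_closure_def
proof safe
  show "(\<lambda>t. complex_of_real (g t)) \<in> L2"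
    by (intro L2_continuous continuous_intros g)
  fix e :: real assume "e > 0"
  then have "sqrt (e / 2) > 0"
    by simp
  then obtain h where h: "real_polynomial_function h" "\<And>t. t \<in> sphere 0 1 \<Longrightarrow> \<bar>g t - h t\<bar> < sqrt (e / 2)"
    using Stone_Weierstrass_real_polynomial_function[OF compact_sphere continuous_on_subset[OF g subset_UNIV]]
    by metis
  then obtain N p where Np: "\<And>t. norm t = 1 \<Longrightarrow> complex_of_real (h t) = trig N p t"
    using real_polynomial_function_trig by metis
  have "L2_dist2 (\<lambda>t. complex_of_real (g t)) (trig N p) \<le> (\<integral>t. e / 2 \<partial>\<mu>)"
    unfolding L2_dist2_def
  proof (rule integral_mono)
    fix t assume t: "t \<in> space \<mu>"
    then have "norm (complex_of_real (g t) - trig N p t) = \<bar>g t - h t\<bar>"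
      using Np[of t, symmetric] by (simp add: norm_of_real flip: of_real_diff)
    also have "\<dots> \<le> sqrt (e / 2)"
      using h(2)[of t] t by simp
    finally have "(norm (complex_of_real (g t) - trig N p t))\<^sup>2 \<le> (sqrt (e / 2))\<^sup>2"
      by (intro power_mono) auto
    then show "(norm (complex_of_real (g t) - trig N p t))\<^sup>2 \<le> e / 2"
      using \<open>e > 0\<close> by simp
  qed (auto intro!: L2_integrable L2_diff L2_trig L2_continuous[OF continuous_on_of_real[OF g]])
  then show "\<exists>N p. L2_dist2 (\<lambda>t. complex_of_real (g t)) (trig N p) < e"
    using \<open>e > 0\<close> by (auto intro!: exI[of _ N] exI[of _ p])
qed

lemma trig_closure_limit:
  assumes F: "\<And>n. F n \<in> trig_closure" and f: "f \<in> L2"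
    and lim: "\<And>t. norm t = 1 \<Longrightarrow> (\<lambda>n. F n t) \<longlonglongrightarrow> f t"
    and bound: "\<And>n t. norm t = 1 \<Longrightarrow> norm (F n t) \<le> C t" and C: "integrable \<mu> (\<lambda>t. (C t)\<^sup>2)"
  shows "f \<in> trig_closure"
proof (rule trig_closure_closed[OF f])
  fix e :: real assume "e > 0"
  note [measurable] = L2_measurable[OF f]
  have [measurable]: "F n \<in> borel_measurable \<mu>" for n
    using F[of n] by (auto simp: trig_closure_def L2_def)
  have "(\<lambda>n. \<integral>t. (norm (f t - F n t))\<^sup>2 \<partial>\<mu>) \<longlonglongrightarrow> (\<integral>t. 0 \<partial>\<mu>)"
  proof (rule integral_dominated_convergence[where w = "\<lambda>t. 2 * (norm (f t))\<^sup>2 + 2 * (C t)\<^sup>2"])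
    show "AE t in \<mu>. (\<lambda>n. (norm (f t - F n t))\<^sup>2) \<longlonglongrightarrow> 0"
    proof (rule AE_I2)
      fix t :: complex assume "t \<in> space \<mu>"
      then have "(\<lambda>n. (norm (f t - F n t))\<^sup>2) \<longlonglongrightarrow> (norm (f t - f t))\<^sup>2"
        by (intro tendsto_intros lim) auto
      then show "(\<lambda>n. (norm (f t - F n t))\<^sup>2) \<longlonglongrightarrow> 0"
        by simp
    qed
    show "AE t in \<mu>. norm ((norm (f t - F n t))\<^sup>2) \<le> 2 * (norm (f t))\<^sup>2 + 2 * (C t)\<^sup>2" for n
    proof (rule AE_I2)
      fix t :: complex assume "t \<in> space \<mu>"
      then have "(norm (F n t))\<^sup>2 \<le> (C t)\<^sup>2"
        using bound[of t n] by (intro power_mono) auto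
      then show "norm ((norm (f t - F n t))\<^sup>2) \<le> 2 * (norm (f t))\<^sup>2 + 2 * (C t)\<^sup>2"
        using norm_add_power2_le[of "f t" "- F n t"] by simp
    qed
  qed (use C L2_integrable[OF f] in auto)
  then have "\<forall>\<^sub>F n in sequentially. L2_dist2 f (F n) < e"
    using \<open>e > 0\<close> unfolding L2_dist2_def by (intro order_tendstoD) auto
  then show "\<exists>g\<in>trig_closure. L2_dist2 f g < e"
    using F by (auto simp: eventually_sequentially)
qed

lemma trig_closure_zero: "(\<lambda>t. 0) \<in> trig_closure"
  using trig_closure_continuous[of "\<lambda>_. 0"] by simp

lemma trig_closure_compact:
  assumes "compact K"
  shows "(\<lambda>t. complex_of_real (indicator K t)) \<in> trig_closure"
proof (cases "K = {}")
  case False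
  have K: "closed K"
    using assms by (rule compact_imp_closed)
  \<comment> \<open>Continuous functions decreasing to the indicator of K: off the closed set K the
    distance to K is positive, so \<open>F n t\<close> vanishes as soon as n times that distance
    exceeds 1.\<close>
  define F where "F n t = max 0 (1 - real n * infdist t K)" for n t
  have F: "0 \<le> F n t" "F n t \<le> 1" for n t
    by (auto simp: F_def infdist_nonneg)
  have lim: "(\<lambda>n. F n t) \<longlonglongrightarrow> indicator K t" for t
  proof (cases "t \<in> K")
    case True
    then show ?thesis
      by (simp add: F_def)
  next
    case False
    have d: "infdist t K > 0"
      by (rule infdist_pos_not_in_closed) (use False K \<open>K \<noteq> {}\<close> in auto)
    then obtain n0 where n0: "real n0 * infdist t K > 1"
      using reals_Archimedean3 by blast
    have "F n t = 0" if "n \<ge> n0" for n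
    proof -
      have "real n0 * infdist t K \<le> real n * infdist t K"
        using that d by (intro mult_right_mono) auto
      then show ?thesis
        using n0 by (simp add: F_def)
    qed
    then have "\<forall>\<^sub>F n in sequentially. F n t = 0"
      by (auto simp: eventually_sequentially)
    then show ?thesis
      using False by (simp add: tendsto_eventually)
  qed
  have [measurable]: "K \<in> sets borel"
    using K by (rule borel_closed)
  show ?thesis
  proof (rule trig_closure_limit[where F = "\<lambda>n t. complex_of_real (F n t)" and C = "\<lambda>_. 1"])
    show "(\<lambda>t. complex_of_real (F n t)) \<in> trig_closure" for n
      unfolding F_def by (intro trig_closure_continuous continuous_intros)
    show "(\<lambda>t. complex_of_real (indicator K t)) \<in> L2"
    proof (rule L2_bounded[where C = 1])
      show "(\<lambda>t. complex_of_real (indicator K t)) \<in> borel_measurable \<mu>"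
        by (rule borel_measurable_circle) measurable
    qed (simp add: indicator_def)
  qed (use F in \<open>auto intro: tendsto_of_real lim\<close>)
qed (use trig_closure_zero in simp)

text \<open>A measurable set is a Borel set up to a null set, as the measure is a completion, and a
  Borel set exceeds some compact subset by measure less than e; this reduces the claim to compact
  sets.\<close>

lemma trig_closure_indicator:
  assumes "A \<in> sets \<mu>"
  shows "(\<lambda>t. complex_of_real (indicator A t)) \<in> trig_closure"
proof (rule trig_closure_closed)
  show "(\<lambda>t. complex_of_real (indicator A t)) \<in> L2"
    by (rule L2_bounded[where C = 1]) (use assms in \<open>auto simp: indicator_def\<close>)
  fix e :: real assume "e > 0"
  let ?D = "distr (uniform_measure lborel {0..<2*pi}) (restrict_space borel (sphere (0::complex) 1)) cis"
  define B where "B = main_part ?D A"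
  have A: "A \<in> sets (completion ?D)"
    using assms by (simp add: circle_measure_def)
  have "B \<in> sets ?D"
    unfolding B_def using A by (rule main_part_sets)
  then have B: "B \<in> sets borel"
    by (auto simp: sets_restrict_space)
  have "AE t in \<mu>. t \<notin> null_part ?D A"
    unfolding circle_measure_def by (intro AE_completion AE_notin_null_part A)
  then have AB: "AE t in \<mu>. indicator A t = indicator B t"
  proof eventually_elim
    case (elim t)
    then show ?case
      using main_part_null_part_Un[OF A] unfolding B_def by (auto simp: indicator_def)
  qed
  \<comment> \<open>The measure is carried over to the Borel sets of the whole plane, where finite
    measures are inner regular with respect to compact sets.\<close>
  define \<nu> where "\<nu> = distr \<mu> borel (\<lambda>t. t)"
  interpret \<nu>: finite_measure \<nu>
    unfolding \<nu>_def by (rule circle.finite_measure_distr) (rule borel_measurable_circle_ident)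
  have [simp]: "sets \<nu> = sets borel"
    by (simp add: \<nu>_def)
  have measure_\<nu>: "measure \<nu> X = measure \<mu> (X \<inter> sphere 0 1)" if "X \<in> sets borel" for X
    unfolding \<nu>_def by (subst measure_distr) (use that borel_measurable_circle_ident in \<open>auto simp: vimage_def\<close>)
  obtain K where K: "K \<subseteq> B" "compact K" "measure \<nu> B < measure \<nu> K + e"
  proof -
    have "emeasure \<nu> B = (SUP K \<in> {K. K \<subseteq> B \<and> compact K}. emeasure \<nu> K)"
      using B by (intro inner_regular) auto
    moreover have "{K. K \<subseteq> B \<and> compact K} \<noteq> {}"
      by (auto intro!: exI[of _ "{}"])
    ultimately have "\<exists>K\<in>{K. K \<subseteq> B \<and> compact K}. emeasure \<nu> B < emeasure \<nu> K + ennreal e"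
      using \<nu>.emeasure_finite[of B] by (intro SUP_approx_ennreal[OF \<open>e > 0\<close>]) auto
    then obtain K where K: "K \<subseteq> B" "compact K"
        "emeasure \<nu> B < emeasure \<nu> K + ennreal e"
      by auto
    then have "ennreal (measure \<nu> B) < ennreal (measure \<nu> K + e)"
      using \<open>e > 0\<close> by (simp add: \<nu>.emeasure_eq_measure)
    then have "measure \<nu> B < measure \<nu> K + e"
      by (subst (asm) ennreal_less_iff) auto
    with K show ?thesis
      using that by blast
  qed
  then have Kb: "K \<in> sets borel"
    by (simp add: borel_closed compact_imp_closed)
  note [measurable] = assms borel_measurable_circle[OF borel_measurable_indicator[OF B]]
    borel_measurable_circle[OF borel_measurable_indicator[OF Kb]]
    borel_measurable_circle[OF borel_measurable_indicator[OF sets.Diff[OF B Kb]]]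
  have "L2_dist2 (\<lambda>t. complex_of_real (indicator A t)) (\<lambda>t. complex_of_real (indicator K t)) =
      (\<integral>t. indicator (B - K) t \<partial>\<mu>)"
    unfolding L2_dist2_def
  proof (rule integral_cong_AE)
    show "AE t in \<mu>. (norm (complex_of_real (indicator A t) - complex_of_real (indicator K t)))\<^sup>2 =
        indicator (B - K) t"
      using AB by eventually_elim (use K in \<open>auto simp: indicator_def\<close>)
  qed measurable
  also have "\<dots> = measure \<nu> (B - K)"
    using B Kb by (simp add: measure_\<nu> Int_commute)
  also have "\<dots> = measure \<nu> B - measure \<nu> K"
    by (rule \<nu>.finite_measure_Diff) (use B Kb K in auto)
  also have "\<dots> < e"
    using K by simp
  finally show "\<exists>g\<in>trig_closure. L2_dist2 (\<lambda>t. complex_of_real (indicator A t)) g < e"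
    using trig_closure_compact[OF K(2)] by blast
qed

lemma trig_closure_sum:
  "(\<And>i. i \<in> I \<Longrightarrow> f i \<in> trig_closure) \<Longrightarrow> (\<lambda>t. \<Sum>i\<in>I. f i t) \<in> trig_closure"
  by (induction I rule: infinite_finite_induct) (auto intro: trig_closure_add trig_closure_zero)

lemma trig_closure_eq_L2: "trig_closure = L2"
proof
  show "trig_closure \<subseteq> L2"
    by (auto simp: trig_closure_def)
  show "L2 \<subseteq> trig_closure"
  proof
    fix f assume f: "f \<in> L2"
    obtain F where F: "\<And>i. simple_function \<mu> (F i)"
      "\<And>t. t \<in> space \<mu> \<Longrightarrow> (\<lambda>i. F i t) \<longlonglongrightarrow> f t"
      "\<And>i t. t \<in> space \<mu> \<Longrightarrow> norm (F i t) \<le> 2 * norm (f t)"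
      using borel_measurable_implies_sequence_metric[OF L2_measurable[OF f], of 0]
      unfolding norm_conv_dist by metis
    \<comment> \<open>On the circle \<open>F i\<close> equals this finite combination of indicators
      of level sets, to which the closure properties above apply.\<close>
    define G where "G i t = (\<Sum>y\<in>F i ` space \<mu>.
        y * complex_of_real (indicator (F i -` {y} \<inter> space \<mu>) t))" for i t
    have G: "G i t = F i t" if "t \<in> space \<mu>" for i t
    proof -
      have "G i t = (\<Sum>y\<in>F i ` space \<mu>. if y = F i t then y else 0)"
        unfolding G_def using that by (intro sum.cong) (auto simp: indicator_def)
      also have "\<dots> = F i t"
        using simple_functionD(1)[OF F(1)[of i]] that by (simp add: sum.delta)
      finally show ?thesis .
    qed
    show "f \<in> trig_closure"
    proof (rule trig_closure_limit[where F = G and C = "\<lambda>t. 2 * norm (f t)"])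
      show "G i \<in> trig_closure" for i
        unfolding G_def[abs_def]
        by (intro trig_closure_sum trig_closure_cmult trig_closure_indicator simple_functionD[OF F(1)])
      show "integrable \<mu> (\<lambda>t. (2 * norm (f t))\<^sup>2)"
        using L2_integrable[OF f] by (simp add: power_mult_distrib)
    qed (use f F G in auto)
  qed
qed

section \<open>Hardy spaces\<close>

lemma powi_L2 [simp]: "(\<lambda>t. t powi k) \<in> L2"
  by (rule L2_bounded[where C = 1]) (auto intro!: borel_measurable_circle simp: norm_power_int)

lemma H2_plus_L2: "f \<in> H2_plus \<Longrightarrow> f \<in> L2"
  and H2_minus_L2: "f \<in> H2_minus \<Longrightarrow> f \<in> L2"
  by (auto simp: H2_plus_def H2_minus_def)

lemma H2_plus_orth: "f \<in> H2_plus \<Longrightarrow> k < 0 \<Longrightarrow> (\<integral>t. f t * cnj (t powi k) \<partial>\<mu>) = 0"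
  by (auto simp: H2_plus_def)

lemma L2_cnj_integrable: "f \<in> L2 \<Longrightarrow> g \<in> L2 \<Longrightarrow> integrable \<mu> (\<lambda>t. f t * cnj (g t))"
  by (intro L2_mult_integrable L2_cnj)

lemma H2_plus_add [intro]: "f \<in> H2_plus \<Longrightarrow> g \<in> H2_plus \<Longrightarrow> (\<lambda>t. f t + g t) \<in> H2_plus"
  by (auto simp: H2_plus_def distrib_right L2_cnj_integrable simp del: complex_cnj_power_int)

lemma H2_plus_cmult [intro]: "f \<in> H2_plus \<Longrightarrow> (\<lambda>t. c * f t) \<in> H2_plus"
  by (auto simp: H2_plus_def mult.assoc simp del: complex_cnj_power_int)

lemma H2_plus_diff [intro]: "f \<in> H2_plus \<Longrightarrow> g \<in> H2_plus \<Longrightarrow> (\<lambda>t. f t - g t) \<in> H2_plus"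
  using H2_plus_add[of f "\<lambda>t. (-1) * g t"] H2_plus_cmult[of g "-1"] by simp

lemma H2_minus_add [intro]: "f \<in> H2_minus \<Longrightarrow> g \<in> H2_minus \<Longrightarrow> (\<lambda>t. f t + g t) \<in> H2_minus"
  by (auto simp: H2_minus_def distrib_right L2_cnj_integrable H2_plus_L2)

lemma H2_minus_cmult [intro]: "f \<in> H2_minus \<Longrightarrow> (\<lambda>t. c * f t) \<in> H2_minus"
  by (auto simp: H2_minus_def mult.assoc)

lemma integral_powi_cnj_powi:
  "(\<integral>t. t powi j * cnj (t powi k) \<partial>\<mu>) = (if j = k then 1 else 0)"
proof -
  have "(\<integral>t. t powi j * cnj (t powi k) \<partial>\<mu>) = (\<integral>t. t powi (j - k) \<partial>\<mu>)"
  proof (rule integral_circle_cong)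
    fix t :: complex assume t: "norm t = 1"
    then show "t powi j * cnj (t powi k) = t powi (j - k)"
      using cnj_powi_circle[of t k] power_int_add[of t j "-k"] by (cases "t = 0") auto
  qed
  then show ?thesis
    by (simp add: integral_powi_circle)
qed

lemma powi_H2_plus: "0 \<le> k \<Longrightarrow> (\<lambda>t. t powi k) \<in> H2_plus"
  by (auto simp: H2_plus_def integral_powi_cnj_powi simp del: complex_cnj_power_int)

lemma const_H2_plus: "(\<lambda>_. c) \<in> H2_plus"
  using H2_plus_cmult[OF powi_H2_plus[of 0], of c] by simp

lemma poly_H2_plus: "poly p \<in> H2_plus"
proof -
  have "(\<lambda>t. \<Sum>i\<in>I. coeff p i * t powi int i) \<in> H2_plus" if "finite I" for I
    using that
  proof (induction I)
    case (insert i I)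
    then show ?case
      unfolding sum.insert[OF insert.hyps] by (intro H2_plus_add H2_plus_cmult powi_H2_plus) auto
  qed (simp add: const_H2_plus)
  from this[of "{..degree p}"] show ?thesis
    by (simp add: poly_altdef[abs_def])
qed

text \<open>Multiplication by t^j shifts the Fourier coefficients by j. The exponent may be negative
  as long as the coefficients pushed below 0 vanish; j = -1 gives the backward shift.\<close>

lemma H2_plus_mult_powiI:
  assumes f: "f \<in> L2" and orth: "\<And>k. k < 0 \<Longrightarrow> (\<integral>t. f t * cnj (t powi (k - j)) \<partial>\<mu>) = 0"
  shows "(\<lambda>t. t powi j * f t) \<in> H2_plus"
  unfolding H2_plus_def
proof safe
  show "(\<lambda>t. t powi j * f t) \<in> L2"
    by (rule L2_mult_bounded[OF f, where C = 1]) (auto intro!: borel_measurable_circle simp: norm_power_int)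
  fix k :: int assume k: "k < 0"
  have "(\<integral>t. t powi j * f t * cnj (t powi k) \<partial>\<mu>) = (\<integral>t. f t * cnj (t powi (k - j)) \<partial>\<mu>)"
  proof (rule integral_circle_cong)
    fix t :: complex assume t: "norm t = 1"
    then have "t powi (- (k - j)) = t powi j * t powi (- k)"
      by (cases "t = 0") (simp_all flip: power_int_add)
    then show "t powi j * f t * cnj (t powi k) = f t * cnj (t powi (k - j))"
      using cnj_powi_circle[of t] t by (simp del: complex_cnj_power_int)
  qed
  then show "(\<integral>t. t powi j * f t * cnj (t powi k) \<partial>\<mu>) = 0"
    using orth[OF k] by simp
qed

lemma H2_plus_mult_powi:
  assumes "f \<in> H2_plus" "0 \<le> j"
  shows "(\<lambda>t. t powi j * f t) \<in> H2_plus"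
  by (rule H2_plus_mult_powiI[OF H2_plus_L2 H2_plus_orth]) (use assms in auto)

lemma H2_plus_backward_shift:
  assumes "f \<in> H2_plus" "(\<integral>t. f t \<partial>\<mu>) = 0"
  shows "(\<lambda>t. t powi (- 1) * f t) \<in> H2_plus"
proof (rule H2_plus_mult_powiI)
  fix k :: int assume "k < 0"
  then show "(\<integral>t. f t * cnj (t powi (k - - 1)) \<partial>\<mu>) = 0"
    using assms H2_plus_orth[of f "k - - 1"] by (cases "k = - 1") auto
qed (rule H2_plus_L2[OF assms(1)])

text \<open>The constant is the mean of f, and g is the backward shift of f minus its mean. This
  splitting is why H(n+1,m) has codimension at most one in H(n,m).\<close>

lemma H2_plus_decompose:
  assumes "f \<in> H2_plus"
  obtains c g where "g \<in> H2_plus" "\<And>t. norm t = 1 \<Longrightarrow> f t = c + t * g t"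
proof -
  define c where "c = (\<integral>t. f t \<partial>\<mu>)"
  define g where "g t = t powi (- 1) * (f t - c)" for t
  have "integrable \<mu> f"
    using assms by (intro L2_imp_integrable H2_plus_L2)
  then have "(\<integral>t. f t - c \<partial>\<mu>) = 0"
    by (simp add: c_def)
  then have "g \<in> H2_plus"
    unfolding g_def[abs_def] using assms by (intro H2_plus_backward_shift H2_plus_diff const_H2_plus)
  moreover have "f t = c + t * g t" if "norm t = 1" for t
    using that by (cases "t = 0") (auto simp: g_def power_int_minus field_simps)
  ultimately show ?thesis
    by (rule that)
qed

lemma H2_minus_orth: "f \<in> H2_minus \<Longrightarrow> g \<in> H2_plus \<Longrightarrow> (\<integral>t. f t * cnj (g t) \<partial>\<mu>) = 0"
  by (auto simp: H2_minus_def)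

text \<open>Conjugation turns negative frequencies into positive ones, so the conjugate of f lies in
  t H^2_+. This lets a lower bound for |1 - t h| serve also for |1 - f|.\<close>

lemma cnj_H2_minus:
  assumes "f \<in> H2_minus"
  shows "(\<lambda>t. t powi (- 1) * cnj (f t)) \<in> H2_plus"
proof (rule H2_plus_backward_shift)
  have f: "f \<in> L2"
    using assms by (rule H2_minus_L2)
  have "(\<integral>t. cnj (f t) * cnj (t powi k) \<partial>\<mu>) = 0" if "k \<le> 0" for k
  proof -
    have "(\<integral>t. cnj (f t) * cnj (t powi k) \<partial>\<mu>) = (\<integral>t. cnj (f t * cnj (t powi (- k))) \<partial>\<mu>)"
    proof (rule integral_circle_cong)
      fix t :: complex assume "norm t = 1"
      then show "cnj (f t) * cnj (t powi k) = cnj (f t * cnj (t powi (- k)))"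
        using cnj_powi_circle[of t "-k"] by (simp del: complex_cnj_power_int)
    qed
    also have "\<dots> = cnj (\<integral>t. f t * cnj (t powi (- k)) \<partial>\<mu>)"
      by (rule Bochner_Integration.integral_cnj)
    also have "\<dots> = 0"
      using H2_minus_orth[OF assms powi_H2_plus[of "-k"]] that by simp
    finally show ?thesis .
  qed
  from this[of 0] this show "(\<lambda>t. cnj (f t)) \<in> H2_plus" "(\<integral>t. cnj (f t) \<partial>\<mu>) = 0"
    using f by (auto simp: H2_plus_def)
qed

lemma cnj_powi_H2_minus:
  assumes "k < 0"
  shows "(\<lambda>t. t powi k) \<in> H2_minus"
  unfolding H2_minus_def
proof safe
  fix g assume "g \<in> H2_plus"
  have "(\<integral>t. t powi k * cnj (g t) \<partial>\<mu>) = (\<integral>t. cnj (g t * cnj (t powi k)) \<partial>\<mu>)"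
    by (simp add: mult.commute)
  also have "\<dots> = cnj (\<integral>t. g t * cnj (t powi k) \<partial>\<mu>)"
    by (rule Bochner_Integration.integral_cnj)
  finally show "(\<integral>t. t powi k * cnj (g t) \<partial>\<mu>) = 0"
    using H2_plus_orth[OF \<open>g \<in> H2_plus\<close> assms] by simp
qed simp

lemma H2_minus_mult_cnj:
  assumes "f \<in> H2_minus"
  shows "(\<lambda>t. cnj t * f t) \<in> H2_minus"
  unfolding H2_minus_def
proof safe
  show "(\<lambda>t. cnj t * f t) \<in> L2"
    by (rule L2_mult_bounded[where C = 1])
       (auto intro!: borel_measurable_circle borel_measurable_cnj H2_minus_L2 assms)
  fix g assume "g \<in> H2_plus"
  have "(\<integral>t. f t * cnj (t powi 1 * g t) \<partial>\<mu>) = 0"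
    by (intro H2_minus_orth assms H2_plus_mult_powi \<open>g \<in> H2_plus\<close>) auto
  then show "(\<integral>t. cnj t * f t * cnj (g t) \<partial>\<mu>) = 0"
    by (simp add: mult_ac)
qed

text \<open>The constant is the Fourier coefficient of f at -1. This mirrors
  \<open>H2_plus_decompose\<close>, but H^2_- is defined as an orthogonal complement, so membership
  of g is tested against every h in H^2_+.\<close>

lemma H2_minus_decompose:
  assumes "f \<in> H2_minus"
  obtains c g where "g \<in> H2_minus" "\<And>t. norm t = 1 \<Longrightarrow> f t = cnj t * (c + g t)"
proof -
  define c where "c = (\<integral>t. f t * t \<partial>\<mu>)"
  define g where "g t = t * f t - c" for t
  have tf: "(\<lambda>t. t * f t) \<in> L2"
    by (rule L2_mult_bounded[where C = 1])
       (auto intro!: borel_measurable_circle H2_minus_L2 assms)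
  have "g \<in> H2_minus"
    unfolding H2_minus_def
  proof safe
    show "g \<in> L2"
      unfolding g_def by (intro L2_diff tf L2_const)
    fix h assume "h \<in> H2_plus"
    \<comment> \<open>With h = d + t k the factor t cancels in t f cnj (t k), which leaves the
      orthogonality of f to k; the constant d is the mean of h, so the terms cnj d c from both parts
      of g cancel.\<close>
    then obtain d k where k: "k \<in> H2_plus" and h: "\<And>t. norm t = 1 \<Longrightarrow> h t = d + t * k t"
      by (rule H2_plus_decompose) auto
    have fk: "(\<integral>t. f t * cnj (k t) \<partial>\<mu>) = 0"
      using assms k by (rule H2_minus_orth)
    have "(\<integral>t. g t * cnj (h t) \<partial>\<mu>) = (\<integral>t. cnj d * (t * f t) + f t * cnj (k t) - c * cnj (h t) \<partial>\<mu>)"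
    proof (rule integral_circle_cong)
      fix t :: complex assume "norm t = 1"
      have "g t * cnj (h t) = t * f t * cnj (d + t * k t) - c * cnj (h t)"
        using h[OF \<open>norm t = 1\<close>] by (simp add: g_def algebra_simps)
      also have "t * f t * cnj (d + t * k t) = cnj d * (t * f t) + (t * cnj t) * (f t * cnj (k t))"
        by (simp add: algebra_simps)
      finally show "g t * cnj (h t) = cnj d * (t * f t) + f t * cnj (k t) - c * cnj (h t)"
        unfolding circle_mult_cnj[OF \<open>norm t = 1\<close>] by simp
    qed
    also have "\<dots> = cnj d * (\<integral>t. t * f t \<partial>\<mu>) + (\<integral>t. f t * cnj (k t) \<partial>\<mu>) - c * (\<integral>t. cnj (h t) \<partial>\<mu>)"
      using L2_imp_integrable[OF tf] L2_cnj_integrable[OF H2_minus_L2[OF assms] H2_plus_L2[OF k]]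
        L2_imp_integrable[OF L2_cnj[OF H2_plus_L2[OF \<open>h \<in> H2_plus\<close>]]]
      by simp
    also have "(\<integral>t. cnj (h t) \<partial>\<mu>) = cnj (\<integral>t. h t \<partial>\<mu>)"
      by (rule Bochner_Integration.integral_cnj)
    also have "(\<integral>t. h t \<partial>\<mu>) = (\<integral>t. d + k t * cnj (t powi (- 1)) \<partial>\<mu>)"
      by (rule integral_circle_cong) (use h cnj_powi_circle[of _ "-1"] in \<open>auto simp del: complex_cnj_power_int\<close>)
    also have "\<dots> = d + (\<integral>t. k t * cnj (t powi (- 1)) \<partial>\<mu>)"
      using L2_cnj_integrable[OF H2_plus_L2[OF k] powi_L2[of "-1"]]
      by (subst Bochner_Integration.integral_add) (auto simp del: complex_cnj_power_int)
    also have "\<dots> = d"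
      using H2_plus_orth[OF k, of "-1"] by simp
    finally show "(\<integral>t. g t * cnj (h t) \<partial>\<mu>) = 0"
      using fk by (simp add: c_def mult.commute)
  qed
  moreover have "f t = cnj t * (c + g t)" if "norm t = 1" for t
    using circle_mult_cnj[OF that] by (simp add: g_def mult.assoc[symmetric] mult.commute[of "cnj t"])
  ultimately show ?thesis
    by (rule that)
qed

text \<open>Splitting a trigonometric polynomial into its analytic and coanalytic parts can only bring
  it closer to a function in \<open>H\<^sup>2\<^sub>+\<close>, by orthogonality.\<close>

lemma poly_dense_H2_plus:
  assumes h: "h \<in> H2_plus" and e: "e > 0"
  obtains p where "L2_dist2 h (poly p) < e"
proof -
  have "h \<in> trig_closure"
    using h by (simp add: trig_closure_eq_L2 H2_plus_L2)
  then obtain N p where Np: "L2_dist2 h (trig N p) < e"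
    using e unfolding trig_closure_def by blast
  \<comment> \<open>Division by t^N separates the frequencies of t^-N p: the quotient carries those
    \<ge> 0, the remainder those from -N to -1, which are collected in \<open>f\<close>.\<close>
  define q where "q = p div monom 1 N"
  define r where "r = p mod monom 1 N"
  define f where "f t = (\<Sum>i<N. coeff r i * t powi (int i - int N))" for t
  have r: "coeff r i = 0" if "i \<ge> N" for i
  proof (cases "N = 0")
    case True
    then show ?thesis
      by (simp add: r_def)
  next
    case False
    then have "r = 0 \<or> degree r < N"
      unfolding r_def using degree_mod_less[of "monom 1 N" p] by (simp add: degree_monom_eq)
    then show ?thesis
      using that by (auto intro: coeff_eq_0)
  qed
  have trig_eq: "trig N p t = poly q t + f t" if t: "norm t = 1" for t
  proof -
    have "t \<noteq> 0"
      using t by auto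
    have "p = monom 1 N * q + r"
      by (simp add: q_def r_def)
    then have "trig N p t = (t * cnj t) ^ N * poly q t + cnj t ^ N * poly r t"
      by (simp add: trig_def poly_monom algebra_simps)
    also have "poly r t = (\<Sum>i<N. coeff r i * t ^ i)"
      unfolding poly_altdef using r
      by (intro sum.mono_neutral_cong) (auto intro: coeff_eq_0)
    also have "cnj t ^ N * \<dots> = f t"
      unfolding f_def sum_distrib_left
    proof (rule sum.cong)
      fix i
      have "cnj t ^ N = t powi (- int N)"
        using cnj_powi_circle[OF t, of "int N"] by simp
      then show "cnj t ^ N * (coeff r i * t ^ i) = coeff r i * t powi (int i - int N)"
        using power_int_add[of t "int i" "- int N"] \<open>t \<noteq> 0\<close> by (simp add: mult_ac)
    qed simp
    finally show ?thesis
      using circle_mult_cnj[OF t] by simp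
  qed
  define g where "g t = h t - poly q t" for t
  have g: "g \<in> H2_plus"
    unfolding g_def using h by (intro H2_plus_diff poly_H2_plus)
  have f: "f \<in> L2"
  proof -
    have "(\<lambda>t. \<Sum>i\<in>I. coeff r i * t powi (int i - int N)) \<in> L2" if "finite I" for I
      using that
    proof (induction I)
      case (insert i I)
      then show ?case
        unfolding sum.insert[OF insert.hyps] by (intro L2_add L2_cmult powi_L2) auto
    qed (simp add: L2_const)
    from this[of "{..<N}"] show ?thesis
      by (simp add: f_def[abs_def])
  qed
  have "(\<integral>t. g t * cnj (f t) \<partial>\<mu>) = (\<integral>t. (\<Sum>i<N. cnj (coeff r i) * (g t * cnj (t powi (int i - int N)))) \<partial>\<mu>)"
    by (simp add: f_def sum_distrib_left mult_ac)
  also have "\<dots> = (\<Sum>i<N. \<integral>t. cnj (coeff r i) * (g t * cnj (t powi (int i - int N))) \<partial>\<mu>)"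
    by (intro Bochner_Integration.integral_sum integrable_mult_right L2_cnj_integrable H2_plus_L2[OF g] powi_L2)
  also have "\<dots> = 0"
    using H2_plus_orth[OF g] by (intro sum.neutral) (auto simp del: complex_cnj_power_int)
  finally have gf: "(\<integral>t. g t * cnj (f t) \<partial>\<mu>) = 0" .
  have "L2_dist2 h (trig N p) = (\<integral>t. (norm (g t))\<^sup>2 + (norm (f t))\<^sup>2 - 2 * Re (g t * cnj (f t)) \<partial>\<mu>)"
    unfolding L2_dist2_def
  proof (rule integral_circle_cong)
    fix t :: complex assume "norm t = 1"
    then have "h t - trig N p t = g t - f t"
      by (simp add: trig_eq g_def)
    moreover have "(norm (g t - f t))\<^sup>2 = (norm (g t))\<^sup>2 + (norm (f t))\<^sup>2 - 2 * Re (g t * cnj (f t))"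
      unfolding cmod_power2 by (simp add: power2_eq_square algebra_simps)
    ultimately show "(norm (h t - trig N p t))\<^sup>2 = (norm (g t))\<^sup>2 + (norm (f t))\<^sup>2 - 2 * Re (g t * cnj (f t))"
      by (simp only:)
  qed
  also have "\<dots> = (\<integral>t. (norm (g t))\<^sup>2 \<partial>\<mu>) + (\<integral>t. (norm (f t))\<^sup>2 \<partial>\<mu>) - 2 * Re (\<integral>t. g t * cnj (f t) \<partial>\<mu>)"
    using L2_integrable[OF f] L2_integrable[OF H2_plus_L2[OF g]] L2_cnj_integrable[OF H2_plus_L2[OF g] f]
    by (simp add: integrable_Re integral_Re del: Re_complex_of_real times_complex.sel)
  also have "\<dots> \<ge> (\<integral>t. (norm (g t))\<^sup>2 \<partial>\<mu>)"
    by (simp add: gf)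
  finally have "L2_dist2 h (poly q) \<le> L2_dist2 h (trig N p)"
    by (simp add: L2_dist2_def g_def)
  with Np show ?thesis
    by (intro that[of q]) simp
qed

text \<open>For a polynomial p close to h, 1 - t p = (1 - t h) + t (h - p), and w \<le> 1 lets the
  error be measured in unweighted L^2. Squaring the sum costs a factor 2, hence the 1/2; what
  matters later is that the bound is positive and independent of h.\<close>

lemma Szego_H2_plus:
  assumes w: "AE t in \<mu>. 0 < w t" "AE t in \<mu>. w t \<le> 1"
      "w \<in> borel_measurable \<mu>" "integrable \<mu> (\<lambda>t. ln (w t))"
    and h: "h \<in> H2_plus"
  shows "exp (\<integral>t. ln (w t) \<partial>\<mu>) / 2 \<le> (\<integral>t. (norm (1 - t * h t))\<^sup>2 * w t \<partial>\<mu>)"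
proof -
  have "integrable \<mu> w"
    by (rule circle.integrable_const_bound[where B = 1]) (use w in auto)
  have int_w: "integrable \<mu> (\<lambda>t. (norm (f t))\<^sup>2 * w t)" if "f \<in> L2" for f
  proof (rule Bochner_Integration.integrable_bound[OF L2_integrable[OF that]])
    show "AE t in \<mu>. norm ((norm (f t))\<^sup>2 * w t) \<le> norm ((norm (f t))\<^sup>2)"
      using w(1,2) by eventually_elim (auto simp: abs_mult intro: mult_left_le)
  qed (use w(3) L2_measurable[OF that] in measurable)
  have th: "(\<lambda>t. 1 - t * h t) \<in> L2"
    using H2_plus_L2[OF H2_plus_mult_powi[OF h, of 1]] by (intro L2_diff L2_const) simp
  have "exp (\<integral>t. ln (w t) \<partial>\<mu>) \<le> 2 * (\<integral>t. (norm (1 - t * h t))\<^sup>2 * w t \<partial>\<mu>) + e" if e: "e > 0" for e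
  proof -
    obtain p where p: "L2_dist2 h (poly p) < e / 2"
      by (rule poly_dense_H2_plus[OF h, of "e / 2"]) (use e in auto)
    define q where "q = 1 - pCons 0 p"
    have q: "poly q t = 1 - t * poly p t" for t
      by (simp add: q_def)
    have "exp (\<integral>t. ln (w t) \<partial>\<mu>) \<le> (\<integral>t. (norm (poly q t))\<^sup>2 * w t \<partial>\<mu>)"
      by (rule Szego_poly) (use w \<open>integrable \<mu> w\<close> in \<open>auto simp: q\<close>)
    also have "\<dots> \<le> (\<integral>t. 2 * ((norm (1 - t * h t))\<^sup>2 * w t) + 2 * (norm (h t - poly p t))\<^sup>2 \<partial>\<mu>)"
    proof (rule integral_mono_AE)
      have "AE t in \<mu>. t \<in> space \<mu>"
        by (rule AE_space)
      then show "AE t in \<mu>. (norm (poly q t))\<^sup>2 * w t \<le>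
          2 * ((norm (1 - t * h t))\<^sup>2 * w t) + 2 * (norm (h t - poly p t))\<^sup>2"
        using w(1,2)
      proof eventually_elim
        case (elim t)
        have "poly q t = (1 - t * h t) + t * (h t - poly p t)"
          by (simp add: q algebra_simps)
        then have "(norm (poly q t))\<^sup>2 \<le> 2 * (norm (1 - t * h t))\<^sup>2 + 2 * (norm (t * (h t - poly p t)))\<^sup>2"
          by (metis norm_add_power2_le)
        then have "(norm (poly q t))\<^sup>2 * w t \<le>
            (2 * (norm (1 - t * h t))\<^sup>2 + 2 * (norm (h t - poly p t))\<^sup>2) * w t"
          using elim by (intro mult_right_mono) (auto simp: norm_mult)
        also have "\<dots> \<le> 2 * ((norm (1 - t * h t))\<^sup>2 * w t) + 2 * (norm (h t - poly p t))\<^sup>2"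
          using elim mult_left_le[of "w t" "(norm (h t - poly p t))\<^sup>2"] by (simp add: algebra_simps)
        finally show ?case .
      qed
    qed (intro Bochner_Integration.integrable_add integrable_mult_right int_w th L2_integrable L2_diff
        H2_plus_L2[OF h] H2_plus_L2[OF poly_H2_plus])+
    also have "\<dots> = 2 * (\<integral>t. (norm (1 - t * h t))\<^sup>2 * w t \<partial>\<mu>) + 2 * L2_dist2 h (poly p)"
      unfolding L2_dist2_def
      by (subst Bochner_Integration.integral_add)
         (auto intro!: int_w th L2_integrable L2_diff H2_plus_L2[OF h] H2_plus_L2[OF poly_H2_plus])
    finally show ?thesis
      using p by simp
  qed
  then have "exp (\<integral>t. ln (w t) \<partial>\<mu>) \<le> 2 * (\<integral>t. (norm (1 - t * h t))\<^sup>2 * w t \<partial>\<mu>)"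
    by (rule field_le_epsilon)
  then show ?thesis
    by simp
qed

section \<open>Complex Hilbert spaces on a carrier set\<close>

text \<open>The carrier is a set because L^R is a subset of \<open>L0\<close> and its inner product
  depends on R. The laws of scaling are global, as they hold on all of \<open>L0\<close>, while
  those of the inner product are confined to the carrier.\<close>

locale complex_hilbert =
  fixes H :: "'a::ab_group_add set"
    and scale :: "complex \<Rightarrow> 'a \<Rightarrow> 'a"  (infixr "\<cdot>" 75)
    and inn :: "'a \<Rightarrow> 'a \<Rightarrow> complex"
  assumes zero_closed [simp]: "0 \<in> H"
    and add_closed [simp]: "x \<in> H \<Longrightarrow> y \<in> H \<Longrightarrow> x + y \<in> H"
    and scale_closed [simp]: "x \<in> H \<Longrightarrow> c \<cdot> x \<in> H"
    and scale_add_right: "c \<cdot> (x + y) = c \<cdot> x + c \<cdot> y"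
    and scale_add_left: "(c + d) \<cdot> x = c \<cdot> x + d \<cdot> x"
    and scale_scale: "c \<cdot> d \<cdot> x = (c * d) \<cdot> x"
    and scale_one [simp]: "1 \<cdot> x = x"
    and inn_add_left: "x \<in> H \<Longrightarrow> y \<in> H \<Longrightarrow> z \<in> H \<Longrightarrow> inn (x + y) z = inn x z + inn y z"
    and inn_scale_left: "x \<in> H \<Longrightarrow> y \<in> H \<Longrightarrow> inn (c \<cdot> x) y = c * inn x y"
    and inn_commute: "x \<in> H \<Longrightarrow> y \<in> H \<Longrightarrow> inn y x = cnj (inn x y)"
    and inn_nonneg: "x \<in> H \<Longrightarrow> 0 \<le> Re (inn x x)"
    and inn_eq_0: "x \<in> H \<Longrightarrow> inn x x = 0 \<Longrightarrow> x = 0"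
    and complete: "(\<And>n::nat. X n \<in> H) \<Longrightarrow>
      (\<And>e. e > 0 \<Longrightarrow> \<exists>N. \<forall>m\<ge>N. \<forall>n\<ge>N. Re (inn (X m - X n) (X m - X n)) < e) \<Longrightarrow>
      \<exists>l\<in>H. (\<lambda>n. Re (inn (X n - l) (X n - l))) \<longlonglongrightarrow> 0"
begin

lemma scale_zero_left [simp]: "0 \<cdot> x = 0"
  using scale_add_left[of 0 0 x] by simp

lemma scale_minus_one: "(- 1) \<cdot> x = - x"
  using scale_add_left[of 1 "- 1" x] by (simp add: eq_neg_iff_add_eq_0 add.commute)

lemma uminus_closed [simp]: "x \<in> H \<Longrightarrow> - x \<in> H"
  using scale_closed[of x "- 1"] by (simp add: scale_minus_one)

lemma diff_closed [simp]: "x \<in> H \<Longrightarrow> y \<in> H \<Longrightarrow> x - y \<in> H"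
  using add_closed[of x "- y"] by simp

lemma scale_minus_right: "c \<cdot> (- x) = - (c \<cdot> x)"
  by (metis mult.commute scale_minus_one scale_scale)

lemma scale_diff_right: "c \<cdot> (x - y) = c \<cdot> x - c \<cdot> y"
  using scale_add_right[of c x "- y"] by (simp add: scale_minus_right)

lemma scale_minus_left: "(- c) \<cdot> x = - (c \<cdot> x)"
  by (metis mult_minus1 scale_minus_one scale_scale)

lemma scale_diff_left: "(c - d) \<cdot> x = c \<cdot> x - d \<cdot> x"
  using scale_add_left[of c "- d" x] by (simp add: scale_minus_left)

lemma inn_add_right: "x \<in> H \<Longrightarrow> y \<in> H \<Longrightarrow> z \<in> H \<Longrightarrow> inn x (y + z) = inn x y + inn x z"
  by (metis add_closed complex_cnj_add inn_add_left inn_commute)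

lemma inn_scale_right: "x \<in> H \<Longrightarrow> y \<in> H \<Longrightarrow> inn x (c \<cdot> y) = cnj c * inn x y"
  by (metis complex_cnj_mult inn_commute inn_scale_left scale_closed)

lemma inn_minus_left: "x \<in> H \<Longrightarrow> y \<in> H \<Longrightarrow> inn (- x) y = - inn x y"
  using inn_scale_left[of x y "- 1"] by (simp add: scale_minus_one)

lemma inn_minus_right: "x \<in> H \<Longrightarrow> y \<in> H \<Longrightarrow> inn x (- y) = - inn x y"
  using inn_scale_right[of x y "- 1"] by (simp add: scale_minus_one)

lemma inn_diff_left: "x \<in> H \<Longrightarrow> y \<in> H \<Longrightarrow> z \<in> H \<Longrightarrow> inn (x - y) z = inn x z - inn y z"
  using inn_add_left[of x "- y" z] by (simp add: inn_minus_left)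

lemma inn_diff_right: "x \<in> H \<Longrightarrow> y \<in> H \<Longrightarrow> z \<in> H \<Longrightarrow> inn x (y - z) = inn x y - inn x z"
  using inn_add_right[of x y "- z"] by (simp add: inn_minus_right)

lemma inn_zero [simp]: "x \<in> H \<Longrightarrow> inn 0 x = 0" "x \<in> H \<Longrightarrow> inn x 0 = 0"
  using inn_diff_left[of x x x] inn_diff_right[of x x x] by auto

lemmas inn_simps = inn_add_left inn_add_right inn_scale_left inn_scale_right inn_diff_left inn_diff_right

definition nm :: "'a \<Rightarrow> real" where
  "nm x = sqrt (Re (inn x x))"

lemma nm_power2: "x \<in> H \<Longrightarrow> (nm x)\<^sup>2 = Re (inn x x)"
  by (simp add: nm_def inn_nonneg)

lemma nm_nonneg [simp]: "x \<in> H \<Longrightarrow> 0 \<le> nm x"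
  by (simp add: nm_def inn_nonneg)

lemma inn_self: "x \<in> H \<Longrightarrow> inn x x = complex_of_real ((nm x)\<^sup>2)"
  using inn_commute[of x x] by (simp add: nm_power2 complex_eq_iff)

lemma nm_eq_0: "x \<in> H \<Longrightarrow> nm x = 0 \<longleftrightarrow> x = 0"
  using inn_self[of x] inn_eq_0[of x] by (auto simp: nm_def)

lemma nm_scale: "x \<in> H \<Longrightarrow> nm (c \<cdot> x) = norm c * nm x"
proof -
  assume x: "x \<in> H"
  have "inn (c \<cdot> x) (c \<cdot> x) = (c * cnj c) * inn x x"
    using x by (simp add: inn_simps)
  also have "\<dots> = complex_of_real ((norm c * nm x)\<^sup>2)"
    using x by (simp add: inn_self power_mult_distrib flip: complex_norm_square)
  finally show ?thesis
    using x by (simp add: nm_def[of "c \<cdot> x"])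
qed

lemma nm_minus: "x \<in> H \<Longrightarrow> nm (- x) = nm x"
  using nm_scale[of x "- 1"] by (simp add: scale_minus_one)

lemma nm_minus_commute: "x \<in> H \<Longrightarrow> y \<in> H \<Longrightarrow> nm (x - y) = nm (y - x)"
  using nm_minus[of "x - y"] by simp

lemma nm_add_power2: "x \<in> H \<Longrightarrow> y \<in> H \<Longrightarrow> (nm (x + y))\<^sup>2 = (nm x)\<^sup>2 + (nm y)\<^sup>2 + 2 * Re (inn x y)"
  using inn_commute[of x y] by (simp add: nm_power2 inn_simps)

text \<open>Pythagoras for the component of x along y. Dropping the remainder gives the
  Cauchy-Schwarz inequality; comparing x with the remainder gives the orthogonality of a
  minimizer.\<close>

lemma split_along:
  assumes x: "x \<in> H" and y: "y \<in> H" and "y \<noteq> 0"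
  defines "c \<equiv> inn x y / complex_of_real ((nm y)\<^sup>2)"
  shows "0 < nm y" "(nm x)\<^sup>2 = (nm (x - c \<cdot> y))\<^sup>2 + (norm c * nm y)\<^sup>2"
proof -
  show ny: "0 < nm y"
    using y \<open>y \<noteq> 0\<close> nm_eq_0[of y] nm_nonneg[of y] by linarith
  define z where "z = x - c \<cdot> y"
  have z: "z \<in> H" "inn z y = 0"
    using x y ny by (simp_all add: z_def inn_simps c_def inn_self)
  have "x = z + c \<cdot> y"
    by (simp add: z_def)
  then have "(nm x)\<^sup>2 = (nm z)\<^sup>2 + (norm c * nm y)\<^sup>2"
    using z y by (simp add: nm_add_power2 inn_simps nm_scale)
  then show "(nm x)\<^sup>2 = (nm (x - c \<cdot> y))\<^sup>2 + (norm c * nm y)\<^sup>2"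
    by (simp only: z_def)
qed

lemma Cauchy_Schwarz:
  assumes x: "x \<in> H" and y: "y \<in> H"
  shows "norm (inn x y) \<le> nm x * nm y"
proof (cases "y = 0")
  case True
  then show ?thesis
    using x by (simp add: nm_def)
next
  case False
  define c where "c = inn x y / complex_of_real ((nm y)\<^sup>2)"
  note split = split_along[OF x y False, folded c_def]
  have "(norm c * nm y)\<^sup>2 \<le> (nm x)\<^sup>2"
    unfolding split(2) by simp
  then have "norm c * nm y \<le> nm x"
    by (rule power2_le_imp_le) (use x in simp)
  moreover have "norm c = norm (inn x y) / (nm y)\<^sup>2"
    unfolding c_def norm_divide norm_of_real by simp
  ultimately show ?thesis
    using split(1) by (simp add: power2_eq_square field_simps)
qed

lemma nm_triangle: "x \<in> H \<Longrightarrow> y \<in> H \<Longrightarrow> nm (x + y) \<le> nm x + nm y"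
proof -
  assume x: "x \<in> H" and y: "y \<in> H"
  have "Re (inn x y) \<le> nm x * nm y"
    using Cauchy_Schwarz[OF x y] complex_Re_le_cmod[of "inn x y"] by simp
  then have "(nm (x + y))\<^sup>2 \<le> (nm x + nm y)\<^sup>2"
    using x y by (simp add: nm_add_power2 power2_sum)
  then show ?thesis
    by (rule power2_le_imp_le) (use x y in simp)
qed

lemma nm_triangle_diff:
  "x \<in> H \<Longrightarrow> y \<in> H \<Longrightarrow> z \<in> H \<Longrightarrow> nm (x - z) \<le> nm (x - y) + nm (y - z)"
  using nm_triangle[of "x - y" "y - z"] by simp

lemma Cauchy_limit:
  assumes X: "\<And>n::nat. X n \<in> H"
    and C: "\<And>e. e > 0 \<Longrightarrow> \<exists>N. \<forall>m\<ge>N. \<forall>n\<ge>N. nm (X m - X n) < e"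
  obtains l where "l \<in> H" "(\<lambda>n. nm (X n - l)) \<longlonglongrightarrow> 0"
proof -
  have "\<exists>l\<in>H. (\<lambda>n. Re (inn (X n - l) (X n - l))) \<longlonglongrightarrow> 0"
  proof (rule complete[OF X])
    fix e :: real assume "e > 0"
    then obtain N where N: "\<And>m n. m \<ge> N \<Longrightarrow> n \<ge> N \<Longrightarrow> nm (X m - X n) < sqrt e"
      using C[of "sqrt e"] by auto
    then show "\<exists>N. \<forall>m\<ge>N. \<forall>n\<ge>N. Re (inn (X m - X n) (X m - X n)) < e"
      by (auto simp: nm_def)
  qed
  then obtain l where lH: "l \<in> H" and l: "(\<lambda>n. Re (inn (X n - l) (X n - l))) \<longlonglongrightarrow> 0"
    by blast
  have "(\<lambda>n. nm (X n - l)) \<longlonglongrightarrow> 0"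
    using tendsto_real_sqrt[OF l] by (simp add: nm_def)
  with lH show ?thesis
    by (rule that)
qed

section \<open>Closed subspaces: projections, and resolvents of contractions\<close>

definition closed_subspace :: "'a set \<Rightarrow> bool" where
  "closed_subspace M \<longleftrightarrow> M \<subseteq> H \<and> 0 \<in> M \<and> (\<forall>x\<in>M. \<forall>y\<in>M. x + y \<in> M) \<and> (\<forall>c. \<forall>x\<in>M. c \<cdot> x \<in> M) \<and>
    (\<forall>x\<in>H. (\<forall>e>0. \<exists>y\<in>M. nm (x - y) < e) \<longrightarrow> x \<in> M)"

context
  fixes M
  assumes M: "closed_subspace M"
begin

lemma subspace_carrier: "x \<in> M \<Longrightarrow> x \<in> H"
  and subspace_zero: "0 \<in> M"
  and subspace_add: "x \<in> M \<Longrightarrow> y \<in> M \<Longrightarrow> x + y \<in> M"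
  and subspace_scale: "x \<in> M \<Longrightarrow> c \<cdot> x \<in> M"
  and subspace_closed: "x \<in> H \<Longrightarrow> (\<And>e. e > 0 \<Longrightarrow> \<exists>y\<in>M. nm (x - y) < e) \<Longrightarrow> x \<in> M"
  using M unfolding closed_subspace_def by blast+

lemma subspace_diff: "x \<in> M \<Longrightarrow> y \<in> M \<Longrightarrow> x - y \<in> M"
  using subspace_add[of x "- y"] subspace_scale[of y "- 1"] by (simp add: scale_minus_one)

lemma subspace_limit:
  assumes X: "\<And>n::nat. X n \<in> M" and l: "l \<in> H" "(\<lambda>n. nm (X n - l)) \<longlonglongrightarrow> 0"
  shows "l \<in> M"
proof (rule subspace_closed[OF l(1)])
  fix e :: real assume "e > 0"
  then have "\<forall>\<^sub>F n in sequentially. nm (X n - l) < e"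
    using l(2) by (intro order_tendstoD) auto
  then obtain n where "nm (X n - l) < e"
    by (auto simp: eventually_sequentially)
  then have "nm (l - X n) < e"
    using l(1) subspace_carrier[OF X] by (simp add: nm_minus_commute)
  then show "\<exists>y\<in>M. nm (l - y) < e"
    using X by blast
qed

text \<open>Moving g by c y, with c y the component of x - g along y, lowers the squared distance by
  (|c| |y|)^2, so minimality forces c = 0.\<close>

lemma minimizer_orthogonal:
  assumes x: "x \<in> H" and g: "g \<in> M" and min: "\<And>y. y \<in> M \<Longrightarrow> nm (x - g) \<le> nm (x - y)"
    and y: "y \<in> M"
  shows "inn (x - g) y = 0"
proof (cases "y = 0")
  case True
  then show ?thesis
    using x g by (simp add: subspace_carrier)
next
  case False
  note H = subspace_carrier[OF g] subspace_carrier[OF y]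
  have xg: "x - g \<in> H"
    using x H by simp
  define c where "c = inn (x - g) y / complex_of_real ((nm y)\<^sup>2)"
  note split = split_along[OF xg H(2) False, folded c_def]
  have eq: "x - g - c \<cdot> y = x - (g + c \<cdot> y)"
    by (simp add: algebra_simps)
  have "(nm (x - g))\<^sup>2 \<le> (nm (x - (g + c \<cdot> y)))\<^sup>2"
    using xg g y by (intro power_mono min subspace_add subspace_scale) auto
  then have "(norm c * nm y)\<^sup>2 \<le> 0"
    using split(2) unfolding eq by linarith
  then have "c = 0"
    using split(1) by simp
  then show ?thesis
    using split(1) by (simp add: c_def)
qed

lemma projection_exists:
  assumes x: "x \<in> H"
  obtains g where "g \<in> M" "\<And>y. y \<in> M \<Longrightarrow> inn (x - g) y = 0"
proof -
  define \<delta> where "\<delta> = (INF y\<in>M. (nm (x - y))\<^sup>2)"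
  have bdd: "bdd_below ((\<lambda>y. (nm (x - y))\<^sup>2) ` M)"
    by (rule bdd_belowI[of _ 0]) auto
  have \<delta>: "\<delta> \<le> (nm (x - y))\<^sup>2" if "y \<in> M" for y
    unfolding \<delta>_def by (intro cINF_lower bdd that)
  have "\<exists>y\<in>M. (nm (x - y))\<^sup>2 < \<delta> + e" if "e > 0" for e
    using that cINF_less_iff[OF _ bdd, of "\<delta> + e"] subspace_zero by (auto simp: \<delta>_def[symmetric])
  then have "\<forall>n::nat. \<exists>y\<in>M. (nm (x - y))\<^sup>2 < \<delta> + inverse (Suc n)"
    by simp
  then obtain Y where Y: "\<And>n::nat. Y n \<in> M" "\<And>n. (nm (x - Y n))\<^sup>2 < \<delta> + inverse (Suc n)"
    by metis
  note YH = subspace_carrier[OF Y(1)]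
  have par: "(nm (Y m - Y n))\<^sup>2 \<le> 2 * (inverse (Suc m) + inverse (Suc n))" for m n
  proof -
    define a where "a = x - Y m"
    define b where "b = x - Y n"
    have ab: "a \<in> H" "b \<in> H"
      using x YH by (auto simp: a_def b_def)
    have "(nm (a + b))\<^sup>2 + (nm (a - b))\<^sup>2 = 2 * (nm a)\<^sup>2 + 2 * (nm b)\<^sup>2"
      using nm_add_power2[OF ab] nm_add_power2[of a "- b"] ab by (simp add: inn_minus_right nm_minus)
    \<comment> \<open>The vector a + b is twice the difference of x and the midpoint of
      \<open>Y m\<close> and \<open>Y n\<close>, and the midpoint lies in M. In the parallelogram
      law this forces the minimizing sequence to be Cauchy.\<close>
    moreover have "(nm (a + b))\<^sup>2 \<ge> 4 * \<delta>"
    proof -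
      have two: "2 \<cdot> z = z + z" for z
        using scale_add_left[of 1 1 z] by simp
      have "2 \<cdot> ((1/2) \<cdot> (Y m + Y n)) = Y m + Y n"
        by (simp only: scale_scale) simp
      then have "a + b = 2 \<cdot> (x - (1/2) \<cdot> (Y m + Y n))"
        unfolding scale_diff_right by (simp add: two a_def b_def)
      then have "nm (a + b) = 2 * nm (x - (1/2) \<cdot> (Y m + Y n))"
        using x YH by (simp add: nm_scale)
      then show ?thesis
        using \<delta>[OF subspace_scale[OF subspace_add[OF Y(1) Y(1)]], of "1/2" m n]
        by (simp add: power_mult_distrib)
    qed
    moreover have "a - b = - (Y m - Y n)"
      by (simp add: a_def b_def)
    then have "nm (a - b) = nm (Y m - Y n)"
      using YH by (simp only: nm_minus diff_closed)
    ultimately show ?thesis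
      using Y(2)[of m] Y(2)[of n] unfolding a_def[symmetric] b_def[symmetric] by simp
  qed
  obtain g where g: "g \<in> H" "(\<lambda>n. nm (Y n - g)) \<longlonglongrightarrow> 0"
  proof (rule Cauchy_limit[OF YH])
    fix e :: real assume "e > 0"
    then obtain N where N: "inverse (Suc N) < e\<^sup>2 / 4"
      using reals_Archimedean[of "e\<^sup>2 / 4"] by auto
    have "nm (Y m - Y n) < e" if "m \<ge> N" "n \<ge> N" for m n
    proof -
      have "inverse (real (Suc m)) \<le> inverse (Suc N)" "inverse (real (Suc n)) \<le> inverse (Suc N)"
        using that by (auto intro!: le_imp_inverse_le)
      then have "2 * (inverse (real (Suc m)) + inverse (real (Suc n))) \<le> 2 * (inverse (Suc N) + inverse (Suc N))"
        by (intro mult_left_mono add_mono) auto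
      also have "\<dots> < e\<^sup>2"
        using N by simp
      finally have "(nm (Y m - Y n))\<^sup>2 < e\<^sup>2"
        by (rule le_less_trans[OF par])
      then show ?thesis
        by (rule power2_less_imp_less) (use \<open>e > 0\<close> in simp)
    qed
    then show "\<exists>N. \<forall>m\<ge>N. \<forall>n\<ge>N. nm (Y m - Y n) < e"
      by blast
  qed
  have "g \<in> M"
    using Y(1) g by (rule subspace_limit)
  have le: "nm (x - g) \<le> nm (x - Y n) + nm (Y n - g)" for n
    by (rule nm_triangle_diff) (use x YH g in auto)
  have nY: "(\<lambda>n. sqrt (\<delta> + inverse (Suc n)) + nm (Y n - g)) \<longlonglongrightarrow> sqrt (\<delta> + 0) + 0"
    by (intro tendsto_intros g(2) LIMSEQ_inverse_real_of_nat)
  have "nm (x - Y n) \<le> sqrt (\<delta> + inverse (Suc n))" for n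
    using Y(2)[of n] by (intro real_le_rsqrt less_imp_le)
  then have "nm (x - g) \<le> sqrt (\<delta> + inverse (Suc n)) + nm (Y n - g)" for n
    using le by (meson add_right_mono order_trans)
  then have "nm (x - g) \<le> sqrt \<delta>"
    using LIMSEQ_le_const[OF nY] by auto
  have "nm (x - g) \<le> nm (x - y)" if "y \<in> M" for y
  proof -
    have "sqrt \<delta> \<le> nm (x - y)"
      by (rule real_le_lsqrt) (use \<delta>[OF that] x subspace_carrier[OF that] in auto)
    then show ?thesis
      using \<open>nm (x - g) \<le> sqrt \<delta>\<close> by linarith
  qed
  then show ?thesis
    using that[OF \<open>g \<in> M\<close>] minimizer_orthogonal[OF x \<open>g \<in> M\<close>] by blast
qed

text \<open>Fixed point iteration for f = g + \<zeta> A f, that is, the Neumann series. The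
  conclusion is a unique existence because \<open>resolv\<close> is a definite description.\<close>

lemma contraction_resolvent:
  assumes A: "\<And>x. x \<in> M \<Longrightarrow> A x \<in> M" "\<And>x y. x \<in> M \<Longrightarrow> y \<in> M \<Longrightarrow> A (x - y) = A x - A y"
      "\<And>x. x \<in> M \<Longrightarrow> nm (A x) \<le> nm x"
    and \<zeta>: "norm \<zeta> < 1" and g: "g \<in> M"
  shows "\<exists>!f. f \<in> M \<and> f - \<zeta> \<cdot> A f = g"
proof -
  define X where "X = rec_nat g (\<lambda>_ f. g + \<zeta> \<cdot> A f)"
  have X_Suc: "X (Suc n) = g + \<zeta> \<cdot> A (X n)" for n
    by (simp add: X_def)
  have XM: "X n \<in> M" for n
    by (induction n) (auto simp: X_Suc X_def intro!: subspace_add subspace_scale A g)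
  note XH = subspace_carrier[OF XM]
  have contr: "nm (\<zeta> \<cdot> A x - \<zeta> \<cdot> A y) \<le> norm \<zeta> * nm (x - y)" if "x \<in> M" "y \<in> M" for x y
  proof -
    have "\<zeta> \<cdot> A x - \<zeta> \<cdot> A y = \<zeta> \<cdot> A (x - y)"
      using that by (simp add: A scale_diff_right)
    then show ?thesis
      using that A(3)[of "x - y"] subspace_diff[of x y]
      by (simp add: nm_scale A(1) subspace_carrier mult_left_mono)
  qed
  have step: "nm (X (n + k) - X n) \<le> norm \<zeta> ^ n * nm (X k - g)" for n k
  proof (induction n)
    case 0
    then show ?case
      by (simp add: X_def)
  next
    case (Suc n)
    have "nm (X (Suc n + k) - X (Suc n)) \<le> norm \<zeta> * nm (X (n + k) - X n)"
      using contr[OF XM XM, of "n + k" n] by (simp add: X_Suc)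
    also have "\<dots> \<le> norm \<zeta> * (norm \<zeta> ^ n * nm (X k - g))"
      by (intro mult_left_mono Suc.IH) auto
    finally show ?case by simp
  qed
  \<comment> \<open>The solution of C = |\<zeta>| C + |g|, so that the bound on the iterates
    reproduces itself in the induction.\<close>
  define C where "C = nm g / (1 - norm \<zeta>)"
  have gH: "g \<in> H"
    using g by (rule subspace_carrier)
  have "C \<ge> 0"
    using \<zeta> gH by (simp add: C_def)
  have Xg: "nm (X k - g) \<le> C" for k
  proof (induction k)
    case 0
    then show ?case
      using \<open>C \<ge> 0\<close> by (simp add: X_def nm_def)
  next
    case (Suc k)
    have AX: "A (X k) \<in> H"
      using A(1)[OF XM] by (rule subspace_carrier)
    have "nm (X (Suc k) - g) = norm \<zeta> * nm (A (X k))"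
      using AX by (simp add: X_Suc nm_scale)
    also have "\<dots> \<le> norm \<zeta> * (nm (X k - g) + nm g)"
      using A(3)[OF XM, of k] nm_triangle[of "X k - g" g] XH[of k] gH by (intro mult_left_mono) auto
    also have "\<dots> \<le> norm \<zeta> * C + 1 * nm g"
      unfolding distrib_left using Suc \<zeta> gH by (intro add_mono mult_left_mono mult_right_mono) auto
    also have "\<dots> = C"
      using \<zeta> by (simp add: C_def field_simps)
    finally show ?case .
  qed
  obtain f where f: "f \<in> H" "(\<lambda>n. nm (X n - f)) \<longlonglongrightarrow> 0"
  proof (rule Cauchy_limit[OF XH])
    fix e :: real assume e: "e > 0"
    have "(\<lambda>n. norm \<zeta> ^ n * C) \<longlonglongrightarrow> 0 * C"
      using \<zeta> by (intro tendsto_intros LIMSEQ_realpow_zero) auto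
    then have "\<forall>\<^sub>F n in sequentially. norm \<zeta> ^ n * C < e"
      using e by (intro order_tendstoD) auto
    then obtain N where N: "\<And>n. n \<ge> N \<Longrightarrow> norm \<zeta> ^ n * C < e"
      by (auto simp: eventually_sequentially)
    have *: "nm (X m - X n) < e" if "n \<ge> N" "n \<le> m" for m n
    proof -
      have "nm (X m - X n) \<le> norm \<zeta> ^ n * nm (X (m - n) - g)"
        using step[of n "m - n"] that by simp
      also have "\<dots> \<le> norm \<zeta> ^ n * C"
        by (intro mult_left_mono Xg) auto
      finally show ?thesis
        using N[OF that(1)] by simp
    qed
    have "nm (X m - X n) < e" if "n \<ge> N" "m \<ge> N" for m n
      using *[of n m] *[of m n] that nm_minus_commute[OF XH XH, of m n] by (cases "n \<le> m") auto
    then show "\<exists>N. \<forall>m\<ge>N. \<forall>n\<ge>N. nm (X m - X n) < e"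
      by blast
  qed
  have fM: "f \<in> M"
    using XM f by (rule subspace_limit)
  \<comment> \<open>The residual of the limit; it is bounded by the distances of two consecutive
    iterates from f and therefore vanishes.\<close>
  define r where "r = f - (g + \<zeta> \<cdot> A f)"
  have AH: "A x \<in> H" if "x \<in> M" for x
    using that A(1) subspace_carrier by blast
  have r: "r \<in> H"
    using f(1) gH AH[OF fM] by (simp add: r_def)
  have "nm r \<le> nm (X (Suc n) - f) + nm (X n - f)" for n
  proof -
    have "nm r \<le> nm (f - X (Suc n)) + nm (X (Suc n) - (g + \<zeta> \<cdot> A f))"
      unfolding r_def by (rule nm_triangle_diff) (use f(1) XH gH AH[OF fM] in auto)
    also have "X (Suc n) - (g + \<zeta> \<cdot> A f) = \<zeta> \<cdot> A (X n) - \<zeta> \<cdot> A f"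
      by (simp add: X_Suc)
    also have "nm \<dots> \<le> norm \<zeta> * nm (X n - f)"
      using contr XM fM by blast
    also have "\<dots> \<le> 1 * nm (X n - f)"
      using \<zeta> XH f(1) by (intro mult_right_mono) auto
    finally show ?thesis
      using nm_minus_commute[OF f(1) XH] by simp
  qed
  moreover have "(\<lambda>n. nm (X (Suc n) - f) + nm (X n - f)) \<longlonglongrightarrow> 0 + 0"
    by (intro tendsto_add f(2) LIMSEQ_Suc[OF f(2)])
  ultimately have "nm r \<le> 0"
    using LIMSEQ_le_const by fastforce
  then have "r = 0"
    using r nm_eq_0[of r] nm_nonneg[of r] by linarith
  then have "f - \<zeta> \<cdot> A f = g"
    by (simp add: r_def algebra_simps)
  moreover have "f' = f" if f': "f' \<in> M" "f' - \<zeta> \<cdot> A f' = g" for f'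
  proof -
    have "f' - f - (\<zeta> \<cdot> A f' - \<zeta> \<cdot> A f) = (f' - \<zeta> \<cdot> A f') - (f - \<zeta> \<cdot> A f)"
      by (simp add: algebra_simps)
    then have "f' - f = \<zeta> \<cdot> A f' - \<zeta> \<cdot> A f"
      unfolding f'(2) \<open>f - \<zeta> \<cdot> A f = g\<close> by simp
    then have le: "nm (f' - f) \<le> norm \<zeta> * nm (f' - f)"
      using contr[OF f'(1) fM] by simp
    have dH: "f' - f \<in> H"
      using f'(1) fM by (simp add: subspace_carrier)
    have "(1 - norm \<zeta>) * nm (f' - f) \<le> 0"
      using le by (simp add: algebra_simps)
    then have "nm (f' - f) = 0"
      using \<zeta> nm_nonneg[OF dH] by (simp add: mult_le_0_iff)
    then show ?thesis
      using nm_eq_0[OF dH] by simp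
  qed
  ultimately show ?thesis
    using fM by blast
qed

end

end

section \<open>One-dimensional gaps between closed subspaces\<close>

lemma pos_complex_iff: "0 < z \<longleftrightarrow> 0 < Re z \<and> Im z = 0" for z :: complex
  by (auto simp: less_complex_def)

lemma pos_complex_of_real: "0 < z \<longleftrightarrow> (\<exists>r>0. z = complex_of_real r)"
  by (auto simp: pos_complex_iff complex_eq_iff)

context complex_hilbert
begin

text \<open>As F = g + \<zeta> A F, the difference F - g is of order |\<zeta>| once F is bounded.
  For |\<zeta>| < 1/2 the term \<zeta> A F has at most half the norm of F and can be absorbed,
  whence |F| \<le> 2 |g|.\<close>

lemma resolvent_tendsto:
  assumes M: "closed_subspace M"
    and A: "\<And>x. x \<in> M \<Longrightarrow> A x \<in> M" "\<And>x. x \<in> M \<Longrightarrow> nm (A x) \<le> nm x"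
    and F: "\<And>\<zeta>. norm \<zeta> < 1 \<Longrightarrow> F \<zeta> \<in> M \<and> F \<zeta> - \<zeta> \<cdot> A (F \<zeta>) = g"
    and g: "g \<in> M" and k: "k \<in> H"
  shows "((\<lambda>\<zeta>. inn (F \<zeta>) k) \<longlongrightarrow> inn g k) (at 0)"
proof -
  note MH = subspace_carrier[OF M]
  have bound: "norm (inn (F \<zeta>) k - inn g k) \<le> norm \<zeta> * (2 * nm g * nm k)" if \<zeta>: "norm \<zeta> < 1 / 2" for \<zeta>
  proof -
    have F': "F \<zeta> \<in> M" "F \<zeta> = g + \<zeta> \<cdot> A (F \<zeta>)"
      using F[of \<zeta>] \<zeta> by (auto simp: algebra_simps)
    note FH = MH[OF F'(1)] MH[OF A(1)[OF F'(1)]] MH[OF g]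
    have "nm (F \<zeta>) \<le> nm g + nm (\<zeta> \<cdot> A (F \<zeta>))"
      by (subst F'(2)) (rule nm_triangle, use FH in auto)
    also have "nm (\<zeta> \<cdot> A (F \<zeta>)) = norm \<zeta> * nm (A (F \<zeta>))"
      using FH by (simp add: nm_scale)
    also have "\<dots> \<le> 1 / 2 * nm (F \<zeta>)"
      using \<zeta> FH A(2)[OF F'(1)] by (intro mult_mono) auto
    finally have nF: "nm (F \<zeta>) \<le> 2 * nm g"
      by simp
    have "inn (F \<zeta>) k - inn g k = inn (F \<zeta> - g) k"
      using FH k by (simp add: inn_diff_left)
    also have "F \<zeta> - g = \<zeta> \<cdot> A (F \<zeta>)"
      using F[of \<zeta>] \<zeta> by (auto simp: algebra_simps)
    also have "norm (inn (\<zeta> \<cdot> A (F \<zeta>)) k) = norm \<zeta> * norm (inn (A (F \<zeta>)) k)"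
      using FH k by (simp add: inn_scale_left norm_mult)
    also have "\<dots> \<le> norm \<zeta> * (nm (A (F \<zeta>)) * nm k)"
      using FH k by (intro mult_left_mono Cauchy_Schwarz) auto
    also have "\<dots> \<le> norm \<zeta> * (2 * nm g * nm k)"
      using A(2)[OF F'(1)] nF k by (intro mult_left_mono mult_right_mono) auto
    finally show ?thesis .
  qed
  have "((\<lambda>\<zeta>. inn (F \<zeta>) k - inn g k) \<longlongrightarrow> 0) (at 0)"
  proof (rule Lim_null_comparison)
    have "\<forall>\<^sub>F \<zeta>::complex in at 0. norm \<zeta> < 1 / 2"
      by (auto simp: eventually_at intro!: exI[of _ "1/2"])
    then show "\<forall>\<^sub>F \<zeta> in at 0. norm (inn (F \<zeta>) k - inn g k) \<le> norm \<zeta> * (2 * nm g * nm k)"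
      by eventually_elim (rule bound)
    show "((\<lambda>\<zeta>::complex. norm \<zeta> * (2 * nm g * nm k)) \<longlongrightarrow> 0) (at 0)"
      by (auto intro!: tendsto_eq_intros)
  qed
  then show ?thesis
    by (simp add: LIM_zero_iff)
qed

text \<open>The last clause says that M is N plus the line through k, so codimension one is part of
  the notion; the vector e fixes the phase of k.\<close>

definition unit_gap :: "'a set \<Rightarrow> 'a set \<Rightarrow> 'a \<Rightarrow> 'a \<Rightarrow> bool" where
  "unit_gap M N e k \<longleftrightarrow> k \<in> M \<and> (\<forall>g\<in>N. inn k g = 0) \<and> nm k = 1 \<and> 0 < inn e k \<and>
    (\<forall>x\<in>M. x - inn x k \<cdot> k \<in> N)"

text \<open>The vector k is e minus its projection to N, normalized, so the inner product of e and k
  is the distance from e to N and thus positive. Approximation of M by N plus the line of e is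
  enough for the exact decomposition because N is closed.\<close>

lemma unit_gap_exists:
  assumes M: "closed_subspace M" and N: "closed_subspace N" and NM: "N \<subseteq> M"
    and e: "e \<in> M" "e \<notin> N"
    and dense: "\<And>x \<epsilon>. x \<in> M \<Longrightarrow> \<epsilon> > 0 \<Longrightarrow> \<exists>c. \<exists>g\<in>N. nm (x - (c \<cdot> e + g)) < \<epsilon>"
  obtains k where "unit_gap M N e k"
proof -
  note MH = subspace_carrier[OF M]
  have eH: "e \<in> H"
    using e MH by blast
  obtain g0 where g0: "g0 \<in> N" "\<And>y. y \<in> N \<Longrightarrow> inn (e - g0) y = 0"
    using projection_exists[OF N eH] by blast
  define v where "v = e - g0"
  have g0M: "g0 \<in> M"
    using g0 NM by blast
  have v: "v \<in> M"
    unfolding v_def by (intro subspace_diff[OF M] e g0M)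
  have vH: "v \<in> H"
    using v MH by blast
  have "v \<noteq> 0"
    using e g0 by (auto simp: v_def)
  then have nv: "nm v > 0"
    using nm_eq_0[OF vH] nm_nonneg[OF vH] by linarith
  define k where "k = complex_of_real (1 / nm v) \<cdot> v"
  have k: "k \<in> M"
    unfolding k_def by (intro subspace_scale[OF M] v)
  have kH: "k \<in> H"
    using k MH by blast
  have k_orth: "inn k g = 0" if "g \<in> N" for g
    using g0(2)[OF that] that NM MH vH unfolding k_def v_def[symmetric]
    by (subst inn_scale_left) auto
  have nk: "nm k = 1"
    unfolding k_def using nv by (simp add: nm_scale[OF vH] norm_divide)
  have vk: "inn v k = complex_of_real (nm v)"
    unfolding k_def using nv vH by (simp add: inn_scale_right inn_self power2_eq_square)
  have orth_k: "inn g k = 0" if "g \<in> N" for g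
    using inn_commute[OF kH, of g] k_orth[OF that] that NM MH by auto
  have "inn e k = inn v k + inn g0 k"
    using vH kH MH[OF g0M] by (simp add: v_def eH inn_diff_left)
  then have ek: "inn e k = complex_of_real (nm v)"
    using vk orth_k[OF g0(1)] by simp
  have decomp: "x - inn x k \<cdot> k \<in> N" if x: "x \<in> M" for x
  proof (rule subspace_closed[OF N])
    have xH: "x \<in> H"
      using x MH by blast
    show "x - inn x k \<cdot> k \<in> H"
      using xH kH by simp
    fix \<epsilon> :: real assume "\<epsilon> > 0"
    \<comment> \<open>Removing the component along k maps y = c e + g into N exactly and at most
      doubles the norm of the error x - y, hence the \<epsilon> / 2.\<close>
    then obtain c g where g: "g \<in> N" and cg: "nm (x - (c \<cdot> e + g)) < \<epsilon> / 2"
      using dense[OF x, of "\<epsilon> / 2"] by auto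
    have gH: "g \<in> H"
      using g NM MH by blast
    define y where "y = c \<cdot> e + g"
    have yH: "y \<in> H"
      using eH gH by (simp add: y_def)
    define z where "z = x - y"
    have zH: "z \<in> H"
      using xH yH by (simp add: z_def)
    have "inn y k = c * complex_of_real (nm v)"
      using eH gH kH ek orth_k[OF g] by (simp add: y_def inn_simps)
    then have "inn y k \<cdot> k = c \<cdot> v"
      using nv by (simp add: k_def scale_scale)
    then have "y - inn y k \<cdot> k = c \<cdot> g0 + g"
      by (simp add: y_def v_def scale_diff_right)
    then have "y - inn y k \<cdot> k \<in> N"
      using g0(1) g by (simp add: subspace_add[OF N] subspace_scale[OF N])
    moreover have "(x - inn x k \<cdot> k) - (y - inn y k \<cdot> k) = z - inn z k \<cdot> k"
      using xH yH kH by (simp add: z_def inn_diff_left scale_diff_left)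
    moreover have "nm (z - inn z k \<cdot> k) < \<epsilon>"
    proof -
      have "nm (z - inn z k \<cdot> k) \<le> nm z + nm (inn z k \<cdot> k)"
        using nm_triangle[of z "- (inn z k \<cdot> k)"] zH kH by (simp add: nm_minus)
      also have "nm (inn z k \<cdot> k) \<le> nm z"
        using Cauchy_Schwarz[OF zH kH] kH by (simp add: nm_scale nk)
      finally show ?thesis
        using cg by (simp add: z_def y_def)
    qed
    ultimately show "\<exists>y\<in>N. nm (x - inn x k \<cdot> k - y) < \<epsilon>"
      by metis
  qed
  have "unit_gap M N e k"
    unfolding unit_gap_def using k k_orth nk ek nv decomp by (simp add: pos_complex_iff)
  then show ?thesis
    by (rule that)
qed

text \<open>The vector k' minus its component along k lies in N and is orthogonal to N, so k' = c k
  with |c| = 1; the two positive inner products with e make c positive, hence 1.\<close>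

lemma unit_gap_unique:
  assumes M: "closed_subspace M" and N: "closed_subspace N" and NM: "N \<subseteq> M" and e: "e \<in> M"
    and k: "unit_gap M N e k"
    and k': "k' \<in> M" "\<And>g. g \<in> N \<Longrightarrow> inn k' g = 0" "nm k' = 1" "0 < inn e k'"
  shows "k' = k"
proof -
  note MH = subspace_carrier[OF M]
  have kM: "k \<in> M" "nm k = 1" "0 < inn e k" "\<And>g. g \<in> N \<Longrightarrow> inn k g = 0"
    and dec: "\<And>x. x \<in> M \<Longrightarrow> x - inn x k \<cdot> k \<in> N"
    using k by (auto simp: unit_gap_def)
  note H = MH[OF kM(1)] MH[OF k'(1)] MH[OF e]
  define c where "c = inn k' k"
  define r where "r = k' - c \<cdot> k"
  have r: "r \<in> N"
    unfolding r_def c_def by (rule dec[OF k'(1)])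
  then have rH: "r \<in> H"
    by (rule subspace_carrier[OF N])
  have "inn r r = inn k' r - c * inn k r"
    using H rH by (subst (1) r_def) (simp add: inn_simps)
  then have "inn r r = 0"
    using k'(2)[OF r] kM(4)[OF r] by simp
  then have "r = 0"
    using rH inn_eq_0 by blast
  then have k'_eq: "k' = c \<cdot> k"
    by (simp add: r_def)
  then have nc: "norm c = 1"
    using k'(3) kM(2) H by (simp add: nm_scale)
  have "inn e k' = cnj c * inn e k"
    using H by (simp add: k'_eq inn_simps)
  moreover obtain a where a: "a > 0" "inn e k' = complex_of_real a"
    using k'(4) unfolding pos_complex_of_real by blast
  moreover obtain b where b: "b > 0" "inn e k = complex_of_real b"
    using kM(3) unfolding pos_complex_of_real by blast
  ultimately have "cnj c = complex_of_real (a / b)"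
    by (simp add: field_simps)
  then have "cnj (cnj c) = cnj (complex_of_real (a / b))"
    by (simp only:)
  then have c: "c = complex_of_real (a / b)"
    by simp
  have "a / b = 1"
    using nc a(1) b(1) unfolding c norm_of_real by simp
  then have "c = 1"
    using c by simp
  then show ?thesis
    by (simp add: k'_eq)
qed

text \<open>Both \<open>{k\<^sub>1, l\<^sub>2}\<close> and \<open>{k\<^sub>2, l\<^sub>1}\<close> are orthonormal bases of the two-dimensional space
  \<open>M \<ominus> N\<^sub>1\<^sub>2\<close>; positivity of the normalizations pins down the unitary matrix between them.\<close>

lemma Szego_recurrence:
  assumes M: "closed_subspace M" and N1: "closed_subspace N1" and N2: "closed_subspace N2"
    and N12: "closed_subspace N12"
    and sub: "N1 \<subseteq> M" "N2 \<subseteq> M" "N12 \<subseteq> N1" "N12 \<subseteq> N2"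
    and k1: "unit_gap M N1 e k1" and l1: "unit_gap N2 N12 e l1"
    and k2: "unit_gap M N2 f k2" and l2: "unit_gap N1 N12 f l2"
    and e: "e \<in> N2" and f: "f \<in> N1"
  defines "\<alpha> \<equiv> inn k1 k2" and "\<rho> \<equiv> inn e k1 / inn e l1"
  shows "k1 = \<alpha> \<cdot> k2 + \<rho> \<cdot> l1" "l2 = \<rho> \<cdot> k2 + (- cnj \<alpha>) \<cdot> l1"
    and "0 < \<rho>" "norm \<alpha> < 1" "\<rho> = complex_of_real (sqrt (1 - (norm \<alpha>)\<^sup>2))"
    and "inn l1 l2 = - \<alpha>"
proof -
  have k1': "k1 \<in> M" "\<And>g. g \<in> N1 \<Longrightarrow> inn k1 g = 0" "nm k1 = 1" "0 < inn e k1"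
    and l1': "l1 \<in> N2" "\<And>g. g \<in> N12 \<Longrightarrow> inn l1 g = 0" "nm l1 = 1" "0 < inn e l1"
    and k2': "k2 \<in> M" "\<And>g. g \<in> N2 \<Longrightarrow> inn k2 g = 0" "nm k2 = 1" "0 < inn f k2"
    and l2': "l2 \<in> N1" "\<And>g. g \<in> N12 \<Longrightarrow> inn l2 g = 0" "nm l2 = 1" "0 < inn f l2"
    and dec1: "\<And>x. x \<in> N2 \<Longrightarrow> x - inn x l1 \<cdot> l1 \<in> N12"
    and dec2: "\<And>x. x \<in> M \<Longrightarrow> x - inn x k2 \<cdot> k2 \<in> N2"
    and dec3: "\<And>x. x \<in> N1 \<Longrightarrow> x - inn x l2 \<cdot> l2 \<in> N12"
    using k1 l1 k2 l2 by (auto simp: unit_gap_def)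
  note MH = subspace_carrier[OF M]
  have H: "k1 \<in> H" "k2 \<in> H" "l1 \<in> H" "l2 \<in> H" "e \<in> H" "f \<in> H"
    using k1'(1) k2'(1) l1'(1) l2'(1) e f sub MH by blast+
  have l1M: "l1 \<in> M" and l2M: "l2 \<in> M"
    using l1'(1) l2'(1) sub by blast+
  have k2_orth: "inn k2 l1 = 0"
    by (rule k2'(2)[OF l1'(1)])
  \<comment> \<open>Splitting off the component along k2 leaves a vector of N2, and splitting off l1
    leaves r in N12; since r is also orthogonal to N12, it is 0.\<close>
  have expand: "x = inn x k2 \<cdot> k2 + inn x l1 \<cdot> l1"
    if x: "x \<in> M" and orth: "\<And>g. g \<in> N12 \<Longrightarrow> inn x g = 0" for x
  proof -
    have xH: "x \<in> H"
      using x MH by blast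
    define y where "y = x - inn x k2 \<cdot> k2"
    have y: "y \<in> N2"
      unfolding y_def by (rule dec2[OF x])
    have "inn y l1 = inn x l1"
      using xH H k2_orth by (simp add: y_def inn_simps)
    then have r: "y - inn x l1 \<cdot> l1 \<in> N12"
      using dec1[OF y] by simp
    define r where "r = y - inn x l1 \<cdot> l1"
    have rN: "r \<in> N12"
      using r by (simp add: r_def)
    then have rH: "r \<in> H"
      by (rule subspace_carrier[OF N12])
    have "inn k2 r = 0" "inn l1 r = 0" "inn x r = 0"
      using rN sub k2'(2) l1'(2) orth by blast+
    moreover have "inn r r = inn x r - inn x k2 * inn k2 r - inn x l1 * inn l1 r"
      using xH H rH by (subst (1) r_def) (simp add: y_def inn_simps)
    ultimately have "inn r r = 0"
      by simp
    then have "r = 0"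
      using rH inn_eq_0 by blast
    then show ?thesis
      by (simp add: r_def y_def algebra_simps)
  qed
  \<comment> \<open>Since e lies in N2, removing its component along l1 puts it into N12, to which
    k1 is orthogonal. This compares the two normalizations, <e,k1> = <e,l1> cnj <k1,l1>, and
    identifies the coefficient of l1 in k1.\<close>
  have eN: "e - inn e l1 \<cdot> l1 \<in> N1"
    using dec1[OF e] sub by blast
  have "inn k1 (e - inn e l1 \<cdot> l1) = 0"
    by (rule k1'(2)[OF eN])
  then have "inn k1 e = cnj (inn e l1) * inn k1 l1"
    using H by (simp add: inn_simps)
  then have "inn e k1 = inn e l1 * cnj (inn k1 l1)"
    using inn_commute[OF H(1,5)] by simp
  moreover have "inn e l1 \<noteq> 0"
    using l1'(4) by auto
  ultimately have rho: "\<rho> = cnj (inn k1 l1)"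
    by (simp add: \<rho>_def)
  obtain a b where ab: "a > 0" "b > 0" "inn e k1 = complex_of_real a" "inn e l1 = complex_of_real b"
    using k1'(4) l1'(4) unfolding pos_complex_of_real by blast
  define p where "p = a / b"
  have p: "p > 0" "\<rho> = complex_of_real p"
    using ab by (auto simp: p_def \<rho>_def)
  then show "0 < \<rho>"
    by (simp add: pos_complex_iff)
  have k1l1: "inn k1 l1 = \<rho>"
    using rho p by (metis complex_cnj_cnj complex_cnj_complex_of_real)
  have k1N12: "inn k1 g = 0" if "g \<in> N12" for g
    using that sub k1'(2) by blast
  show eq1: "k1 = \<alpha> \<cdot> k2 + \<rho> \<cdot> l1"
    using expand[OF k1'(1) k1N12] by (simp add: \<alpha>_def k1l1)
  define x where "x = inn l2 k2"
  define y where "y = inn l2 l1"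
  have eq2: "l2 = x \<cdot> k2 + y \<cdot> l1"
    using expand[OF l2M l2'(2)] by (simp add: x_def y_def)
  \<comment> \<open>The same comparison with f makes the coefficient x of k2 in l2 positive; that it
    equals \<rho> follows only from unitarity below.\<close>
  have fN: "f - inn f l2 \<cdot> l2 \<in> N2"
    using dec3[OF f] sub by blast
  have "inn k2 (f - inn f l2 \<cdot> l2) = 0"
    by (rule k2'(2)[OF fN])
  then have "inn k2 f = cnj (inn f l2) * inn k2 l2"
    using H by (simp add: inn_simps)
  then have fk2: "inn f k2 = inn f l2 * x"
    using inn_commute[OF H(2,6)] inn_commute[OF H(2,4)] by (simp add: x_def)
  obtain a' b' where ab': "a' > 0" "b' > 0" "inn f k2 = complex_of_real a'" "inn f l2 = complex_of_real b'"
    using k2'(4) l2'(4) unfolding pos_complex_of_real by blast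
  define q where "q = a' / b'"
  have q: "q > 0" "x = complex_of_real q"
    using ab' fk2 by (auto simp: q_def field_simps)
  have l1k2: "inn l1 k2 = 0"
    using inn_commute[OF H(2,3)] k2_orth by simp
  have self: "inn k2 k2 = 1" "inn l1 l1 = 1" "inn k1 k1 = 1" "inn l2 l2 = 1"
    using H k1' k2' l1' l2' by (simp_all add: inn_self)
  have inn_comb: "inn (a \<cdot> k2 + b \<cdot> l1) (c \<cdot> k2 + d \<cdot> l1) = a * cnj c + b * cnj d" for a b c d
    using H by (simp add: inn_simps self k2_orth l1k2 mult.commute)
  have "complex_of_real ((norm \<alpha>)\<^sup>2 + p\<^sup>2) = 1"
    using self(3) eq1 p(2) inn_comb[of \<alpha> \<rho> \<alpha> \<rho>] by (simp add: complex_norm_square power2_eq_square flip: complex_norm_square)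
  then have norm1: "(norm \<alpha>)\<^sup>2 + p\<^sup>2 = 1"
    by (simp only: of_real_eq_1_iff)
  have "complex_of_real (q\<^sup>2 + (norm y)\<^sup>2) = 1"
    using self(4) eq2 q(2) inn_comb[of x y x y] by (simp add: complex_norm_square power2_eq_square flip: complex_norm_square)
  then have norm2: "q\<^sup>2 + (norm y)\<^sup>2 = 1"
    by (simp only: of_real_eq_1_iff)
  have "inn k1 l2 = 0"
    by (rule k1'(2)[OF l2'(1)])
  then have orth: "\<alpha> * complex_of_real q + complex_of_real p * cnj y = 0"
    using eq1 eq2 p(2) q(2) inn_comb[of \<alpha> \<rho> x y] by simp
  then have cy: "complex_of_real p * cnj y = - \<alpha> * complex_of_real q"
    by (simp add: add_eq_0_iff)
  \<comment> \<open>Taking moduli in the orthogonality of k1 and l2 and inserting the two norm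
    relations leaves p^2 = q^2, hence p = q as both are positive.\<close>
  then have "norm (complex_of_real p * cnj y) = norm (- \<alpha> * complex_of_real q)"
    by simp
  then have "p * norm y = norm \<alpha> * q"
    using p(1) q(1) by (simp add: norm_mult)
  then have "p\<^sup>2 * (norm y)\<^sup>2 = (norm \<alpha>)\<^sup>2 * q\<^sup>2"
    by (metis power_mult_distrib)
  moreover have "(norm y)\<^sup>2 = 1 - q\<^sup>2" "(norm \<alpha>)\<^sup>2 = 1 - p\<^sup>2"
    using norm1 norm2 by simp_all
  ultimately have "p\<^sup>2 * (1 - q\<^sup>2) = (1 - p\<^sup>2) * q\<^sup>2"
    by simp
  then have "p\<^sup>2 = q\<^sup>2"
    by (simp add: algebra_simps)
  then have pq: "p = q"
    using p(1) q(1) by simp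
  have "complex_of_real p * cnj y = complex_of_real p * (- \<alpha>)"
    using cy by (simp add: pq)
  then have "cnj y = - \<alpha>"
    using p(1) by (simp only: mult_left_cancel of_real_eq_0_iff)
  then show "inn l1 l2 = - \<alpha>"
    unfolding y_def using inn_commute[OF H(4,3)] by (simp only:)
  have "cnj (cnj y) = cnj (- \<alpha>)"
    by (simp only: \<open>cnj y = - \<alpha>\<close>)
  then have "y = - cnj \<alpha>"
    by simp
  moreover have "x = \<rho>"
    by (simp only: q(2) p(2) pq)
  ultimately show "l2 = \<rho> \<cdot> k2 + (- cnj \<alpha>) \<cdot> l1"
    using eq2 by (simp only:)
  have "(norm \<alpha>)\<^sup>2 < 1"
    using norm1 zero_less_power[OF p(1), of 2] by linarith
  then show "norm \<alpha> < 1"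
    by (simp add: abs_square_less_1)
  have "p\<^sup>2 = 1 - (norm \<alpha>)\<^sup>2"
    using norm1 by simp
  then have "sqrt (1 - (norm \<alpha>)\<^sup>2) = p"
    by (intro real_sqrt_unique) (use p(1) in simp_all)
  then show "\<rho> = complex_of_real (sqrt (1 - (norm \<alpha>)\<^sup>2))"
    using p(2) by simp
qed

end

section \<open>Coordinates on \<open>L\<^sup>R\<close>\<close>

lemma abs_rep_L0 [simp]: "abs_L0 (rep_L0 f) = f"
  by (rule Quotient3_abs_rep[OF Quotient3_L0])

lemma rep_L0_measurable [measurable]: "rep_L0 f \<in> borel_measurable \<mu>"
  using Quotient3_rep_reflp[OF Quotient3_L0, of f] by (simp add: L0_eq_def)

lemma rep_abs_L0_AE:
  assumes "\<phi> \<in> borel_measurable \<mu>"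
  shows "AE t in \<mu>. rep_L0 (abs_L0 \<phi>) t = \<phi> t"
proof -
  have "L0_eq \<phi> \<phi>"
    using assms by (simp add: L0_eq_def)
  then have "L0_eq (rep_L0 (abs_L0 \<phi>)) \<phi>"
    by (rule rep_abs_rsp_left[OF Quotient3_L0])
  then show ?thesis
    by (simp add: L0_eq_def)
qed

lemma abs_L0_eqI:
  assumes "\<phi> \<in> borel_measurable \<mu>" "\<psi> \<in> borel_measurable \<mu>"
    "AE t in \<mu>. \<phi> t = \<psi> t"
  shows "abs_L0 \<phi> = abs_L0 \<psi>"
  using Quotient3_rel[OF Quotient3_L0, of \<phi> \<psi>] assms by (simp add: L0_eq_def)

lemma L0_eqI: "AE t in \<mu>. rep_L0 f t = rep_L0 g t \<Longrightarrow> f = g"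
  using abs_L0_eqI[of "rep_L0 f" "rep_L0 g"] by (simp add: rep_L0_measurable)

lemma abs_L0_add:
  assumes "\<phi> \<in> borel_measurable \<mu>" "\<psi> \<in> borel_measurable \<mu>"
  shows "abs_L0 \<phi> + abs_L0 \<psi> = abs_L0 (\<lambda>t. \<phi> t + \<psi> t)"
  by (rule plus_L0.abs_eq) (use assms in \<open>auto simp: L0_eq_def\<close>)

lemma abs_L0_scale:
  assumes "\<phi> \<in> borel_measurable \<mu>"
  shows "c *\<^sub>C abs_L0 \<phi> = abs_L0 (\<lambda>t. c *s \<phi> t)"
  by (rule scale_L0.abs_eq) (use assms in \<open>auto simp: L0_eq_def\<close>)

lemma abs_L0_mult_t:
  assumes "\<phi> \<in> borel_measurable \<mu>"
  shows "mult_t (abs_L0 \<phi>) = abs_L0 (\<lambda>t. t *s \<phi> t)"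
  by (rule mult_t.abs_eq) (use assms in \<open>auto simp: L0_eq_def\<close>)

lemma rep_L0_add: "AE t in \<mu>. rep_L0 (f + g) t = rep_L0 f t + rep_L0 g t"
  using rep_abs_L0_AE[of "\<lambda>t. rep_L0 f t + rep_L0 g t"]
  by (simp add: rep_L0_measurable borel_measurable_add flip: abs_L0_add)

lemma rep_L0_scale: "AE t in \<mu>. rep_L0 (c *\<^sub>C f) t = c *s rep_L0 f t"
  using rep_abs_L0_AE[of "\<lambda>t. c *s rep_L0 f t"]
  by (simp add: rep_L0_measurable borel_measurable_vector_scalar_mult flip: abs_L0_scale)

lemma rep_L0_mult_t: "AE t in \<mu>. rep_L0 (mult_t f) t = t *s rep_L0 f t"
  using rep_abs_L0_AE[of "\<lambda>t. t *s rep_L0 f t"]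
  by (simp add: rep_L0_measurable borel_measurable_vector_scalar_mult borel_measurable_circle_ident
      flip: abs_L0_mult_t)

lemma rep_L0_0: "AE t in \<mu>. rep_L0 0 t = 0"
proof -
  have "abs_L0 (\<lambda>_. 0) = 0"
    by (simp add: zero_L0_def)
  then show ?thesis
    using rep_abs_L0_AE[of "\<lambda>_. 0"] by simp
qed

lemmas borel_measurable_scale_intros =
  borel_measurable_add borel_measurable_times borel_measurable_const borel_measurable_vector_scalar_mult borel_measurable_cnj borel_measurable_circle_ident

lemma scale_L0_add_right: "c *\<^sub>C (f + g) = c *\<^sub>C f + c *\<^sub>C g"
  by transfer (auto simp: L0_eq_def vector_add_ldistrib intro!: borel_measurable_scale_intros)

lemma scale_L0_add_left: "(c + d) *\<^sub>C f = c *\<^sub>C f + d *\<^sub>C f"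
  by transfer (auto simp: L0_eq_def vector_sadd_rdistrib intro!: borel_measurable_scale_intros)

lemma scale_L0_scale: "c *\<^sub>C d *\<^sub>C f = (c * d) *\<^sub>C f"
  by transfer (auto simp: L0_eq_def vector_smult_assoc intro!: borel_measurable_scale_intros)

lemma scale_L0_one: "1 *\<^sub>C f = f"
  by transfer (simp add: L0_eq_def)

lemma mult_t_add: "mult_t (f + g) = mult_t f + mult_t g"
  by transfer (auto simp: L0_eq_def vector_add_ldistrib intro!: borel_measurable_scale_intros)

lemma mult_t_scale: "mult_t (c *\<^sub>C f) = c *\<^sub>C mult_t f"
  by transfer (auto simp: L0_eq_def vector_smult_assoc mult.commute intro!: borel_measurable_scale_intros)

lemma mult_t_diff: "mult_t (f - g) = mult_t f - mult_t g"
  using mult_t_add[of "f - g" g] by (simp add: algebra_simps)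

lift_definition mult_cnj_t :: "L0 \<Rightarrow> L0" is "\<lambda>f t. cnj t *s f t"
  by (auto simp: L0_eq_def intro!: borel_measurable_scale_intros)

lemma mult_t_mult_cnj_t [simp]: "mult_t (mult_cnj_t f) = f" "mult_cnj_t (mult_t f) = f"
  by (transfer; auto simp: L0_eq_def vector_smult_assoc circle_mult_cnj mult.commute[of "cnj _"]
      intro!: borel_measurable_scale_intros)+

lemma borel_measurable_nth [measurable (raw)]:
  fixes f :: "'a \<Rightarrow> complex ^ 2"
  shows "f \<in> borel_measurable M \<Longrightarrow> (\<lambda>x. f x $ i) \<in> borel_measurable M"
  by (erule measurable_compose) (intro borel_measurable_continuous_onI continuous_intros)

lemma borel_measurable_vector2 [measurable (raw)]:
  fixes a b :: "'a \<Rightarrow> complex"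
  assumes "a \<in> borel_measurable M" "b \<in> borel_measurable M"
  shows "(\<lambda>x. vector [a x, b x] :: complex ^ 2) \<in> borel_measurable M"
proof -
  have "(\<lambda>x. vector [a x, b x] :: complex ^ 2) = (\<lambda>x. a x *s vector [1, 0] + b x *s vector [0, 1])"
    by (simp add: fun_eq_iff vec_eq_iff forall_2)
  then show ?thesis
    using assms by (simp only:) (intro borel_measurable_add borel_measurable_vector_scalar_mult; simp)
qed

lemma W_mult_vector: "W R t *v vector [x, y] = vector [x + cnj (R t) * y, R t * x + y]"
  by (simp add: W_def vec_eq_iff forall_2 matrix_vector_mult_def sum_2)

lemma matrix_inv_W:
  assumes "norm (R t) < 1"
  shows "W R t *v (matrix_inv (W R t) *v x) = x"
proof -
  have "det (W R t) = 1 - complex_of_real ((norm (R t))\<^sup>2)"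
    using complex_norm_square[of "R t"] by (simp add: det_2 W_def mult.commute)
  also have "\<dots> \<noteq> 0"
  proof
    assume "1 - complex_of_real ((norm (R t))\<^sup>2) = 0"
    then have "(norm (R t))\<^sup>2 = 1"
      by (metis eq_iff_diff_eq_0 of_real_eq_1_iff)
    then show False
      using assms norm_ge_zero[of "R t"] unfolding power2_eq_1_iff by linarith
  qed
  finally have "invertible (W R t)"
    by (simp add: invertible_det_nz)
  then have "W R t ** matrix_inv (W R t) = mat 1"
    unfolding invertible_def matrix_inv_def by (rule someI2_ex) blast
  then show ?thesis
    by (simp add: matrix_vector_mul_assoc)
qed

text \<open>Completing the square, \<open>g\<^sup>* W\<^sup>-\<^sup>1 f\<close> is the sum of \<open>f\<^sub>1 \<cdot> cnj g\<^sub>1\<close> and the same product for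
  \<open>(f\<^sub>2 - R f\<^sub>1) / sqrt (1 - |R|\<^sup>2)\<close>; so these two coordinates map \<open>L\<^sup>R\<close> isometrically onto
  \<open>L\<^sup>2 \<oplus> L\<^sup>2\<close>.\<close>

definition coord1 :: "L0 \<Rightarrow> complex \<Rightarrow> complex" where
  "coord1 f t = rep_L0 f t $ 1"

locale scattering =
  fixes R :: "complex \<Rightarrow> complex"
  assumes R_measurable [measurable]: "R \<in> borel_measurable \<mu>"
    and R_log: "log_integrable (\<lambda>t. 1 - norm (R t))"
begin

lemma R_less_1: "AE t in \<mu>. norm (R t) < 1"
  using R_log by (simp add: log_integrable_def)

definition defect :: "complex \<Rightarrow> real" where
  "defect t = sqrt (1 - (norm (R t))\<^sup>2)"

definition coord2 :: "L0 \<Rightarrow> complex \<Rightarrow> complex" where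
  "coord2 f t = (rep_L0 f t $ 2 - R t * rep_L0 f t $ 1) / complex_of_real (defect t)"

lemma defect_mult_self:
  assumes "norm (R t) < 1"
  shows "complex_of_real (defect t) * complex_of_real (defect t) = 1 - R t * cnj (R t)"
proof -
  have "defect t * defect t = 1 - (norm (R t))\<^sup>2"
    using assms by (simp add: defect_def abs_square_le_1)
  then have "complex_of_real (defect t * defect t) = 1 - complex_of_real ((norm (R t))\<^sup>2)"
    by simp
  then show ?thesis
    by (simp only: of_real_mult complex_norm_square)
qed

lemma defect_pos: "AE t in \<mu>. 0 < defect t"
  using R_less_1 by eventually_elim (simp add: defect_def abs_square_less_1)

lemma defect_measurable [measurable]: "defect \<in> borel_measurable \<mu>"
  unfolding defect_def[abs_def] by measurable

lemma coord_measurable [measurable]: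
  "coord1 f \<in> borel_measurable \<mu>" "coord2 f \<in> borel_measurable \<mu>"
  unfolding coord1_def[abs_def] coord2_def[abs_def] by measurable

lemma coord_add:
  "AE t in \<mu>. coord1 (f + g) t = coord1 f t + coord1 g t"
  "AE t in \<mu>. coord2 (f + g) t = coord2 f t + coord2 g t"
  using rep_L0_add[of f g]
  by (eventually_elim, simp add: coord1_def coord2_def add_divide_distrib[symmetric] algebra_simps)+

lemma coord_scale:
  "AE t in \<mu>. coord1 (c *\<^sub>C f) t = c * coord1 f t"
  "AE t in \<mu>. coord2 (c *\<^sub>C f) t = c * coord2 f t"
  using rep_L0_scale[of c f]
  by (eventually_elim, simp add: coord1_def coord2_def algebra_simps)+

lemma coord_mult_t:
  "AE t in \<mu>. coord1 (mult_t f) t = t * coord1 f t"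
  "AE t in \<mu>. coord2 (mult_t f) t = t * coord2 f t"
  using rep_L0_mult_t[of f]
  by (eventually_elim, simp add: coord1_def coord2_def algebra_simps)+

lemma coord_abs_L0:
  assumes "\<phi> \<in> borel_measurable \<mu>"
  shows "AE t in \<mu>. coord1 (abs_L0 \<phi>) t = \<phi> t $ 1"
    "AE t in \<mu>. coord2 (abs_L0 \<phi>) t = (\<phi> t $ 2 - R t * \<phi> t $ 1) / complex_of_real (defect t)"
  using rep_abs_L0_AE[OF assms] by (eventually_elim, simp add: coord1_def coord2_def)+

text \<open>Write f = W (a, b). Then f_2 - R f_1 = (1 - |R|^2) b, so the second coordinate of f is
  \<open>defect t\<close> times b, and the defect cancels against the denominator in the second
  coordinate of g.\<close>

lemma ip_density_eq:
  "AE t in \<mu>. ip_density R f g t = coord1 f t * cnj (coord1 g t) + coord2 f t * cnj (coord2 g t)"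
  using R_less_1 defect_pos
proof eventually_elim
  case (elim t)
  define x where "x = matrix_inv (W R t) *v rep_L0 f t"
  define a where "a = x $ 1"
  define b where "b = x $ 2"
  define u where "u = rep_L0 g t $ 1"
  define v where "v = rep_L0 g t $ 2"
  define d where "d = complex_of_real (defect t)"
  have "x = vector [a, b]"
    by (simp add: a_def b_def vec_eq_iff forall_2)
  then have "rep_L0 f t = vector [a + cnj (R t) * b, R t * a + b]"
    using matrix_inv_W[where R = R and t = t, OF elim(1), of "rep_L0 f t"] W_mult_vector[of R t a b] by (simp add: x_def)
  then have f: "rep_L0 f t $ 1 = a + cnj (R t) * b" "rep_L0 f t $ 2 = R t * a + b"
    by simp_all
  have dd: "d * d = 1 - R t * cnj (R t)"
    unfolding d_def by (rule defect_mult_self[OF elim(1)])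
  have d: "d \<noteq> 0" "cnj d = d"
    using elim(2) by (simp_all add: d_def)
  have "rep_L0 f t $ 2 - R t * rep_L0 f t $ 1 = d * d * b"
    unfolding dd f by (simp add: algebra_simps)
  then have "coord2 f t = d * b"
    using d by (simp add: coord2_def d_def[symmetric])
  moreover have "cnj (coord2 g t) = (cnj v - cnj (R t) * cnj u) / d"
    using d by (simp add: coord2_def d_def[symmetric] u_def v_def)
  ultimately have "coord2 f t * cnj (coord2 g t) = b * (cnj v - cnj (R t) * cnj u)"
    using d by simp
  then show ?case
    unfolding ip_density_def sum_2 x_def[symmetric] a_def[symmetric] b_def[symmetric]
      u_def[symmetric] v_def[symmetric] coord1_def f
    by (simp add: algebra_simps)
qed

text \<open>\<open>matrix_inv\<close> is a choice with unknown values where W is singular. This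
  happens only on a null set, and as the measure is complete, equality almost everywhere with a
  measurable function suffices.\<close>

lemma ip_density_measurable: "ip_density R f g \<in> borel_measurable \<mu>"
proof -
  define q where "q t = coord1 f t * cnj (coord1 g t) + coord2 f t * cnj (coord2 g t)" for t
  have 1: "q \<in> borel_measurable \<mu>"
    unfolding q_def by measurable
  show ?thesis
  proof (rule borel_measurableI)
    fix S :: "complex set" assume "open S"
    then have "q -` S \<inter> space \<mu>
        \<in> sets \<mu>"
      by (intro measurable_sets[OF 1]) auto
    moreover have "AE t in \<mu>.
        t \<in> q -` S \<inter> space \<mu> \<longleftrightarrow>
        t \<in> ip_density R f g -` S \<inter> space \<mu>"
      using ip_density_eq[of f g] by eventually_elim (auto simp: q_def)
    ultimately show "ip_density R f g -` S \<inter> space \<mu> \<in> sets \<mu>"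
      unfolding circle_measure_def using completion.in_sets_AE by blast
  qed
qed

end

section \<open>\<open>L\<^sup>R\<close> as a Hilbert space\<close>

lemma L2_cong_AE:
  assumes "f \<in> borel_measurable \<mu>" "g \<in> L2" "AE t in \<mu>. f t = g t"
  shows "f \<in> L2"
  by (rule L2I[OF assms(1) L2_integrable[OF assms(2)]]) (use assms(3) in eventually_elim, simp)

definition L2_ip :: "(complex \<Rightarrow> complex) \<Rightarrow> (complex \<Rightarrow> complex) \<Rightarrow> complex" where
  "L2_ip f g = (\<integral>t. f t * cnj (g t) \<partial>\<mu>)"

lemma L2_ip_cong_AE:
  assumes [measurable]: "f \<in> borel_measurable \<mu>" "f' \<in> borel_measurable \<mu>"
    "g \<in> borel_measurable \<mu>" "g' \<in> borel_measurable \<mu>"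
    and "AE t in \<mu>. f t = f' t" "AE t in \<mu>. g t = g' t"
  shows "L2_ip f g = L2_ip f' g'"
  unfolding L2_ip_def
proof (rule integral_cong_AE)
  show "AE t in \<mu>. f t * cnj (g t) = f' t * cnj (g' t)"
    using assms(5,6) by eventually_elim simp
qed measurable

lemma L2_ip_add_left: "f \<in> L2 \<Longrightarrow> g \<in> L2 \<Longrightarrow> h \<in> L2 \<Longrightarrow> L2_ip (\<lambda>t. f t + g t) h = L2_ip f h + L2_ip g h"
  by (simp add: L2_ip_def distrib_right L2_cnj_integrable)

lemma L2_ip_scale_left: "L2_ip (\<lambda>t. c * f t) h = c * L2_ip f h"
  by (simp add: L2_ip_def mult.assoc)

lemma L2_ip_commute: "L2_ip g f = cnj (L2_ip f g)"
  by (simp add: L2_ip_def mult.commute flip: Bochner_Integration.integral_cnj)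

lemma L2_ip_self: "L2_ip f f = complex_of_real (\<integral>t. (norm (f t))\<^sup>2 \<partial>\<mu>)"
  by (simp only: L2_ip_def flip: complex_norm_square integral_complex_of_real)

lemma L2_ip_mult_t:
  "L2_ip (\<lambda>t. t * f t) (\<lambda>t. t * g t) = L2_ip f g"
  unfolding L2_ip_def
proof (rule integral_circle_cong)
  fix t :: complex assume "norm t = 1"
  then have "t * cnj t = 1"
    by (rule circle_mult_cnj)
  moreover have "t * f t * cnj (t * g t) = (t * cnj t) * (f t * cnj (g t))"
    by simp
  ultimately show "t * f t * cnj (t * g t) = f t * cnj (g t)"
    by (simp only: mult_1)
qed

context scattering
begin

lemma LR_iff: "f \<in> LR R \<longleftrightarrow> coord1 f \<in> L2 \<and> coord2 f \<in> L2"
proof -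
  let ?q = "\<lambda>t. (norm (coord1 f t))\<^sup>2 + (norm (coord2 f t))\<^sup>2"
  have "integrable \<mu> (ip_density R f f) \<longleftrightarrow> integrable \<mu> (\<lambda>t. complex_of_real (?q t))"
  proof (rule integrable_cong_AE)
    show "AE t in \<mu>. ip_density R f f t = complex_of_real (?q t)"
      using ip_density_eq[of f f] by eventually_elim (simp only: of_real_add complex_norm_square)
  qed (auto intro!: ip_density_measurable)
  also have "\<dots> \<longleftrightarrow> integrable \<mu> ?q"
    by (rule complex_of_real_integrable_eq)
  also have "\<dots> \<longleftrightarrow> coord1 f \<in> L2 \<and> coord2 f \<in> L2"
  proof
    assume q: "integrable \<mu> ?q"
    show "coord1 f \<in> L2 \<and> coord2 f \<in> L2"
      by (intro conjI L2I[OF _ q]) auto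
  qed (auto intro!: Bochner_Integration.integrable_add L2_integrable)
  finally show ?thesis
    by (simp add: LR_def)
qed

lemma LR_coord: "f \<in> LR R \<Longrightarrow> coord1 f \<in> L2" "f \<in> LR R \<Longrightarrow> coord2 f \<in> L2"
  by (auto simp: LR_iff)

lemma LR_I:
  assumes "a \<in> L2" "b \<in> L2" "AE t in \<mu>. coord1 f t = a t" "AE t in \<mu>. coord2 f t = b t"
  shows "f \<in> LR R"
  unfolding LR_iff using assms by (auto intro: L2_cong_AE)

lemma ip_eq:
  assumes "f \<in> LR R" "g \<in> LR R"
  shows "ip R f g = L2_ip (coord1 f) (coord1 g) + L2_ip (coord2 f) (coord2 g)"
proof -
  have "ip R f g = (\<integral>t. coord1 f t * cnj (coord1 g t) + coord2 f t * cnj (coord2 g t) \<partial>\<mu>)"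
    unfolding ip_def by (rule integral_cong_AE) (auto intro: ip_density_eq ip_density_measurable)
  then show ?thesis
    using assms by (simp add: L2_ip_def L2_cnj_integrable LR_coord)
qed

lemma LR_add: "f \<in> LR R \<Longrightarrow> g \<in> LR R \<Longrightarrow> f + g \<in> LR R"
  by (rule LR_I[OF L2_add L2_add coord_add]) (auto simp: LR_coord)

lemma LR_scale: "f \<in> LR R \<Longrightarrow> c *\<^sub>C f \<in> LR R"
  by (rule LR_I[OF L2_cmult L2_cmult coord_scale]) (auto simp: LR_coord)

lemma LR_mult_t_iff: "mult_t f \<in> LR R \<longleftrightarrow> f \<in> LR R"
proof
  have bdd: "AE t in \<mu>. norm t \<le> 1" "AE t in \<mu>. norm (cnj t) \<le> 1"
    by (rule AE_I2, simp)+
  note m = borel_measurable_circle_ident borel_measurable_cnj[OF borel_measurable_circle_ident]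
  show "mult_t f \<in> LR R" if "f \<in> LR R"
    by (rule LR_I[OF L2_mult_bounded L2_mult_bounded coord_mult_t])
       (use that bdd m in \<open>auto simp: LR_coord\<close>)
  assume f: "mult_t f \<in> LR R"
  have sphere: "AE t in \<mu>. norm t = 1"
    by (rule AE_I2) simp
  have 1: "AE t in \<mu>. coord1 f t = cnj t * coord1 (mult_t f) t"
    using coord_mult_t(1)[of f] sphere
    by eventually_elim (simp add: mult.assoc[symmetric] mult.commute[of "cnj _"] circle_mult_cnj)
  have 2: "AE t in \<mu>. coord2 f t = cnj t * coord2 (mult_t f) t"
    using coord_mult_t(2)[of f] sphere
    by eventually_elim (simp add: mult.assoc[symmetric] mult.commute[of "cnj _"] circle_mult_cnj)
  show "f \<in> LR R"
    by (rule LR_I[OF L2_mult_bounded L2_mult_bounded 1 2])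
       (use f bdd m in \<open>auto simp: LR_coord\<close>)
qed

lemma ip_mult_t:
  assumes "f \<in> LR R" "g \<in> LR R"
  shows "ip R (mult_t f) (mult_t g) = ip R f g"
proof -
  have "L2_ip (coord1 (mult_t f)) (coord1 (mult_t g)) = L2_ip (\<lambda>t. t * coord1 f t) (\<lambda>t. t * coord1 g t)"
    by (rule L2_ip_cong_AE) (auto intro: coord_mult_t borel_measurable_times borel_measurable_circle_ident)
  moreover have "L2_ip (coord2 (mult_t f)) (coord2 (mult_t g)) = L2_ip (\<lambda>t. t * coord2 f t) (\<lambda>t. t * coord2 g t)"
    by (rule L2_ip_cong_AE) (auto intro: coord_mult_t borel_measurable_times borel_measurable_circle_ident)
  ultimately show ?thesis
    using assms by (simp add: ip_eq LR_mult_t_iff L2_ip_mult_t)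
qed

lemma ip_add_left:
  assumes f: "f \<in> LR R" "g \<in> LR R" "h \<in> LR R"
  shows "ip R (f + g) h = ip R f h + ip R g h"
proof -
  have "L2_ip (coord1 (f + g)) (coord1 h) = L2_ip (\<lambda>t. coord1 f t + coord1 g t) (coord1 h)"
    by (rule L2_ip_cong_AE) (auto intro: coord_add)
  moreover have "L2_ip (coord2 (f + g)) (coord2 h) = L2_ip (\<lambda>t. coord2 f t + coord2 g t) (coord2 h)"
    by (rule L2_ip_cong_AE) (auto intro: coord_add)
  ultimately show ?thesis
    using assms by (simp add: ip_eq LR_add L2_ip_add_left LR_coord)
qed

lemma ip_scale_left:
  assumes f: "f \<in> LR R" "h \<in> LR R"
  shows "ip R (c *\<^sub>C f) h = c * ip R f h"
proof -
  have "L2_ip (coord1 (c *\<^sub>C f)) (coord1 h) = L2_ip (\<lambda>t. c * coord1 f t) (coord1 h)"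
    by (rule L2_ip_cong_AE) (auto intro: coord_scale)
  moreover have "L2_ip (coord2 (c *\<^sub>C f)) (coord2 h) = L2_ip (\<lambda>t. c * coord2 f t) (coord2 h)"
    by (rule L2_ip_cong_AE) (auto intro: coord_scale)
  ultimately show ?thesis
    using assms by (simp add: ip_eq LR_scale L2_ip_scale_left distrib_left)
qed

lemma ip_self:
  assumes "f \<in> LR R"
  shows "ip R f f = complex_of_real ((\<integral>t. (norm (coord1 f t))\<^sup>2 \<partial>\<mu>) + (\<integral>t. (norm (coord2 f t))\<^sup>2 \<partial>\<mu>))"
  using assms by (simp add: ip_eq L2_ip_self)

lemma coord_eq_0:
  assumes "AE t in \<mu>. coord1 f t = 0" "AE t in \<mu>. coord2 f t = 0"
  shows "f = 0"
proof (rule L0_eqI)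
  show "AE t in \<mu>. rep_L0 f t = rep_L0 0 t"
    using assms rep_L0_0 defect_pos
    by eventually_elim (simp add: coord1_def coord2_def vec_eq_iff forall_2)
qed

lemma ip_eq_0:
  assumes f: "f \<in> LR R" and "ip R f f = 0"
  shows "f = 0"
proof -
  have nonneg: "0 \<le> (\<integral>t. (norm (coord1 f t))\<^sup>2 \<partial>\<mu>)" "0 \<le> (\<integral>t. (norm (coord2 f t))\<^sup>2 \<partial>\<mu>)"
    by simp_all
  have "(\<integral>t. (norm (coord1 f t))\<^sup>2 \<partial>\<mu>) + (\<integral>t. (norm (coord2 f t))\<^sup>2 \<partial>\<mu>) = 0"
    using assms(2) unfolding ip_self[OF f] by (simp only: of_real_eq_0_iff)
  then have 0: "(\<integral>t. (norm (coord1 f t))\<^sup>2 \<partial>\<mu>) = 0" "(\<integral>t. (norm (coord2 f t))\<^sup>2 \<partial>\<mu>) = 0"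
    using nonneg by linarith+
  show ?thesis
  proof (rule coord_eq_0)
    show "AE t in \<mu>. coord1 f t = 0"
      using 0(1) L2_integrable[OF LR_coord(1)[OF f]] by (simp add: integral_nonneg_eq_0_iff_AE)
    show "AE t in \<mu>. coord2 f t = 0"
      using 0(2) L2_integrable[OF LR_coord(2)[OF f]] by (simp add: integral_nonneg_eq_0_iff_AE)
  qed
qed

lemma coord_diff:
  "AE t in \<mu>. coord1 (f - g) t = coord1 f t - coord1 g t"
  "AE t in \<mu>. coord2 (f - g) t = coord2 f t - coord2 g t"
proof -
  show "AE t in \<mu>. coord1 (f - g) t = coord1 f t - coord1 g t"
    using coord_add(1)[of "f - g" g] by eventually_elim simp
  show "AE t in \<mu>. coord2 (f - g) t = coord2 f t - coord2 g t"
    using coord_add(2)[of "f - g" g] by eventually_elim simp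
qed

lemma LR_diff: "f \<in> LR R \<Longrightarrow> g \<in> LR R \<Longrightarrow> f - g \<in> LR R"
  by (rule LR_I[OF L2_diff L2_diff coord_diff]) (auto simp: LR_coord)

text \<open>The coordinates of g enter through representatives u and v, so that the formula applies
  to a limit whose coordinates are prescribed only almost everywhere.\<close>

lemma ip_self_diff:
  assumes "f \<in> LR R" "g \<in> LR R"
    and "u \<in> borel_measurable \<mu>" "v \<in> borel_measurable \<mu>"
    and "AE t in \<mu>. coord1 g t = u t" "AE t in \<mu>. coord2 g t = v t"
  shows "Re (ip R (f - g) (f - g)) =
    L2_dist2 (coord1 f) u + L2_dist2 (coord2 f) v"
proof -
  note [measurable] = assms(3,4)
  have "(\<integral>t. (norm (coord1 (f - g) t))\<^sup>2 \<partial>\<mu>) = L2_dist2 (coord1 f) u"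
    unfolding L2_dist2_def
  proof (rule integral_cong_AE)
    show "AE t in \<mu>. (norm (coord1 (f - g) t))\<^sup>2 = (norm (coord1 f t - u t))\<^sup>2"
      using coord_diff(1)[of f g] assms(5) by eventually_elim simp
  qed measurable
  moreover have "(\<integral>t. (norm (coord2 (f - g) t))\<^sup>2 \<partial>\<mu>) = L2_dist2 (coord2 f) v"
    unfolding L2_dist2_def
  proof (rule integral_cong_AE)
    show "AE t in \<mu>. (norm (coord2 (f - g) t))\<^sup>2 = (norm (coord2 f t - v t))\<^sup>2"
      using coord_diff(2)[of f g] assms(6) by eventually_elim simp
  qed measurable
  ultimately show ?thesis
    using assms(1,2) by (simp add: ip_self LR_diff)
qed

lemma LR_complete:
  assumes X: "\<And>n::nat. X n \<in> LR R"
    and C: "\<And>e. e > 0 \<Longrightarrow> \<exists>N. \<forall>m\<ge>N. \<forall>n\<ge>N. Re (ip R (X m - X n) (X m - X n)) < e"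
  shows "\<exists>l\<in>LR R. (\<lambda>n. Re (ip R (X n - l) (X n - l))) \<longlonglongrightarrow> 0"
proof -
  have eq: "Re (ip R (X m - X n) (X m - X n)) =
      L2_dist2 (coord1 (X m)) (coord1 (X n)) +
      L2_dist2 (coord2 (X m)) (coord2 (X n))" for m n
    by (rule ip_self_diff[OF X X]) auto
  have le: "L2_dist2 (coord1 (X m)) (coord1 (X n)) \<le> Re (ip R (X m - X n) (X m - X n))"
    "L2_dist2 (coord2 (X m)) (coord2 (X n)) \<le> Re (ip R (X m - X n) (X m - X n))" for m n
    by (simp_all add: eq)
  have C1: "\<exists>N. \<forall>m\<ge>N. \<forall>n\<ge>N. L2_dist2 (coord1 (X m)) (coord1 (X n)) < e" if "e > 0" for e
    using C[OF that] by (meson le(1) le_less_trans)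
  have C2: "\<exists>N. \<forall>m\<ge>N. \<forall>n\<ge>N. L2_dist2 (coord2 (X m)) (coord2 (X n)) < e" if "e > 0" for e
    using C[OF that] by (meson le(2) le_less_trans)
  obtain u where u: "u \<in> L2" "(\<lambda>n. L2_dist2 (coord1 (X n)) u) \<longlonglongrightarrow> 0"
    by (rule L2_complete[of "\<lambda>n. coord1 (X n)", OF LR_coord(1)[OF X] C1])
  obtain v where v: "v \<in> L2" "(\<lambda>n. L2_dist2 (coord2 (X n)) v) \<longlonglongrightarrow> 0"
    by (rule L2_complete[of "\<lambda>n. coord2 (X n)", OF LR_coord(2)[OF X] C2])
  note [measurable] = L2_measurable[OF u(1)] L2_measurable[OF v(1)]
  \<comment> \<open>The inverse of the coordinate map: f_1 = u and (f_2 - R f_1) / defect = v are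
    solved for f.\<close>
  define \<phi> :: "complex \<Rightarrow> complex ^ 2" where
    "\<phi> t = vector [u t, complex_of_real (defect t) * v t + R t * u t]" for t
  have \<phi>: "\<phi> \<in> borel_measurable \<mu>"
    unfolding \<phi>_def[abs_def] by measurable
  define l where "l = abs_L0 \<phi>"
  have l1: "AE t in \<mu>. coord1 l t = u t"
    using coord_abs_L0(1)[OF \<phi>] unfolding l_def by eventually_elim (simp add: \<phi>_def)
  have l2: "AE t in \<mu>. coord2 l t = v t"
    using coord_abs_L0(2)[OF \<phi>] defect_pos unfolding l_def by eventually_elim (simp add: \<phi>_def)
  have l: "l \<in> LR R"
    by (rule LR_I[OF u(1) v(1) l1 l2])
  have "(\<lambda>n. Re (ip R (X n - l) (X n - l))) \<longlonglongrightarrow> 0 + 0"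
    unfolding ip_self_diff[OF X l L2_measurable[OF u(1)] L2_measurable[OF v(1)] l1 l2]
    by (intro tendsto_add u v)
  then show ?thesis
    using l by auto
qed

sublocale complex_hilbert "LR R" scale_L0 "ip R"
proof
  show "0 \<in> LR R"
  proof (rule LR_I[OF L2_const L2_const])
    show "AE t in \<mu>. coord1 0 t = 0" "AE t in \<mu>. coord2 0 t = 0"
      using rep_L0_0 by (eventually_elim, simp add: coord1_def coord2_def)+
  qed
  show "ip R g f = cnj (ip R f g)" if "f \<in> LR R" "g \<in> LR R" for f g
    unfolding ip_eq[OF that] ip_eq[OF that(2,1)] complex_cnj_add
    by (simp only: L2_ip_commute[of "coord1 g" "coord1 f"] L2_ip_commute[of "coord2 g" "coord2 f"])
  show "0 \<le> Re (ip R f f)" if "f \<in> LR R" for f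
    using that by (simp add: ip_self)
qed (fact LR_add LR_scale scale_L0_add_right scale_L0_add_left scale_L0_scale scale_L0_one ip_add_left
    ip_scale_left ip_eq_0 LR_complete)+

lemma nrm_eq_nm: "nrm R = nm"
  by (simp add: fun_eq_iff nrm_def nm_def)

end

section \<open>The subspaces \<open>H(n,m)\<close>\<close>

context scattering
begin

text \<open>Vectors W h with h = (x, y) in L^2. The generators of the subspaces and the vectors
  \<open>e_plus\<close>, \<open>e_minus\<close> all have this form, and computing with h avoids the
  inverse of W.\<close>

definition pot :: "(complex \<Rightarrow> complex) \<Rightarrow> (complex \<Rightarrow> complex) \<Rightarrow> L0" where
  "pot x y = abs_L0 (\<lambda>t. W R t *v vector [x t, y t])"

lemma pot_measurable:
  assumes "x \<in> borel_measurable \<mu>" "y \<in> borel_measurable \<mu>"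
  shows "(\<lambda>t. W R t *v vector [x t, y t]) \<in> borel_measurable \<mu>"
  unfolding W_mult_vector using assms by measurable

lemma pot_cong:
  assumes "x \<in> L2" "y \<in> L2" "x' \<in> L2" "y' \<in> L2"
    and "\<And>t. norm t = 1 \<Longrightarrow> x t = x' t" "\<And>t. norm t = 1 \<Longrightarrow> y t = y' t"
  shows "pot x y = pot x' y'"
  unfolding pot_def by (rule abs_L0_eqI) (use assms in \<open>auto intro!: pot_measurable L2_measurable\<close>)

lemma coord_pot:
  assumes "x \<in> L2" "y \<in> L2"
  shows "AE t in \<mu>. coord1 (pot x y) t = x t + cnj (R t) * y t"
    "AE t in \<mu>. coord2 (pot x y) t = complex_of_real (defect t) * y t"
proof -
  note m = pot_measurable[OF assms[THEN L2_measurable]]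
  show "AE t in \<mu>. coord1 (pot x y) t = x t + cnj (R t) * y t"
    using coord_abs_L0(1)[OF m] unfolding pot_def by eventually_elim (simp add: W_mult_vector)
  show "AE t in \<mu>. coord2 (pot x y) t = complex_of_real (defect t) * y t"
    using coord_abs_L0(2)[OF m] R_less_1 defect_pos unfolding pot_def
  proof eventually_elim
    case (elim t)
    define d where "d = complex_of_real (defect t)"
    have dd: "d * d = 1 - R t * cnj (R t)"
      unfolding d_def by (rule defect_mult_self[OF elim(2)])
    have "R t * x t + y t - R t * (x t + cnj (R t) * y t) = d * d * y t"
      unfolding dd by (simp add: algebra_simps)
    then show ?case
      using elim(1,3) unfolding d_def[symmetric] by (simp add: W_mult_vector d_def)
  qed
qed

lemma R_bound: "AE t in \<mu>. norm (cnj (R t)) \<le> 1"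
  using R_less_1 by eventually_elim simp

lemma defect_bound: "AE t in \<mu>. norm (complex_of_real (defect t)) \<le> 1"
  using R_less_1 by eventually_elim (simp add: defect_def abs_square_le_1)

lemma pot_LR:
  assumes "x \<in> L2" "y \<in> L2"
  shows "pot x y \<in> LR R"
  by (rule LR_I[OF _ _ coord_pot[OF assms]])
     (auto intro!: L2_add assms L2_mult_bounded[OF assms(2)] R_bound defect_bound borel_measurable_cnj
        borel_measurable_of_real)

lemma pot_add:
  assumes "x \<in> L2" "y \<in> L2" "x' \<in> L2" "y' \<in> L2"
  shows "pot x y + pot x' y' = pot (\<lambda>t. x t + x' t) (\<lambda>t. y t + y' t)"
proof -
  have "pot x y + pot x' y' = abs_L0 (\<lambda>t. W R t *v vector [x t, y t] + W R t *v vector [x' t, y' t])"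
    unfolding pot_def by (rule abs_L0_add) (intro pot_measurable L2_measurable assms)+
  also have "(\<lambda>t. W R t *v vector [x t, y t] + W R t *v vector [x' t, y' t]) =
      (\<lambda>t. W R t *v vector [x t + x' t, y t + y' t])"
    by (simp add: fun_eq_iff W_mult_vector vec_eq_iff forall_2 algebra_simps)
  finally show ?thesis
    by (simp add: pot_def)
qed

lemma pot_scale:
  assumes "x \<in> L2" "y \<in> L2"
  shows "c *\<^sub>C pot x y = pot (\<lambda>t. c * x t) (\<lambda>t. c * y t)"
proof -
  have "c *\<^sub>C pot x y = abs_L0 (\<lambda>t. c *s (W R t *v vector [x t, y t]))"
    unfolding pot_def by (rule abs_L0_scale) (intro pot_measurable L2_measurable assms)+
  also have "(\<lambda>t. c *s (W R t *v vector [x t, y t])) = (\<lambda>t. W R t *v vector [c * x t, c * y t])"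
    by (simp add: fun_eq_iff W_mult_vector vec_eq_iff forall_2 algebra_simps)
  finally show ?thesis
    by (simp add: pot_def)
qed

lemma pot_diff:
  assumes "x \<in> L2" "y \<in> L2" "x' \<in> L2" "y' \<in> L2"
  shows "pot x y - pot x' y' = pot (\<lambda>t. x t - x' t) (\<lambda>t. y t - y' t)"
  using pot_add[OF L2_diff[OF assms(1,3)] L2_diff[OF assms(2,4)] assms(3,4)]
  by (simp add: diff_eq_eq)

lemma pot_mult_t:
  assumes "x \<in> L2" "y \<in> L2"
  shows "mult_t (pot x y) = pot (\<lambda>t. t * x t) (\<lambda>t. t * y t)"
proof -
  have "mult_t (pot x y) = abs_L0 (\<lambda>t. t *s (W R t *v vector [x t, y t]))"
    unfolding pot_def by (rule abs_L0_mult_t) (intro pot_measurable L2_measurable assms)+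
  also have "(\<lambda>t. t *s (W R t *v vector [x t, y t])) = (\<lambda>t. W R t *v vector [t * x t, t * y t])"
    by (simp add: fun_eq_iff W_mult_vector vec_eq_iff forall_2 algebra_simps)
  finally show ?thesis
    by (simp add: pot_def)
qed

text \<open>The form h^* W h can be completed to squares in two ways, |x + cnj R y|^2 + (1 - |R|^2)
  |y|^2 and |y + R x|^2 + (1 - |R|^2) |x|^2; dropping the first square bounds either component. The
  weight is lowered to 1 - |R|, whose logarithm is integrable by assumption.\<close>

lemma nm_pot_ge:
  assumes x: "x \<in> L2" and y: "y \<in> L2"
  shows "(\<integral>t. (norm (x t))\<^sup>2 * (1 - norm (R t)) \<partial>\<mu>) \<le> (nm (pot x y))\<^sup>2"
    and "(\<integral>t. (norm (y t))\<^sup>2 * (1 - norm (R t)) \<partial>\<mu>) \<le> (nm (pot x y))\<^sup>2"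
proof -
  let ?q = "\<lambda>t. (norm (coord1 (pot x y) t))\<^sup>2 + (norm (coord2 (pot x y) t))\<^sup>2"
  note P = pot_LR[OF x y]
  have q: "integrable \<mu> ?q"
    using P by (intro Bochner_Integration.integrable_add L2_integrable LR_coord)
  have nm: "(nm (pot x y))\<^sup>2 = (\<integral>t. ?q t \<partial>\<mu>)"
    using P by (simp add: nm_power2 ip_self L2_integrable LR_coord)
  note [measurable] = L2_measurable[OF x] L2_measurable[OF y]
  have int: "integrable \<mu> (\<lambda>t. (norm (f t))\<^sup>2 * (1 - norm (R t)))" if "f \<in> L2" for f
  proof (rule Bochner_Integration.integrable_bound[OF L2_integrable[OF that]])
    show "AE t in \<mu>. norm ((norm (f t))\<^sup>2 * (1 - norm (R t))) \<le> norm ((norm (f t))\<^sup>2)"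
      using R_less_1 by eventually_elim (auto simp: abs_mult intro: mult_left_le)
  qed (use L2_measurable[OF that] in measurable)
  have pointwise: "AE t in \<mu>. (norm (x t))\<^sup>2 * (1 - norm (R t)) \<le> ?q t \<and>
      (norm (y t))\<^sup>2 * (1 - norm (R t)) \<le> ?q t"
    using coord_pot[OF x y] R_less_1
  proof eventually_elim
    case (elim t)
    define w where "w = 1 - (norm (R t))\<^sup>2"
    have w: "1 - norm (R t) \<le> w"
      using elim(3) by (simp add: w_def power2_eq_square mult_left_le)
    have "(norm (complex_of_real (defect t) * y t))\<^sup>2 = w * (norm (y t))\<^sup>2"
      using elim(3) by (simp add: norm_mult power_mult_distrib defect_def w_def abs_square_le_1)
    then have q: "?q t = (norm (x t + cnj (R t) * y t))\<^sup>2 + w * (norm (y t))\<^sup>2"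
      using elim by simp
    also have "\<dots> = w * (norm (x t))\<^sup>2 + (norm (y t + R t * x t))\<^sup>2"
      unfolding w_def cmod_power2 by (simp add: power2_eq_square algebra_simps)
    finally have q': "?q t = w * (norm (x t))\<^sup>2 + (norm (y t + R t * x t))\<^sup>2" .
    have "(norm (x t))\<^sup>2 * (1 - norm (R t)) \<le> (norm (x t))\<^sup>2 * w"
      "(norm (y t))\<^sup>2 * (1 - norm (R t)) \<le> (norm (y t))\<^sup>2 * w"
      using w by (auto intro: mult_left_mono)
    moreover have "(norm (x t))\<^sup>2 * w \<le> ?q t"
      unfolding q' by (simp add: mult.commute)
    moreover have "(norm (y t))\<^sup>2 * w \<le> ?q t"
      unfolding q by (simp add: mult.commute)
    ultimately show ?case
      by (meson order_trans)
  qed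
  show "(\<integral>t. (norm (x t))\<^sup>2 * (1 - norm (R t)) \<partial>\<mu>) \<le> (nm (pot x y))\<^sup>2"
    unfolding nm by (rule integral_mono_AE[OF int[OF x] q]) (use pointwise in auto)
  show "(\<integral>t. (norm (y t))\<^sup>2 * (1 - norm (R t)) \<partial>\<mu>) \<le> (nm (pot x y))\<^sup>2"
    unfolding nm by (rule integral_mono_AE[OF int[OF y] q]) (use pointwise in auto)
qed

section \<open>Generators of H(n,m) and their closure\<close>

definition gens :: "int \<Rightarrow> int \<Rightarrow> L0 set" where
  "gens n m = {pot (\<lambda>t. t powi n * hp t) (\<lambda>t. cnj t powi m * hm t) |hp hm. hp \<in> H2_plus \<and> hm \<in> H2_minus}"

lemma H_check_eq: "H_check R n m = LR_closure R (gens n m)"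
  by (simp add: H_check_def gens_def pot_def)

lemma L2_powi_mult:
  "h \<in> L2 \<Longrightarrow> (\<lambda>t. t powi n * h t) \<in> L2" "h \<in> L2 \<Longrightarrow> (\<lambda>t. cnj t powi n * h t) \<in> L2"
proof -
  have b: "AE t in \<mu>. norm (t powi n) \<le> 1" "AE t in \<mu>. norm (cnj t powi n) \<le> 1"
    by (rule AE_I2, simp add: norm_power_int)+
  have m: "(\<lambda>t::complex. t powi n) \<in> borel_measurable \<mu>"
    by (rule borel_measurable_circle) measurable
  show "h \<in> L2 \<Longrightarrow> (\<lambda>t. t powi n * h t) \<in> L2"
    by (rule L2_mult_bounded[OF _ m b(1)])
  show "h \<in> L2 \<Longrightarrow> (\<lambda>t. cnj t powi n * h t) \<in> L2"
    using L2_mult_bounded[OF _ borel_measurable_cnj[OF m]] b(2) by simp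
qed

lemma gens_L2:
  "h \<in> H2_plus \<Longrightarrow> (\<lambda>t. t powi n * h t) \<in> L2" "h \<in> H2_minus \<Longrightarrow> (\<lambda>t. cnj t powi n * h t) \<in> L2"
  by (intro L2_powi_mult H2_plus_L2 H2_minus_L2; assumption)+

lemma gensI:
  assumes "hp \<in> H2_plus" "hm \<in> H2_minus" "x \<in> L2" "y \<in> L2"
    and "\<And>t. norm t = 1 \<Longrightarrow> x t = t powi n * hp t" "\<And>t. norm t = 1 \<Longrightarrow> y t = cnj t powi m * hm t"
  shows "pot x y \<in> gens n m"
  unfolding gens_def using assms pot_cong[of x y "\<lambda>t. t powi n * hp t" "\<lambda>t. cnj t powi m * hm t"]
  by (auto intro!: gens_L2)

lemma gensE:
  assumes "f \<in> gens n m"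
  obtains hp hm where "hp \<in> H2_plus" "hm \<in> H2_minus"
    "f = pot (\<lambda>t. t powi n * hp t) (\<lambda>t. cnj t powi m * hm t)"
  using assms by (auto simp: gens_def)

lemma zero_H2_minus: "(\<lambda>_. 0) \<in> H2_minus"
  by (simp add: H2_minus_def L2_const)

lemma gens_LR: "gens n m \<subseteq> LR R"
  by (auto elim!: gensE intro!: pot_LR gens_L2)

lemma gens_zero: "0 \<in> gens n m"
proof -
  have "pot (\<lambda>_. 0) (\<lambda>_. 0) \<in> gens n m"
    by (rule gensI[OF const_H2_plus[of 0] zero_H2_minus]) (auto simp: L2_const)
  moreover have "pot (\<lambda>_. 0) (\<lambda>_. 0) = 0"
    using pot_scale[of "\<lambda>_. 0" "\<lambda>_. 0" 0] by (simp add: L2_const)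
  ultimately show ?thesis
    by simp
qed

lemma gens_add:
  assumes "f \<in> gens n m" "g \<in> gens n m"
  shows "f + g \<in> gens n m"
proof -
  obtain hp hm where 1: "hp \<in> H2_plus" "hm \<in> H2_minus"
      "f = pot (\<lambda>t. t powi n * hp t) (\<lambda>t. cnj t powi m * hm t)"
    using assms(1) by (rule gensE)
  obtain kp km where 2: "kp \<in> H2_plus" "km \<in> H2_minus"
      "g = pot (\<lambda>t. t powi n * kp t) (\<lambda>t. cnj t powi m * km t)"
    using assms(2) by (rule gensE)
  note L = gens_L2(1)[OF 1(1)] gens_L2(2)[OF 1(2)] gens_L2(1)[OF 2(1)] gens_L2(2)[OF 2(2)]
  show ?thesis
    unfolding 1(3) 2(3) pot_add[OF L]
    by (rule gensI[OF H2_plus_add[OF 1(1) 2(1)] H2_minus_add[OF 1(2) 2(2)]])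
       ((intro L2_add L)+, simp_all add: distrib_left)
qed

lemma gens_scale:
  assumes "f \<in> gens n m"
  shows "c *\<^sub>C f \<in> gens n m"
proof -
  obtain hp hm where 1: "hp \<in> H2_plus" "hm \<in> H2_minus"
      "f = pot (\<lambda>t. t powi n * hp t) (\<lambda>t. cnj t powi m * hm t)"
    using assms(1) by (rule gensE)
  note L = gens_L2(1)[OF 1(1)] gens_L2(2)[OF 1(2)]
  show ?thesis
    unfolding 1(3) pot_scale[OF L]
    by (rule gensI[OF H2_plus_cmult[OF 1(1), of c] H2_minus_cmult[OF 1(2), of c]])
       ((intro L2_cmult L)+, simp_all)
qed

lemma LR_closureI: "f \<in> LR R \<Longrightarrow> (\<And>e. e > 0 \<Longrightarrow> \<exists>g\<in>S. nm (f - g) < e) \<Longrightarrow> f \<in> LR_closure R S"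
  by (simp add: LR_closure_def nrm_eq_nm)

lemma LR_closureD: "f \<in> LR_closure R S \<Longrightarrow> f \<in> LR R" "f \<in> LR_closure R S \<Longrightarrow> e > 0 \<Longrightarrow> \<exists>g\<in>S. nm (f - g) < e"
  by (auto simp: LR_closure_def nrm_eq_nm)

lemma LR_closure_superset: "S \<subseteq> LR R \<Longrightarrow> S \<subseteq> LR_closure R S"
proof
  fix f assume "S \<subseteq> LR R" "f \<in> S"
  then show "f \<in> LR_closure R S"
    by (intro LR_closureI) (auto intro!: bexI[of _ f] simp: nm_def)
qed

lemma LR_closure_mono: "S \<subseteq> T \<Longrightarrow> LR_closure R S \<subseteq> LR_closure R T"
  unfolding LR_closure_def by blast

lemma closed_subspace_closure:
  assumes S: "S \<subseteq> LR R" "0 \<in> S" "\<And>f g. f \<in> S \<Longrightarrow> g \<in> S \<Longrightarrow> f + g \<in> S" "\<And>c f. f \<in> S \<Longrightarrow> c *\<^sub>C f \<in> S"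
  shows "closed_subspace (LR_closure R S)"
  unfolding closed_subspace_def
proof (intro conjI ballI allI impI)
  show "LR_closure R S \<subseteq> LR R"
    by (auto dest: LR_closureD)
  show "0 \<in> LR_closure R S"
    using LR_closure_superset[OF S(1)] S(2) by blast
next
  fix f g assume fg: "f \<in> LR_closure R S" "g \<in> LR_closure R S"
  note H = LR_closureD(1)[OF fg(1)] LR_closureD(1)[OF fg(2)]
  show "f + g \<in> LR_closure R S"
  proof (rule LR_closureI)
    fix e :: real assume "e > 0"
    then have "e / 2 > 0" by simp
    obtain f' where f': "f' \<in> S" "nm (f - f') < e / 2"
      using LR_closureD(2)[OF fg(1) \<open>e / 2 > 0\<close>] by blast
    obtain g' where g': "g' \<in> S" "nm (g - g') < e / 2"
      using LR_closureD(2)[OF fg(2) \<open>e / 2 > 0\<close>] by blast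
    have "f' \<in> LR R" "g' \<in> LR R"
      using f' g' S by auto
    then have "nm ((f - f') + (g - g')) \<le> nm (f - f') + nm (g - g')"
      using H by (intro nm_triangle) auto
    moreover have "(f - f') + (g - g') = f + g - (f' + g')"
      by simp
    ultimately have "nm (f + g - (f' + g')) < e"
      using f' g' by simp
    then show "\<exists>h\<in>S. nm (f + g - h) < e"
      using S(3) f' g' by blast
  qed (use H in simp)
next
  fix c f assume f: "f \<in> LR_closure R S"
  note H = LR_closureD(1)[OF f]
  show "c *\<^sub>C f \<in> LR_closure R S"
  proof (rule LR_closureI)
    fix e :: real assume "e > 0"
    have pos: "norm c + 1 > 0"
      by (intro add_nonneg_pos) auto
    then have "e / (norm c + 1) > 0"
      using \<open>e > 0\<close> by simp
    then obtain f' where f': "f' \<in> S" "nm (f - f') < e / (norm c + 1)"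
      using LR_closureD(2)[OF f] by blast
    have f'H: "f' \<in> LR R"
      using f' S by auto
    have "nm (c *\<^sub>C f - c *\<^sub>C f') = norm c * nm (f - f')"
      using H f'H by (simp add: nm_scale flip: scale_diff_right)
    also have "\<dots> \<le> (norm c + 1) * nm (f - f')"
      using H f'H by (intro mult_right_mono) auto
    also have "\<dots> < e"
      using f'(2) pos by (simp add: field_simps)
    finally show "\<exists>h\<in>S. nm (c *\<^sub>C f - h) < e"
      using S(4)[OF f'(1)] by blast
  qed (use H in simp)
next
  fix f assume H: "f \<in> LR R" and f: "\<forall>e>0. \<exists>y\<in>LR_closure R S. nm (f - y) < e"
  show "f \<in> LR_closure R S"
  proof (rule LR_closureI[OF H])
    fix e :: real assume "e > 0"
    then have "e / 2 > 0" by simp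
    obtain y where y: "y \<in> LR_closure R S" "nm (f - y) < e / 2"
      using f \<open>e / 2 > 0\<close> by blast
    obtain g where g: "g \<in> S" "nm (y - g) < e / 2"
      using LR_closureD(2)[OF y(1) \<open>e / 2 > 0\<close>] by blast
    have "nm (f - g) \<le> nm (f - y) + nm (y - g)"
      by (rule nm_triangle_diff) (use H LR_closureD(1)[OF y(1)] g S in auto)
    then show "\<exists>g\<in>S. nm (f - g) < e"
      using y g by (intro bexI[of _ g]) auto
  qed
qed

lemma H_check_closed: "closed_subspace (H_check R n m)"
  unfolding H_check_eq by (intro closed_subspace_closure gens_LR gens_zero gens_add gens_scale)

lemma gens_subset_H_check: "gens n m \<subseteq> H_check R n m"
  unfolding H_check_eq by (rule LR_closure_superset[OF gens_LR])

lemma H_check_LR: "f \<in> H_check R n m \<Longrightarrow> f \<in> LR R"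
  by (rule subspace_carrier[OF H_check_closed])

lemma power_int_Suc_circle: "norm t = 1 \<Longrightarrow> t powi (n + 1) = t powi n * t" for t :: complex
  by (rule power_int_add_1) auto

lemma H_check_sub_plus: "H_check R (n + 1) m \<subseteq> H_check R n m"
  unfolding H_check_eq
proof (rule LR_closure_mono, rule subsetI)
  fix f assume "f \<in> gens (n + 1) m"
  then obtain hp hm where h: "hp \<in> H2_plus" "hm \<in> H2_minus"
      and f: "f = pot (\<lambda>t. t powi (n + 1) * hp t) (\<lambda>t. cnj t powi m * hm t)"
    by (rule gensE)
  show "f \<in> gens n m"
    unfolding f by (rule gensI[OF H2_plus_mult_powi[OF h(1), of 1] h(2)])
      (auto intro!: gens_L2 h simp: power_int_Suc_circle mult.assoc)
qed

lemma H_check_sub_minus: "H_check R n (m + 1) \<subseteq> H_check R n m"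
  unfolding H_check_eq
proof (rule LR_closure_mono, rule subsetI)
  fix f assume "f \<in> gens n (m + 1)"
  then obtain hp hm where h: "hp \<in> H2_plus" "hm \<in> H2_minus"
      and f: "f = pot (\<lambda>t. t powi n * hp t) (\<lambda>t. cnj t powi (m + 1) * hm t)"
    by (rule gensE)
  show "f \<in> gens n m"
    unfolding f by (rule gensI[OF h(1) H2_minus_mult_cnj[OF h(2)]])
      (auto intro!: gens_L2 h simp: power_int_Suc_circle mult.assoc)
qed

lemma e_plus_eq: "e_plus R n = pot (\<lambda>t. t powi n) (\<lambda>_. 0)"
proof -
  have "(t powi n) *s vector [1, R t] = W R t *v vector [t powi n, 0]" for t
    by (simp add: W_mult_vector vec_eq_iff forall_2 mult.commute)
  then show ?thesis
    by (simp add: e_plus_def pot_def)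
qed

lemma e_minus_eq: "e_minus R n = pot (\<lambda>_. 0) (\<lambda>t. cnj t powi n)"
proof -
  have "(cnj t powi n) *s vector [cnj (R t), 1] = W R t *v vector [0, cnj t powi n]" for t
    by (simp add: W_mult_vector vec_eq_iff forall_2 mult.commute)
  then show ?thesis
    by (simp add: e_minus_def pot_def)
qed

lemma cnj_powi_L2: "(\<lambda>t. cnj t powi n) \<in> L2"
  using L2_powi_mult(2)[OF L2_const[of 1], of n] by simp

lemma e_plus_gens: "e_plus R n \<in> gens n m"
  unfolding e_plus_eq by (rule gensI[OF const_H2_plus[of 1] zero_H2_minus]) (auto simp: L2_const)

lemma cnj_H2_minus_ident: "cnj \<in> H2_minus"
proof -
  have "(\<lambda>t. cnj t * 1) \<in> L2"
    using L2_powi_mult(2)[OF L2_const[of 1], of 1] by simp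
  moreover have "(\<integral>t. cnj t * cnj (g t) \<partial>\<mu>) = 0" if g: "g \<in> H2_plus" for g
  proof -
    have "(\<integral>t. cnj t * cnj (g t) \<partial>\<mu>) = (\<integral>t. t powi (- 1) * cnj (g t) \<partial>\<mu>)"
      by (rule integral_circle_cong) (simp add: power_int_minus cnj_circle)
    also have "\<dots> = 0"
      by (rule H2_minus_orth[OF cnj_powi_H2_minus g]) simp
    finally show ?thesis .
  qed
  ultimately show ?thesis
    by (simp add: H2_minus_def)
qed

text \<open>The index is m + 1 because the top frequency in H^2_- is -1: the leading second
  component is \<open>cnj t powi m * cnj t\<close>.\<close>

lemma e_minus_gens: "e_minus R (m + 1) \<in> gens n m"
  unfolding e_minus_eq
  by (rule gensI[OF const_H2_plus[of 0] cnj_H2_minus_ident])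
     (auto simp: L2_const cnj_powi_L2 power_int_Suc_circle)

lemmas e_plus_H_check = subsetD[OF gens_subset_H_check e_plus_gens]
lemmas e_minus_H_check = subsetD[OF gens_subset_H_check e_minus_gens]

text \<open>From hp = c + t k one gets t^n hp = c t^n + t^(n+1) k, so every generator is exactly c e
  + g; only the passage to the closure needs an approximation.\<close>

lemma e_plus_dense:
  assumes x: "x \<in> H_check R n m" and e: "e > 0"
  shows "\<exists>c. \<exists>g\<in>H_check R (n + 1) m. nm (x - (c *\<^sub>C e_plus R n + g)) < e"
proof -
  obtain f where f: "f \<in> gens n m" "nm (x - f) < e"
    using x e LR_closureD(2) unfolding H_check_eq by blast
  obtain hp hm where h: "hp \<in> H2_plus" "hm \<in> H2_minus"
      and f_eq: "f = pot (\<lambda>t. t powi n * hp t) (\<lambda>t. cnj t powi m * hm t)"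
    using f(1) by (rule gensE)
  obtain c k where k: "k \<in> H2_plus" "\<And>t. norm t = 1 \<Longrightarrow> hp t = c + t * k t"
    using H2_plus_decompose[OF h(1)] by blast
  define g where "g = pot (\<lambda>t. t powi (n + 1) * k t) (\<lambda>t. cnj t powi m * hm t)"
  have "g \<in> gens (n + 1) m"
    unfolding g_def by (rule gensI[OF k(1) h(2)]) (auto intro!: gens_L2 k h)
  then have gH: "g \<in> H_check R (n + 1) m"
    using gens_subset_H_check by blast
  have "c *\<^sub>C e_plus R n = pot (\<lambda>t. c * t powi n) (\<lambda>t. c * 0)"
    unfolding e_plus_eq by (rule pot_scale) (simp_all add: L2_const)
  then have "c *\<^sub>C e_plus R n + g =
      pot (\<lambda>t. c * t powi n + t powi (n + 1) * k t) (\<lambda>t. c * 0 + cnj t powi m * hm t)"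
    unfolding g_def by (simp only:) (intro pot_add gens_L2 k h L2_cmult powi_L2 L2_const)
  also have "\<dots> = f"
    unfolding f_eq
  proof (rule pot_cong)
    fix t :: complex assume t: "norm t = 1"
    show "c * t powi n + t powi (n + 1) * k t = t powi n * hp t"
      unfolding k(2)[OF t] power_int_Suc_circle[OF t] by (simp add: algebra_simps)
  qed (simp | intro gens_L2 k(1) h L2_add L2_cmult powi_L2 L2_const)+
  finally show ?thesis
    using f(2) gH by blast
qed

lemma e_minus_dense:
  assumes x: "x \<in> H_check R n m" and e: "e > 0"
  shows "\<exists>c. \<exists>g\<in>H_check R n (m + 1). nm (x - (c *\<^sub>C e_minus R (m + 1) + g)) < e"
proof -
  obtain f where f: "f \<in> gens n m" "nm (x - f) < e"
    using x e LR_closureD(2) unfolding H_check_eq by blast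
  obtain hp hm where h: "hp \<in> H2_plus" "hm \<in> H2_minus"
      and f_eq: "f = pot (\<lambda>t. t powi n * hp t) (\<lambda>t. cnj t powi m * hm t)"
    using f(1) by (rule gensE)
  obtain c k where k: "k \<in> H2_minus" "\<And>t. norm t = 1 \<Longrightarrow> hm t = cnj t * (c + k t)"
    using H2_minus_decompose[OF h(2)] by blast
  define g where "g = pot (\<lambda>t. t powi n * hp t) (\<lambda>t. cnj t powi (m + 1) * k t)"
  have "g \<in> gens n (m + 1)"
    unfolding g_def by (rule gensI[OF h(1) k(1)]) (auto intro!: gens_L2 k h)
  then have gH: "g \<in> H_check R n (m + 1)"
    using gens_subset_H_check by blast
  have "c *\<^sub>C e_minus R (m + 1) = pot (\<lambda>t. c * 0) (\<lambda>t. c * cnj t powi (m + 1))"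
    unfolding e_minus_eq by (rule pot_scale) (simp_all add: L2_const cnj_powi_L2)
  then have "c *\<^sub>C e_minus R (m + 1) + g =
      pot (\<lambda>t. c * 0 + t powi n * hp t) (\<lambda>t. c * cnj t powi (m + 1) + cnj t powi (m + 1) * k t)"
    unfolding g_def by (simp only:) (intro pot_add gens_L2 k h L2_cmult cnj_powi_L2 L2_const)
  also have "\<dots> = f"
    unfolding f_eq
  proof (rule pot_cong)
    fix t :: complex assume t: "norm t = 1"
    then have "norm (cnj t) = 1"
      by simp
    note Suc = power_int_Suc_circle[OF this]
    show "c * cnj t powi (m + 1) + cnj t powi (m + 1) * k t = cnj t powi m * hm t"
      unfolding k(2)[OF t] Suc by (simp add: algebra_simps)
  qed (simp | intro gens_L2 k(1) h L2_add L2_cmult cnj_powi_L2 L2_const)+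
  finally show ?thesis
    using f(2) gH by blast
qed

section \<open>Strictness of the inclusions\<close>

definition szego_bound :: real where
  "szego_bound = exp (\<integral>t. ln (1 - norm (R t)) \<partial>\<mu>) / 2"

lemma szego_bound_le:
  assumes "h \<in> H2_plus"
  shows "szego_bound \<le> (\<integral>t. (norm (1 - t * h t))\<^sup>2 * (1 - norm (R t)) \<partial>\<mu>)"
  unfolding szego_bound_def
  by (rule Szego_H2_plus[OF _ _ _ _ assms]) (use R_log in \<open>auto simp: log_integrable_def\<close>)

lemma not_in_closure:
  assumes "b > 0" "\<And>g. g \<in> S \<Longrightarrow> b \<le> (nm (e - g))\<^sup>2" "S \<subseteq> LR R"
  shows "e \<notin> LR_closure R S"
proof
  assume e: "e \<in> LR_closure R S"
  then obtain g where g: "g \<in> S" "nm (e - g) < sqrt b"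
    using LR_closureD(2)[OF e, of "sqrt b"] assms(1) by auto
  have "(nm (e - g))\<^sup>2 < (sqrt b)\<^sup>2"
    using g assms(3) LR_closureD(1)[OF e] by (intro power_strict_mono) auto
  then show False
    using assms(1) assms(2)[OF g(1)] by simp
qed

text \<open>The estimate on the first component is uniform in hm; there the common factor t^n has
  modulus 1, which leaves |1 - t hp|.\<close>

lemma e_plus_not_in: "e_plus R n \<notin> H_check R (n + 1) m"
  unfolding H_check_eq
proof (rule not_in_closure[OF _ _ gens_LR])
  show "0 < szego_bound"
    by (simp add: szego_bound_def)
  fix g assume "g \<in> gens (n + 1) m"
  then obtain hp hm where h: "hp \<in> H2_plus" "hm \<in> H2_minus"
      and g: "g = pot (\<lambda>t. t powi (n + 1) * hp t) (\<lambda>t. cnj t powi m * hm t)"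
    by (rule gensE)
  note L = powi_L2[of n] L2_const[of 0] gens_L2(1)[OF h(1), of "n + 1"] gens_L2(2)[OF h(2), of m]
  have "szego_bound \<le> (\<integral>t. (norm (1 - t * hp t))\<^sup>2 * (1 - norm (R t)) \<partial>\<mu>)"
    by (rule szego_bound_le[OF h(1)])
  also have "\<dots> = (\<integral>t. (norm (t powi n - t powi (n + 1) * hp t))\<^sup>2 * (1 - norm (R t)) \<partial>\<mu>)"
  proof (rule integral_circle_cong)
    fix t :: complex assume t: "norm t = 1"
    have "t powi n - t powi (n + 1) * hp t = t powi n * (1 - t * hp t)"
      unfolding power_int_Suc_circle[OF t] by (simp add: algebra_simps)
    then have "norm (t powi n - t powi (n + 1) * hp t) = norm (1 - t * hp t)"
      using t by (simp only: norm_mult norm_power_int) simp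
    then show "(norm (1 - t * hp t))\<^sup>2 * (1 - norm (R t)) =
        (norm (t powi n - t powi (n + 1) * hp t))\<^sup>2 * (1 - norm (R t))"
      by (simp only:)
  qed
  also have "\<dots> \<le> (nm (e_plus R n - g))\<^sup>2"
    unfolding e_plus_eq g pot_diff[OF L] by (intro nm_pot_ge L2_diff L)
  finally show "szego_bound \<le> (nm (e_plus R n - g))\<^sup>2" .
qed

text \<open>The second component leaves |1 - hm|, and the conjugate of 1 - hm is 1 - t h with h =
  t^-1 cnj hm in H^2_+, so the bound for H^2_+ applies.\<close>

lemma e_minus_not_in: "e_minus R m \<notin> H_check R n m"
  unfolding H_check_eq
proof (rule not_in_closure[OF _ _ gens_LR])
  show "0 < szego_bound"
    by (simp add: szego_bound_def)
  fix g assume "g \<in> gens n m"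
  then obtain hp hm where h: "hp \<in> H2_plus" "hm \<in> H2_minus"
      and g: "g = pot (\<lambda>t. t powi n * hp t) (\<lambda>t. cnj t powi m * hm t)"
    by (rule gensE)
  note L = L2_const[of 0] cnj_powi_L2[of m] gens_L2(1)[OF h(1), of n] gens_L2(2)[OF h(2), of m]
  have "szego_bound \<le> (\<integral>t. (norm (1 - t * (t powi (- 1) * cnj (hm t))))\<^sup>2 * (1 - norm (R t)) \<partial>\<mu>)"
    by (rule szego_bound_le[OF cnj_H2_minus[OF h(2)]])
  also have "\<dots> = (\<integral>t. (norm (cnj t powi m - cnj t powi m * hm t))\<^sup>2 * (1 - norm (R t)) \<partial>\<mu>)"
  proof (rule integral_circle_cong)
    fix t :: complex assume t: "norm t = 1"
    then have "t \<noteq> 0"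
      by auto
    then have "1 - t * (t powi (- 1) * cnj (hm t)) = cnj (1 - hm t)"
      by (simp add: power_int_minus)
    then have "norm (1 - t * (t powi (- 1) * cnj (hm t))) = norm (1 - hm t)"
      by (simp only: complex_mod_cnj)
    moreover have "cnj t powi m - cnj t powi m * hm t = cnj t powi m * (1 - hm t)"
      by (simp add: algebra_simps)
    then have "norm (cnj t powi m - cnj t powi m * hm t) = norm (1 - hm t)"
      using t by (simp only: norm_mult norm_power_int) simp
    ultimately show "(norm (1 - t * (t powi (- 1) * cnj (hm t))))\<^sup>2 * (1 - norm (R t)) =
        (norm (cnj t powi m - cnj t powi m * hm t))\<^sup>2 * (1 - norm (R t))"
      by (simp only:)
  qed
  also have "\<dots> \<le> (nm (e_minus R m - g))\<^sup>2"
    unfolding e_minus_eq g pot_diff[OF L(1,2,3,4)] by (intro nm_pot_ge L2_diff L)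
  finally show "szego_bound \<le> (nm (e_minus R m - g))\<^sup>2" .
qed

end

section \<open>The recurrence\<close>

context scattering
begin

lemma pos_ip_commute: "f \<in> LR R \<Longrightarrow> g \<in> LR R \<Longrightarrow> 0 < ip R f g \<longleftrightarrow> 0 < ip R g f"
  using inn_commute[of f g] by (simp add: pos_complex_iff)

text \<open>From here on \<open>K_check\<close> is used only through this property, which determines
  it by \<open>unit_gap_unique\<close>.\<close>

lemma K_check_gap: "unit_gap (H_check R n m) (H_check R (n + 1) m) (e_plus R n) (K_check R n m)"
proof -
  let ?M = "H_check R n m" and ?N = "H_check R (n + 1) m"
  obtain k where k: "unit_gap ?M ?N (e_plus R n) k"
    by (rule unit_gap_exists[OF H_check_closed H_check_closed H_check_sub_plus e_plus_H_check
          e_plus_not_in e_plus_dense])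
  have "K_check R n m = k"
    unfolding K_check_def
  proof (rule the_equality)
    show "k \<in> ominus R ?M ?N \<and> nrm R k = 1 \<and> 0 < ip R (e_plus R n) k"
      using k by (auto simp: unit_gap_def ominus_def nrm_eq_nm)
    show "x = k" if "x \<in> ominus R ?M ?N \<and> nrm R x = 1 \<and> 0 < ip R (e_plus R n) x" for x
      using unit_gap_unique[OF H_check_closed H_check_closed H_check_sub_plus e_plus_H_check k, of x] that
      by (auto simp: ominus_def nrm_eq_nm)
  qed
  then show ?thesis
    using k by simp
qed

text \<open>The normalization of \<open>Kt_check\<close> has the vector in the left slot of the
  inner product; for a positive value the order can be exchanged.\<close>

lemma Kt_check_gap: "unit_gap (H_check R n m) (H_check R n (m + 1)) (e_minus R (m + 1)) (Kt_check R n m)"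
proof -
  let ?M = "H_check R n m" and ?N = "H_check R n (m + 1)"
  obtain k where k: "unit_gap ?M ?N (e_minus R (m + 1)) k"
    by (rule unit_gap_exists[OF H_check_closed H_check_closed H_check_sub_minus e_minus_H_check
          e_minus_not_in e_minus_dense])
  have LR: "e_minus R (m + 1) \<in> LR R"
    by (rule H_check_LR[OF e_minus_H_check])
  have "Kt_check R n m = k"
    unfolding Kt_check_def
  proof (rule the_equality)
    have "k \<in> LR R"
      using k by (auto simp: unit_gap_def intro: H_check_LR)
    then show "k \<in> ominus R ?M ?N \<and> nrm R k = 1 \<and> 0 < ip R k (e_minus R (m + 1))"
      using k pos_ip_commute[OF _ LR, of k] by (auto simp: unit_gap_def ominus_def nrm_eq_nm)
    fix x assume x: "x \<in> ominus R ?M ?N \<and> nrm R x = 1 \<and> 0 < ip R x (e_minus R (m + 1))"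
    then have "x \<in> LR R"
      by (auto simp: ominus_def intro: H_check_LR)
    then show "x = k"
      using unit_gap_unique[OF H_check_closed H_check_closed H_check_sub_minus e_minus_H_check k, of x] x
        pos_ip_commute[OF _ LR, of x]
      by (auto simp: ominus_def nrm_eq_nm)
  qed
  then show ?thesis
    using k by simp
qed

lemma K_check_in: "K_check R n m \<in> H_check R n m"
  and Kt_check_in: "Kt_check R n m \<in> H_check R n m"
  using K_check_gap[of n m] Kt_check_gap[of n m] by (auto simp: unit_gap_def)

lemma K_check_LR: "K_check R n m \<in> LR R" and Kt_check_LR: "Kt_check R n m \<in> LR R"
  by (rule H_check_LR[OF K_check_in], rule H_check_LR[OF Kt_check_in])

lemma nm_mult_t: "f \<in> LR R \<Longrightarrow> nm (mult_t f) = nm f"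
  by (simp add: nm_def ip_mult_t)

section \<open>Invariance under multiplication by t\<close>

lemma gens_mult_t: "mult_t ` gens n (m + 1) = gens (n + 1) m"
proof (intro equalityI subsetI)
  have cnj: "t * (cnj t powi (m + 1) * z) = cnj t powi m * z" if t: "norm t = 1" for t z :: complex
  proof -
    have "norm (cnj t) = 1"
      using t by simp
    then have "t * (cnj t powi (m + 1) * z) = (t * cnj t) * (cnj t powi m * z)"
      unfolding power_int_Suc_circle[OF \<open>norm (cnj t) = 1\<close>] by (simp only: mult_ac)
    then show ?thesis
      by (simp only: circle_mult_cnj[OF t] mult_1)
  qed
  have mult_t_pot: "mult_t (pot (\<lambda>t. t powi n * hp t) (\<lambda>t. cnj t powi (m + 1) * hm t)) =
      pot (\<lambda>t. t powi (n + 1) * hp t) (\<lambda>t. cnj t powi m * hm t)"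
    if h: "hp \<in> H2_plus" "hm \<in> H2_minus" for hp hm
  proof -
    note L = gens_L2(1)[OF h(1), of n] gens_L2(2)[OF h(2), of "m + 1"]
    have L': "(\<lambda>t. t * (t powi n * hp t)) \<in> L2" "(\<lambda>t. t * (cnj t powi (m + 1) * hm t)) \<in> L2"
      using L2_powi_mult(1)[OF L(1), of 1] L2_powi_mult(1)[OF L(2), of 1] by simp_all
    show ?thesis
      unfolding pot_mult_t[OF L]
    proof (rule pot_cong[OF L' gens_L2(1)[OF h(1)] gens_L2(2)[OF h(2)]])
      fix t :: complex assume t: "norm t = 1"
      show "t * (t powi n * hp t) = t powi (n + 1) * hp t"
        unfolding power_int_Suc_circle[OF t] by (simp only: mult_ac)
      show "t * (cnj t powi (m + 1) * hm t) = cnj t powi m * hm t"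
        by (rule cnj[OF t])
    qed
  qed
  show "f \<in> gens (n + 1) m" if "f \<in> mult_t ` gens n (m + 1)" for f
  proof -
    obtain g where "g \<in> gens n (m + 1)" and f: "f = mult_t g"
      using \<open>f \<in> mult_t ` gens n (m + 1)\<close> by blast
    then obtain hp hm where h: "hp \<in> H2_plus" "hm \<in> H2_minus"
      and g: "g = pot (\<lambda>t. t powi n * hp t) (\<lambda>t. cnj t powi (m + 1) * hm t)"
      by (auto elim: gensE)
    show ?thesis
      unfolding f g mult_t_pot[OF h] gens_def using h by blast
  qed
  show "f \<in> mult_t ` gens n (m + 1)" if "f \<in> gens (n + 1) m" for f
  proof -
    obtain hp hm where h: "hp \<in> H2_plus" "hm \<in> H2_minus"
      and f: "f = pot (\<lambda>t. t powi (n + 1) * hp t) (\<lambda>t. cnj t powi m * hm t)"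
      using \<open>f \<in> gens (n + 1) m\<close> by (rule gensE)
    have "pot (\<lambda>t. t powi n * hp t) (\<lambda>t. cnj t powi (m + 1) * hm t) \<in> gens n (m + 1)"
      unfolding gens_def using h by blast
    then show ?thesis
      unfolding f mult_t_pot[OF h, symmetric] by (rule imageI)
  qed
qed

lemma mult_t_LR_closure:
  assumes "S \<subseteq> LR R"
  shows "mult_t f \<in> LR_closure R (mult_t ` S) \<longleftrightarrow> f \<in> LR_closure R S"
proof (cases "f \<in> LR R")
  case True
  have "nm (mult_t f - mult_t g) = nm (f - g)" if "g \<in> S" for g
  proof -
    have "f - g \<in> LR R"
      using True that assms by auto
    then show ?thesis
      by (metis mult_t_diff nm_mult_t)
  qed
  then show ?thesis
    using True by (simp add: LR_closure_def nrm_eq_nm LR_mult_t_iff)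
next
  case False
  then show ?thesis
    by (auto simp: LR_closure_def LR_mult_t_iff)
qed

lemma mult_t_H_check: "mult_t f \<in> H_check R (n + 1) m \<longleftrightarrow> f \<in> H_check R n (m + 1)"
  unfolding H_check_eq gens_mult_t[symmetric] by (rule mult_t_LR_closure[OF gens_LR])

lemma mult_cnj_t_H_check: "f \<in> H_check R (n + 1) m \<Longrightarrow> mult_cnj_t f \<in> H_check R n (m + 1)"
  using mult_t_H_check[of "mult_cnj_t f" n m] by simp

lemma mult_t_e_plus: "mult_t (e_plus R n) = e_plus R (n + 1)"
proof -
  have "mult_t (e_plus R n) = pot (\<lambda>t. t * t powi n) (\<lambda>t. t * 0)"
    unfolding e_plus_eq by (rule pot_mult_t) (simp_all add: L2_const)
  also have "\<dots> = pot (\<lambda>t. t powi (n + 1)) (\<lambda>_. 0)"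
  proof (rule pot_cong)
    show "(\<lambda>t. t * t powi n) \<in> L2"
      using L2_powi_mult(1)[OF powi_L2, of 1 n] by simp
  qed (simp_all add: L2_const power_int_Suc_circle mult.commute)
  finally show ?thesis
    by (simp add: e_plus_eq)
qed

lemma mult_t_e_minus: "mult_t (e_minus R (m + 1)) = e_minus R m"
proof -
  have "mult_t (e_minus R (m + 1)) = pot (\<lambda>t. t * 0) (\<lambda>t. t * cnj t powi (m + 1))"
    unfolding e_minus_eq by (rule pot_mult_t) (simp_all add: L2_const cnj_powi_L2)
  also have "\<dots> = pot (\<lambda>_. 0) (\<lambda>t. cnj t powi m)"
  proof (rule pot_cong)
    show "(\<lambda>t. t * cnj t powi (m + 1)) \<in> L2"
      using L2_powi_mult(1)[OF cnj_powi_L2, of 1 "m + 1"] by simp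
    fix t :: complex assume t: "norm t = 1"
    then have "norm (cnj t) = 1"
      by simp
    then have "t * cnj t powi (m + 1) = (t * cnj t) * cnj t powi m"
      unfolding power_int_Suc_circle[OF \<open>norm (cnj t) = 1\<close>] by (simp only: mult_ac)
    then show "t * cnj t powi (m + 1) = cnj t powi m"
      by (simp only: circle_mult_cnj[OF t] mult_1)
  qed (simp_all add: L2_const cnj_powi_L2)
  finally show ?thesis
    by (simp add: e_minus_eq)
qed

lemma unit_gap_mult_t:
  assumes "unit_gap M N e k" and H: "M \<subseteq> LR R" "N \<subseteq> LR R" "e \<in> LR R"
    and M': "\<And>f. mult_t f \<in> M' \<longleftrightarrow> f \<in> M" and N': "\<And>f. mult_t f \<in> N' \<longleftrightarrow> f \<in> N"
  shows "unit_gap M' N' (mult_t e) (mult_t k)"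
proof -
  have k: "k \<in> M" "\<And>g. g \<in> N \<Longrightarrow> ip R k g = 0" "nm k = 1" "0 < ip R e k"
    "\<And>x. x \<in> M \<Longrightarrow> x - ip R x k *\<^sub>C k \<in> N"
    using assms(1) by (auto simp: unit_gap_def)
  have kH: "k \<in> LR R"
    using k(1) H by blast
  have "ip R (mult_t k) g = 0" if "g \<in> N'" for g
  proof -
    have g: "g = mult_t (mult_cnj_t g)" "mult_cnj_t g \<in> N"
      using that N'[of "mult_cnj_t g"] by simp_all
    have "ip R (mult_t k) (mult_t (mult_cnj_t g)) = ip R k (mult_cnj_t g)"
      using kH g(2) H(2) by (intro ip_mult_t) auto
    then show ?thesis
      using k(2)[OF g(2)] by simp
  qed
  moreover have "x - ip R x (mult_t k) *\<^sub>C mult_t k \<in> N'" if "x \<in> M'" for x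
  proof -
    define y where "y = mult_cnj_t x"
    have x: "x = mult_t y"
      by (simp add: y_def)
    then have y: "y \<in> M"
      using M'[of y] that by simp
    then have "ip R x (mult_t k) = ip R y k"
      unfolding x using kH H(1) by (intro ip_mult_t) auto
    then have "x - ip R x (mult_t k) *\<^sub>C mult_t k = mult_t (y - ip R y k *\<^sub>C k)"
      unfolding x by (simp only: mult_t_diff mult_t_scale)
    then show ?thesis
      using N' k(5)[OF y] by simp
  qed
  ultimately show ?thesis
    using k kH H by (simp add: unit_gap_def M' nm_mult_t ip_mult_t)
qed

lemma H_check_subset_LR: "H_check R n m \<subseteq> LR R"
  using H_check_LR by blast

text \<open>Multiplication by t is unitary and carries the subspaces and the normalizing vector at
  (n, m + 1) to those at (n + 1, m), so it carries the unique unit vector along.\<close>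

lemma K_check_shift: "K_check R (n + 1) m = mult_t (K_check R n (m + 1))"
proof (rule sym)
  have "unit_gap (H_check R (n + 1) m) (H_check R (n + 1 + 1) m) (mult_t (e_plus R n)) (mult_t (K_check R n (m + 1)))"
    by (rule unit_gap_mult_t[OF K_check_gap H_check_subset_LR H_check_subset_LR
          H_check_LR[OF e_plus_H_check] mult_t_H_check mult_t_H_check])
  then have g: "unit_gap (H_check R (n + 1) m) (H_check R (n + 1 + 1) m) (e_plus R (n + 1)) (mult_t (K_check R n (m + 1)))"
    by (simp only: mult_t_e_plus)
  show "mult_t (K_check R n (m + 1)) = K_check R (n + 1) m"
    by (rule unit_gap_unique[OF H_check_closed H_check_closed H_check_sub_plus e_plus_H_check K_check_gap])
       (use g in \<open>auto simp: unit_gap_def\<close>)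
qed

lemma Kt_check_shift: "Kt_check R (n + 1) m = mult_t (Kt_check R n (m + 1))"
proof (rule sym)
  have "unit_gap (H_check R (n + 1) m) (H_check R (n + 1) (m + 1)) (mult_t (e_minus R (m + 1 + 1))) (mult_t (Kt_check R n (m + 1)))"
    by (rule unit_gap_mult_t[OF Kt_check_gap H_check_subset_LR H_check_subset_LR
          H_check_LR[OF e_minus_H_check] mult_t_H_check mult_t_H_check])
  then have g: "unit_gap (H_check R (n + 1) m) (H_check R (n + 1) (m + 1)) (e_minus R (m + 1)) (mult_t (Kt_check R n (m + 1)))"
    by (simp only: mult_t_e_minus)
  show "mult_t (Kt_check R n (m + 1)) = Kt_check R (n + 1) m"
    by (rule unit_gap_unique[OF H_check_closed H_check_closed H_check_sub_minus e_minus_H_check Kt_check_gap])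
       (use g in \<open>auto simp: unit_gap_def\<close>)
qed

text \<open>The disk functions are evaluated at (j, 0) while the recurrence is wanted at every (n,
  m); quantities constant along n + m = j link the two. The induction runs in both directions since
  m is an integer.\<close>

lemma diagonal_invariant:
  fixes f :: "int \<Rightarrow> int \<Rightarrow> 'b"
  assumes "\<And>n m. f (n + 1) m = f n (m + 1)"
  shows "f n m = f (n + m) 0"
proof (induction m arbitrary: n rule: int_induct[where k = 0])
  case (step1 m)
  then show ?case
    using assms[of n m] step1.IH[of "n + 1"] by (simp add: algebra_simps)
next
  case (step2 m)
  then show ?case
    using assms[of "n - 1" "m - 1"] step2.IH[of "n - 1"] by (simp add: algebra_simps)
qed simp

lemma ip_K_Kt_diagonal:
  "ip R (K_check R n m) (Kt_check R n m) = ip R (K_check R (n + m) 0) (Kt_check R (n + m) 0)"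
  by (rule diagonal_invariant) (simp add: K_check_shift Kt_check_shift ip_mult_t K_check_LR Kt_check_LR)

lemma ip_e_K_diagonal:
  "ip R (e_plus R n) (K_check R n m) = ip R (e_plus R (n + m)) (K_check R (n + m) 0)"
  by (rule diagonal_invariant)
     (simp add: K_check_shift ip_mult_t K_check_LR H_check_LR[OF e_plus_H_check] flip: mult_t_e_plus)

section \<open>Values of a and omega at 0, and the recurrence\<close>

lemma resolv_0: "g \<in> M \<Longrightarrow> resolv M A 0 g = g"
  unfolding resolv_def by (rule the_equality) auto

lemma a_check_0: "a_check R j 0 = ip R (e_plus R j) (K_check R j 0)"
  by (simp add: a_check_def a_nm_def resolv_0 e_plus_H_check)

lemma adj_eqI:
  assumes "M \<subseteq> LR R" "\<And>f g. f \<in> M \<Longrightarrow> g \<in> M \<Longrightarrow> f - g \<in> M"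
    and "h \<in> M" "\<And>f. f \<in> M \<Longrightarrow> ip R (A f) g = ip R f h"
  shows "adj R M A g = h"
  unfolding adj_def
proof (rule the_equality)
  fix h' assume h': "h' \<in> M \<and> (\<forall>f\<in>M. ip R (A f) g = ip R f h')"
  define d where "d = h' - h"
  have d: "d \<in> M" "d \<in> LR R" "h \<in> LR R" "h' \<in> LR R"
    using h' assms(1-3) by (auto simp: d_def)
  have "ip R d h' = ip R d h"
    using h' assms(4) d(1) by metis
  then have "ip R d d = 0"
    using d by (subst (2) d_def) (simp add: inn_simps)
  then have "d = 0"
    using d inn_eq_0 by blast
  then show "h' = h"
    by (simp add: d_def)
qed (use assms in blast)

lemma U_adj_eq: "g \<in> LR R \<Longrightarrow> U_adj R g = mult_cnj_t g"
  unfolding U_adj_def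
proof (rule adj_eqI)
  assume g: "g \<in> LR R"
  show h: "mult_cnj_t g \<in> LR R"
    using g LR_mult_t_iff[of "mult_cnj_t g"] by simp
  show "ip R (mult_t f) g = ip R f (mult_cnj_t g)" if "f \<in> LR R" for f
    using ip_mult_t[OF that h] by simp
qed simp_all

text \<open>At \<zeta> = 0 the resolvent term of omega carries the factor 0, and U^* moves K(j+1,0)
  to K(j,1).\<close>

lemma alpha_check_eq_aux:
  "alpha_check R j = - ip R (K_check R j 1) (Kt_check R (j + 1) 0)"
proof -
  have "K_check R (j + 1) 0 = mult_t (K_check R j 1)"
    using K_check_shift[of j 0] by simp
  then have "U_adj R (K_check R (j + 1) 0) = K_check R j 1"
    using U_adj_eq[OF K_check_LR[of "j + 1" 0]] by simp
  then show ?thesis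
    by (simp add: alpha_check_def omega_check_def omega_nm_def)
qed

text \<open>\<open>Szego_recurrence\<close> with M = H(n,m), N1 = H(n+1,m), N2 = H(n,m+1), N12 =
  H(n+1,m+1). The same normalizing vector \<open>e_plus R n\<close> serves for both K(n,m) and
  K(n,m+1), and \<open>e_minus R (m + 1)\<close> for both Kt(n,m) and Kt(n+1,m).\<close>

lemma recurrence:
  defines "\<alpha> \<equiv> \<lambda>n m. ip R (K_check R n m) (Kt_check R n m)"
    and "\<rho> \<equiv> \<lambda>n m. ip R (e_plus R n) (K_check R n m) / ip R (e_plus R n) (K_check R n (m + 1))"
  shows "K_check R n m = \<alpha> n m *\<^sub>C Kt_check R n m + \<rho> n m *\<^sub>C K_check R n (m + 1)"
    and "Kt_check R (n + 1) m = \<rho> n m *\<^sub>C Kt_check R n m + (- cnj (\<alpha> n m)) *\<^sub>C K_check R n (m + 1)"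
    and "0 < \<rho> n m" "norm (\<alpha> n m) < 1" "\<rho> n m = complex_of_real (sqrt (1 - (norm (\<alpha> n m))\<^sup>2))"
    and "ip R (K_check R n (m + 1)) (Kt_check R (n + 1) m) = - \<alpha> n m"
  unfolding \<alpha>_def \<rho>_def
  by (rule Szego_recurrence[OF H_check_closed H_check_closed H_check_closed H_check_closed
        H_check_sub_plus H_check_sub_minus H_check_sub_minus H_check_sub_plus
        K_check_gap K_check_gap Kt_check_gap Kt_check_gap e_plus_H_check e_minus_H_check])+

text \<open>The sign in \<open>alpha_check\<close> cancels the one in the last relation of
  \<open>recurrence\<close>, which concerns the very pair K(n,m+1), Kt(n+1,m) that omega at 0
  produces.\<close>

lemma alpha_check_eq: "alpha_check R (n + m) = ip R (K_check R n m) (Kt_check R n m)"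
  using recurrence(6)[of "n + m" 0] by (simp add: alpha_check_eq_aux ip_K_Kt_diagonal[of n m])

lemma rho_check_eq:
  "rho_check R (n + m) = ip R (e_plus R n) (K_check R n m) / ip R (e_plus R n) (K_check R n (m + 1))"
  using ip_e_K_diagonal[of n m] ip_e_K_diagonal[of n "m + 1"]
  by (simp add: rho_check_def a_check_0 add.assoc)

section \<open>The adjoint of A_0 and the limit of b/\<zeta> at 0\<close>

lemma proj_H_check_minus:
  assumes f: "f \<in> H_check R n m"
  shows "proj R (H_check R n (m + 1)) f = f - ip R f (Kt_check R n m) *\<^sub>C Kt_check R n m"
  unfolding proj_def
proof (rule the_equality)
  let ?N = "H_check R n (m + 1)" and ?k = "Kt_check R n m"
  have k: "\<And>g. g \<in> ?N \<Longrightarrow> ip R ?k g = 0" "f - ip R f ?k *\<^sub>C ?k \<in> ?N"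
    using Kt_check_gap[of n m] f by (auto simp: unit_gap_def)
  note N = H_check_closed[of n "m + 1"]
  have orth: "ip R (ip R f ?k *\<^sub>C ?k) g = 0" if "g \<in> ?N" for g
    using k(1)[OF that] Kt_check_LR H_check_LR[OF that] by (simp add: inn_scale_left)
  have "f - (f - ip R f ?k *\<^sub>C ?k) = ip R f ?k *\<^sub>C ?k"
    by simp
  then show "f - ip R f ?k *\<^sub>C ?k \<in> ?N \<and> f - (f - ip R f ?k *\<^sub>C ?k) \<in> ominus R (LR R) ?N"
    using k(2) orth Kt_check_LR unfolding ominus_def by simp
  fix g assume g: "g \<in> ?N \<and> f - g \<in> ominus R (LR R) ?N"
  define d where "d = g - (f - ip R f ?k *\<^sub>C ?k)"
  have d: "d \<in> ?N"
    unfolding d_def by (rule subspace_diff[OF N _ k(2)]) (use g in blast)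
  have H: "d \<in> LR R" "g \<in> LR R" "f \<in> LR R"
    using H_check_LR[OF d] H_check_LR[OF f] g H_check_LR by auto
  have "ip R (f - g) d = 0"
    using g d by (simp add: ominus_def)
  moreover have "d = ip R f ?k *\<^sub>C ?k - (f - g)"
    by (simp add: d_def)
  then have "ip R d d = ip R (ip R f ?k *\<^sub>C ?k) d - ip R (f - g) d"
    using H Kt_check_LR by (metis diff_closed inn_diff_left scale_closed)
  ultimately have "ip R d d = 0"
    using orth[OF d] by simp
  then have "d = 0"
    using H(1) inn_eq_0 by blast
  then show "g = f - ip R f ?k *\<^sub>C ?k"
    by (simp add: d_def)
qed

text \<open>\<open>A0\<close> annihilates Kt and maps H(n,m+1) isometrically onto H(n+1,m), so it is
  a partial isometry. Its adjoint projects to H(n+1,m), by removing the component along K, and then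
  multiplies by cnj t.\<close>

definition A0_star :: "int \<Rightarrow> int \<Rightarrow> L0 \<Rightarrow> L0" where
  "A0_star n m g = mult_cnj_t (g - ip R g (K_check R n m) *\<^sub>C K_check R n m)"

lemma A0_star_in_H_check:
  assumes g: "g \<in> H_check R n m"
  shows "A0_star n m g \<in> H_check R n (m + 1)"
  unfolding A0_star_def using K_check_gap[of n m] g by (intro mult_cnj_t_H_check) (auto simp: unit_gap_def)

lemma A0_adj_eq:
  assumes g: "g \<in> H_check R n m"
  shows "A0_adj R n m g = A0_star n m g"
  unfolding A0_adj_def
proof (rule adj_eqI)
  show "H_check R n m \<subseteq> LR R"
    by (rule H_check_subset_LR)
  show "f - h \<in> H_check R n m" if "f \<in> H_check R n m" "h \<in> H_check R n m" for f h
    by (rule subspace_diff[OF H_check_closed that])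
  show "A0_star n m g \<in> H_check R n m"
    using A0_star_in_H_check[OF g] H_check_sub_minus by blast
  fix f assume f: "f \<in> H_check R n m"
  let ?k = "K_check R n m" and ?kt = "Kt_check R n m"
  define p where "p = f - ip R f ?kt *\<^sub>C ?kt"
  have p: "p \<in> H_check R n (m + 1)" and kt: "\<And>h. h \<in> H_check R n (m + 1) \<Longrightarrow> ip R ?kt h = 0"
    using Kt_check_gap[of n m] f by (auto simp: unit_gap_def p_def)
  have Up: "mult_t p \<in> H_check R (n + 1) m"
    using p by (simp add: mult_t_H_check)
  have k: "ip R ?k (mult_t p) = 0"
    using K_check_gap[of n m] Up by (auto simp: unit_gap_def)
  note H = H_check_LR[OF f] H_check_LR[OF g] H_check_LR[OF p] H_check_LR[OF Up]
    K_check_LR[of n m] Kt_check_LR[of n m] H_check_LR[OF A0_star_in_H_check[OF g]]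
  have k': "ip R (mult_t p) ?k = 0"
    using inn_commute[OF H(5,4)] k by simp
  have "A0 R n m f = mult_t p"
    using f by (simp add: A0_def proj_H_check_minus p_def)
  then have "ip R (A0 R n m f) g = ip R (mult_t p) (g - ip R g ?k *\<^sub>C ?k)"
    using H k' by (simp add: inn_simps)
  also have "g - ip R g ?k *\<^sub>C ?k = mult_t (A0_star n m g)"
    by (simp add: A0_star_def)
  also have "ip R (mult_t p) (mult_t (A0_star n m g)) = ip R p (A0_star n m g)"
    by (rule ip_mult_t) (rule H)+
  also have "\<dots> = ip R f (A0_star n m g)"
    using H kt[OF A0_star_in_H_check[OF g]] by (simp add: p_def inn_simps)
  finally show "ip R (A0 R n m f) g = ip R f (A0_star n m g)" .
qed

lemma mult_cnj_t_diff: "mult_cnj_t (f - g) = mult_cnj_t f - mult_cnj_t g"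
  using mult_t_diff[of "mult_cnj_t f" "mult_cnj_t g"] by (metis mult_t_mult_cnj_t)

lemma nm_A0_star_le:
  assumes g: "g \<in> H_check R n m"
  shows "nm (A0_star n m g) \<le> nm g"
proof -
  let ?k = "K_check R n m"
  define r where "r = g - ip R g ?k *\<^sub>C ?k"
  note H = H_check_LR[OF g] K_check_LR[of n m]
  have rH: "r \<in> LR R"
    using H by (simp add: r_def)
  have kk: "ip R ?k ?k = 1"
    using K_check_gap[of n m] H by (simp add: unit_gap_def inn_self)
  have "ip R r ?k = 0"
    using H kk by (simp add: r_def inn_simps)
  moreover have "g = r + ip R g ?k *\<^sub>C ?k"
    by (simp add: r_def)
  ultimately have "(nm g)\<^sup>2 = (nm r)\<^sup>2 + (nm (ip R g ?k *\<^sub>C ?k))\<^sup>2"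
    using nm_add_power2[of r "ip R g ?k *\<^sub>C ?k"] rH H by (simp add: inn_scale_right)
  then have "(nm r)\<^sup>2 \<le> (nm g)\<^sup>2"
    by simp
  then have "nm r \<le> nm g"
    by (rule power2_le_imp_le) (use H in simp)
  moreover have "nm (A0_star n m g) = nm r"
    using nm_mult_t[OF H_check_LR[OF A0_star_in_H_check[OF g]]] by (simp add: A0_star_def r_def)
  ultimately show ?thesis
    by simp
qed

lemma b_check_tendsto: "((\<lambda>\<zeta>. b_check R j \<zeta> / \<zeta>) \<longlongrightarrow> cnj (alpha_check R j)) (at 0)"
proof -
  let ?M = "H_check R j 0" and ?k = "K_check R j 0" and ?kt = "Kt_check R j 0"
  define F where "F \<zeta> = resolv ?M (A0_adj R j 0) \<zeta> ?kt" for \<zeta>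
  have A_eq: "A0_adj R j 0 f = A0_star j 0 f" if "f \<in> ?M" for f
    by (rule A0_adj_eq[OF that])
  have A: "\<And>f. f \<in> ?M \<Longrightarrow> A0_adj R j 0 f \<in> ?M"
    "\<And>f. f \<in> ?M \<Longrightarrow> nm (A0_adj R j 0 f) \<le> nm f"
    using A0_star_in_H_check[of _ j 0] H_check_sub_minus[of j 0] nm_A0_star_le[of _ j 0] by (auto simp: A_eq)
  have A_diff: "A0_adj R j 0 (f - g) = A0_adj R j 0 f - A0_adj R j 0 g" if "f \<in> ?M" "g \<in> ?M" for f g
  proof -
    have "f - g \<in> ?M"
      by (rule subspace_diff[OF H_check_closed that])
    moreover have "A0_star j 0 (f - g) = A0_star j 0 f - A0_star j 0 g"
      using that H_check_LR K_check_LR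
      by (simp add: A0_star_def inn_diff_left scale_diff_left algebra_simps flip: mult_cnj_t_diff)
    ultimately show ?thesis
      using that by (simp add: A_eq)
  qed
  \<comment> \<open>Unique solvability, which gives \<open>resolv\<close> its meaning for |\<zeta>|
    < 1, comes from \<open>A0_adj\<close> being an additive contraction of H(j,0).\<close>
  have F: "F \<zeta> \<in> ?M \<and> F \<zeta> - \<zeta> *\<^sub>C A0_adj R j 0 (F \<zeta>) = ?kt" if "norm \<zeta> < 1" for \<zeta>
    unfolding F_def resolv_def
    by (rule theI') (rule contraction_resolvent[OF H_check_closed A(1) A_diff A(2) that Kt_check_in])
  have "((\<lambda>\<zeta>. ip R (F \<zeta>) ?k) \<longlongrightarrow> ip R ?kt ?k) (at 0)"
    by (rule resolvent_tendsto[OF H_check_closed A F Kt_check_in K_check_LR])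
  moreover have "\<forall>\<^sub>F \<zeta> in at 0. ip R (F \<zeta>) ?k = b_check R j \<zeta> / \<zeta>"
    unfolding eventually_at_filter by (simp add: b_check_def b_nm_def F_def)
  ultimately have "((\<lambda>\<zeta>. b_check R j \<zeta> / \<zeta>) \<longlongrightarrow> ip R ?kt ?k) (at 0)"
    by (rule Lim_transform_eventually)
  also have "ip R ?kt ?k = cnj (alpha_check R j)"
    using alpha_check_eq[of j 0] inn_commute[OF K_check_LR[of j 0] Kt_check_LR[of j 0]] by simp
  finally show ?thesis .
qed

end

theorem mainTheorem2:
  fixes R :: "complex \<Rightarrow> complex"
  assumes "R \<in> borel_measurable circle_measure"
    and "AE t in circle_measure. norm (R t) \<le> 1"
    and "log_integrable (\<lambda>t. 1 - norm (R t))"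
  shows "(\<forall>n m :: int.
            K_check R n m =
              alpha_check R (n + m) *\<^sub>C Kt_check R n m
              + rho_check R (n + m) *\<^sub>C K_check R n (m + 1) \<and>
            Kt_check R (n + 1) m =
              rho_check R (n + m) *\<^sub>C Kt_check R n m
              + (- cnj (alpha_check R (n + m))) *\<^sub>C K_check R n (m + 1)) \<and>
         (\<forall>j :: int.
            0 < rho_check R j \<and>
            ((\<lambda>\<zeta>. b_check R j \<zeta> / \<zeta>) \<longlongrightarrow> cnj (alpha_check R j)) (at 0) \<and>
            norm (alpha_check R j) < 1 \<and>
            rho_check R j = complex_of_real (sqrt (1 - (norm (alpha_check R j))\<^sup>2)))"
proof -
  interpret scattering R
    using assms by unfold_locales
  note rec = recurrence[folded alpha_check_eq rho_check_eq]
  show ?thesis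
  proof (intro conjI allI)
    fix n m
    show "K_check R n m = alpha_check R (n + m) *\<^sub>C Kt_check R n m + rho_check R (n + m) *\<^sub>C K_check R n (m + 1)"
      by (rule rec)
    show "Kt_check R (n + 1) m =
        rho_check R (n + m) *\<^sub>C Kt_check R n m + (- cnj (alpha_check R (n + m))) *\<^sub>C K_check R n (m + 1)"
      by (rule rec)
  next
    fix j
    \<comment> \<open>Every j is of the form n + m, with n = j and m = 0.\<close>
    show "0 < rho_check R j" "norm (alpha_check R j) < 1"
      "rho_check R j = complex_of_real (sqrt (1 - (norm (alpha_check R j))\<^sup>2))"
      using rec(3-5)[of j 0] by simp_all
    show "((\<lambda>\<zeta>. b_check R j \<zeta> / \<zeta>) \<longlongrightarrow> cnj (alpha_check R j)) (at 0)"
      by (rule b_check_tendsto)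
  qed
qed

end
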